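(* Let $\delta$ be the distance on the unit ball $\mathbb{B}$ of the quaternions given by $$\delta(p,q)=\sqrt{1-\left|\left\langle \frac{k_q}{\|k_q\|_{H^2(\mathbb{B})}},\frac{k_p}{\|k_p\|_{H^2(\mathbb{B})}}\right\rangle_{H^2(\mathbb{B})}\right|^2},\qquad p,q\in\mathbb{B},$$ where $k_w(q)=\sum_{n\ge0}q^n\overline{w}^n$ is the reproducing kernel of the quaternionic Hardy space $H^2(\mathbb{B})$. **(I)** The length metric associated with $\delta$ is (the distance of) the Riemannian metric $g$ on $\mathbb{B}$ defined as follows. For $w=x+yI_w\in\mathbb{B}$ lying in the slice $L_{I_w}$, identify $T_w\mathbb{B}$ with $\mathbb{H}$ and decompose $d\in T_w\mathbb{B}$ as $d=d_1+d_2$ with $d_1\in L_{I_w}$ and $d_2\in L_{I_w}^\perp$, the orthogonal complement of $L_{I_w}$ with respect to the Euclidean metric of $\mathbb{H}$. Then $$|d|_{g(w)}^2=\frac{1}{(1-|w|^2)^2}|d_1|^2+\frac{1}{|1-w^2|^2}|d_2|^2.$$ **(II)** The isometry group of $(\mathbb{B},g)$ is the group generated by the following classes of self-maps of $\mathbb{B}$: (a) the maps $q\mapsto M_\lambda(q)=(1-q\lambda)^{-*}*(q-\lambda)=\dfrac{q-\lambda}{1-\lambda q}$, with $\lambda\in(-1,1)$; (b) the maps $q=x+yI\mapsto T_A(q)=x+yA(I)$ (with $x,y\in\mathbb{R}$, $y\ge 0$, $I\in\mathbb{S}$), where $A:\mathbb{S}\to\mathbb{S}$ is an isometry of $\mathbb{S}$;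 (c) the reflection $q\mapsto R(q)=-\overline{q}$.
   Context: $\mathbb{H}$ is the skew-field of quaternions with its Euclidean norm $|\cdot|$ and conjugation $q\mapsto\overline q$; $\mathbb{B}=\{q\in\mathbb{H}:|q|<1\}$; $\mathbb{S}=\{q\in\mathbb{H}: q^2=-1\}$ is the two-sphere of imaginary units, with its round metric; for $I\in\mathbb{S}$, the slice $L_I=L_{-I}$ is $\mathbb{R}+\mathbb{R}I$. Every $q\in\mathbb{H}$ is $q=x+yI$ with $x,y\in\mathbb{R}$, $I\in\mathbb{S}$; if $q=w$ is real, $I_w$ may be any element of $\mathbb{S}$ (the formula for $g$ does not depend on the choice). The quaternionic Hardy space $H^2(\mathbb{B})$ is the space of power series $f(q)=\sum_{n\ge0}q^na_n$, $a_n\in\mathbb{H}$, with $\|f\|_{H^2(\mathbb{B})}^2=\sum|a_n|^2<\infty$, and inner product $\langle\sum q^na_n,\sum q^nb_n\rangle_{H^2(\mathbb{B})}=\sum\overline{b_n}a_n$. One has $f(w)=\langle f,k_w\rangle_{H^2(\mathbb{B})}$ for all $f\in H^2(\mathbb{B})$, $w\in\mathbb{B}$. The $*$-product of power series is $(\sum q^na_n)*(\sum q^nb_n)=\sum q^n\sum_{k=0}^na_kb_{n-k}$ and $f^{-*}$ is the inverse for $*$. The length metric associated with a distance $\delta_0$ assigns to two points the infimum of the $\delta_0$-lengths of curves joining them, where the $\delta_0$-length of a curve is the supremum of the sums of $\delta_0$-distances between consecutive points over partitions of the curve. *)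

theory Defs
  imports
    "HOL-Analysis.Analysis"
    "HOL-Computational_Algebra.Formal_Power_Series"
    "HOL-Algebra.Bij"
    "HOL-Algebra.Generated_Groups"
begin

section \<open>Quaternions\<close>

datatype quat = Quat (qre: real) (qim1: real) (qim2: real) (qim3: real)

lemma quat_eq_iff:
  "p = q \<longleftrightarrow> qre p = qre q \<and> qim1 p = qim1 q \<and> qim2 p = qim2 q \<and> qim3 p = qim3 q"
  by (cases p; cases q) simp

instantiation quat :: ring_1
begin

definition "0 = Quat 0 0 0 0"
definition "1 = Quat 1 0 0 0"
definition "p + q = Quat (qre p + qre q) (qim1 p + qim1 q) (qim2 p + qim2 q) (qim3 p + qim3 q)"
definition "p - q = Quat (qre p - qre q) (qim1 p - qim1 q) (qim2 p - qim2 q) (qim3 p - qim3 q)"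
definition "- q = Quat (- qre q) (- qim1 q) (- qim2 q) (- qim3 q)"
definition "p * q = Quat
  (qre p * qre q - qim1 p * qim1 q - qim2 p * qim2 q - qim3 p * qim3 q)
  (qre p * qim1 q + qim1 p * qre q + qim2 p * qim3 q - qim3 p * qim2 q)
  (qre p * qim2 q - qim1 p * qim3 q + qim2 p * qre q + qim3 p * qim1 q)
  (qre p * qim3 q + qim1 p * qim2 q - qim2 p * qim1 q + qim3 p * qre q)"

instance
  by standard
    (simp_all add: quat_eq_iff zero_quat_def one_quat_def plus_quat_def minus_quat_def
      uminus_quat_def times_quat_def algebra_simps)

end

lemma quat_sel [simp]:
  "qre 0 = 0" "qim1 0 = 0" "qim2 0 = 0" "qim3 0 = 0"
  "qre 1 = 1" "qim1 1 = 0" "qim2 1 = 0" "qim3 1 = 0"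
  "qre (p + q) = qre p + qre q" "qim1 (p + q) = qim1 p + qim1 q"
  "qim2 (p + q) = qim2 p + qim2 q" "qim3 (p + q) = qim3 p + qim3 q"
  "qre (p - q) = qre p - qre q" "qim1 (p - q) = qim1 p - qim1 q"
  "qim2 (p - q) = qim2 p - qim2 q" "qim3 (p - q) = qim3 p - qim3 q"
  "qre (- q) = - qre q" "qim1 (- q) = - qim1 q" "qim2 (- q) = - qim2 q" "qim3 (- q) = - qim3 q"
  by (simp_all add: zero_quat_def one_quat_def plus_quat_def minus_quat_def uminus_quat_def)

lemma quat_sel_times:
  "qre (p * q) = qre p * qre q - qim1 p * qim1 q - qim2 p * qim2 q - qim3 p * qim3 q"
  "qim1 (p * q) = qre p * qim1 q + qim1 p * qre q + qim2 p * qim3 q - qim3 p * qim2 q"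
  "qim2 (p * q) = qre p * qim2 q - qim1 p * qim3 q + qim2 p * qre q + qim3 p * qim1 q"
  "qim3 (p * q) = qre p * qim3 q + qim1 p * qim2 q - qim2 p * qim1 q + qim3 p * qre q"
  by (simp_all add: times_quat_def)

definition qcnj :: "quat \<Rightarrow> quat"
  where "qcnj q = Quat (qre q) (- qim1 q) (- qim2 q) (- qim3 q)"

lemma qcnj_sel [simp]:
  "qre (qcnj q) = qre q" "qim1 (qcnj q) = - qim1 q"
  "qim2 (qcnj q) = - qim2 q" "qim3 (qcnj q) = - qim3 q"
  by (simp_all add: qcnj_def)

lemma qcnj_qcnj [simp]: "qcnj (qcnj q) = q"
  by (simp add: quat_eq_iff)

lemma qcnj_mult: "qcnj (p * q) = qcnj q * qcnj p"
  by (simp add: quat_eq_iff quat_sel_times)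

lemma qcnj_one [simp]: "qcnj 1 = 1"
  by (simp add: quat_eq_iff)

lemma qcnj_power: "qcnj (q ^ n) = qcnj q ^ n"
  by (induction n) (simp_all add: qcnj_mult power_commutes)

instantiation quat :: real_algebra_1
begin

definition "scaleR r q = Quat (r * qre q) (r * qim1 q) (r * qim2 q) (r * qim3 q)"

instance
  by standard (simp_all add: quat_eq_iff scaleR_quat_def quat_sel_times algebra_simps)

end

lemma quat_sel_scaleR [simp]:
  "qre (r *\<^sub>R q) = r * qre q" "qim1 (r *\<^sub>R q) = r * qim1 q"
  "qim2 (r *\<^sub>R q) = r * qim2 q" "qim3 (r *\<^sub>R q) = r * qim3 q"
  by (simp_all add: scaleR_quat_def)

lemma quat_sel_of_real [simp]:
  "qre (of_real r) = r" "qim1 (of_real r) = 0" "qim2 (of_real r) = 0" "qim3 (of_real r) = 0"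
  by (simp_all add: of_real_def)

instantiation quat :: real_inner
begin

definition "inner p q = qre p * qre q + qim1 p * qim1 q + qim2 p * qim2 q + qim3 p * qim3 q"
definition norm_quat :: "quat \<Rightarrow> real" where "norm_quat q = sqrt (inner q q)"
definition sgn_quat :: "quat \<Rightarrow> quat" where "sgn_quat q = q /\<^sub>R norm q"
definition dist_quat :: "quat \<Rightarrow> quat \<Rightarrow> real" where "dist_quat p q = norm (p - q)"
definition uniformity_quat :: "(quat \<times> quat) filter"
  where "uniformity_quat = (INF e\<in>{0<..}. principal {(p, q). dist p q < e})"
definition open_quat :: "quat set \<Rightarrow> bool"
  where "open_quat U \<longleftrightarrow> (\<forall>x\<in>U. eventually (\<lambda>(x', y). x' = x \<longrightarrow> y \<in> U) uniformity)"

instance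
proof
  fix p :: quat
  show "0 \<le> inner p p"
    by (simp add: inner_quat_def)
  show "inner p p = 0 \<longleftrightarrow> p = 0"
  proof
    assume "inner p p = 0"
    then have "(qre p)\<^sup>2 + (qim1 p)\<^sup>2 + (qim2 p)\<^sup>2 + (qim3 p)\<^sup>2 = 0"
      by (simp add: inner_quat_def power2_eq_square)
    moreover have "0 \<le> (qre p)\<^sup>2" "0 \<le> (qim1 p)\<^sup>2" "0 \<le> (qim2 p)\<^sup>2" "0 \<le> (qim3 p)\<^sup>2"
      by simp_all
    ultimately have "(qre p)\<^sup>2 = 0" "(qim1 p)\<^sup>2 = 0" "(qim2 p)\<^sup>2 = 0" "(qim3 p)\<^sup>2 = 0"
      by linarith+
    then show "p = 0"
      by (simp add: quat_eq_iff)
  qed (simp add: inner_quat_def)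
qed (simp_all add: inner_quat_def norm_quat_def sgn_quat_def dist_quat_def uniformity_quat_def
      open_quat_def algebra_simps)

end

lemma norm_quat_sq: "(norm q)\<^sup>2 = (qre q)\<^sup>2 + (qim1 q)\<^sup>2 + (qim2 q)\<^sup>2 + (qim3 q)\<^sup>2"
  for q :: quat
  unfolding power2_norm_eq_inner inner_quat_def by (simp add: power2_eq_square)

instance quat :: real_normed_algebra_1
proof
  fix p q :: quat
  have "(norm (p * q))\<^sup>2 = (norm p * norm q)\<^sup>2"
    unfolding power_mult_distrib norm_quat_sq quat_sel_times by algebra
  then show "norm (p * q) \<le> norm p * norm q"
    by (simp add: power2_eq_iff_nonneg)
  show "norm (1 :: quat) = 1"
    by (simp add: norm_quat_def inner_quat_def)
qed

instantiation quat :: real_normed_div_algebra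
begin

definition "inverse q = qcnj q /\<^sub>R (norm q)\<^sup>2"
definition divide_quat :: "quat \<Rightarrow> quat \<Rightarrow> quat" where "divide_quat p q = p * inverse q"

instance
proof
  fix p q :: quat
  have n: "qcnj p * p = (norm p)\<^sup>2 *\<^sub>R 1" "p * qcnj p = (norm p)\<^sup>2 *\<^sub>R 1"
    unfolding norm_quat_sq by (simp_all add: quat_eq_iff quat_sel_times power2_eq_square)
  show "inverse p * p = 1" "p * inverse p = 1" if "p \<noteq> 0"
    unfolding inverse_quat_def mult_scaleR_left mult_scaleR_right n using that by simp_all
  show "p div q = p * inverse q"
    by (simp add: divide_quat_def)
  show "inverse (0::quat) = 0"
    by (simp add: inverse_quat_def)
  have "(norm (p * q))\<^sup>2 = (norm p * norm q)\<^sup>2"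
    unfolding power_mult_distrib norm_quat_sq quat_sel_times by algebra
  then show "norm (p * q) = norm p * norm q"
    by (simp add: power2_eq_iff_nonneg)
qed

end

instantiation quat :: euclidean_space
begin

definition "Basis = {Quat 1 0 0 0, Quat 0 1 0 0, Quat 0 0 1 0, Quat 0 0 0 1}"

instance
proof
  show "u \<bullet> v = (if u = v then 1 else 0)" if "u \<in> Basis" "v \<in> Basis" for u v :: quat
    using that unfolding Basis_quat_def inner_quat_def by (elim insertE emptyE) simp_all
  show "(\<forall>u\<in>Basis. x \<bullet> u = 0) \<longleftrightarrow> x = 0" for x :: quat
    by (simp add: Basis_quat_def inner_quat_def quat_eq_iff [of x])
qed (simp_all add: Basis_quat_def)

end

lemma norm_qcnj [simp]: "norm (qcnj q) = norm q"
  by (simp add: norm_quat_def inner_quat_def)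

definition quat_ball :: "quat set"  (\<open>\<bool>\<close>)
  where "\<bool> = ball 0 1"

definition imag_units :: "quat set"  (\<open>\<S>\<close>)
  where "\<S> = {q. q\<^sup>2 = - 1}"

definition slice :: "quat \<Rightarrow> quat set"
  where "slice I = {of_real x + of_real y * I |x y. True}"

lemma imag_units_iff: "I \<in> \<S> \<longleftrightarrow> qre I = 0 \<and> norm I = 1"
proof
  assume "I \<in> \<S>"
  then have sq: "I * I = - 1"
    by (simp add: imag_units_def power2_eq_square)
  then have "(norm I)\<^sup>2 = 1"
    by (metis norm_minus_cancel norm_mult norm_one power2_eq_square)
  then have n: "norm I = 1"
    by (simp add: abs_square_eq_1)
  have "qre (I * I) = - 1"
    using sq by simp
  moreover have "(qre I)\<^sup>2 + (qim1 I)\<^sup>2 + (qim2 I)\<^sup>2 + (qim3 I)\<^sup>2 = 1"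
    using norm_quat_sq [of I] n by simp
  ultimately have "(qre I)\<^sup>2 = 0"
    unfolding quat_sel_times power2_eq_square by linarith
  then show "qre I = 0 \<and> norm I = 1"
    using n by simp
next
  assume I: "qre I = 0 \<and> norm I = 1"
  then have "(qim1 I)\<^sup>2 + (qim2 I)\<^sup>2 + (qim3 I)\<^sup>2 = 1"
    using norm_quat_sq [of I] by simp
  then have "I * I = - 1"
    using I by (simp add: quat_eq_iff quat_sel_times power2_eq_square algebra_simps)
  then show "I \<in> \<S>"
    by (simp add: imag_units_def power2_eq_square)
qed

lemma quat_polar_ex:
  obtains x y I where "0 \<le> y" "I \<in> \<S>" "q = of_real x + of_real y * I"
proof (cases "q = of_real (qre q)")
  case True
  have "Quat 0 1 0 0 \<in> \<S>"
    by (simp add: imag_units_iff norm_quat_def inner_quat_def)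
  with True that [of 0 "Quat 0 1 0 0" "qre q"] show ?thesis
    by simp
next
  case False
  define v where "v = q - of_real (qre q)"
  have v: "v \<noteq> 0" "qre v = 0"
    using False by (simp_all add: v_def)
  then have "v /\<^sub>R norm v \<in> \<S>"
    by (simp add: imag_units_iff)
  moreover have "q = of_real (qre q) + of_real (norm v) * (v /\<^sub>R norm v)"
    using v by (simp add: v_def scaleR_conv_of_real mult.assoc [symmetric] flip: of_real_mult)
  ultimately show ?thesis
    using that norm_ge_zero by blast
qed

section \<open>The Hardy space and the distance it induces on the ball\<close>

text \<open>
  A power series \<open>\<Sum>n. q\<^sup>n a\<^sub>n\<close> is represented by the formal power series of its coefficients.
  On \<^typ>\<open>quat fps\<close> the library product is the Cauchy product \<open>\<Sum>k\<le>n. a\<^sub>k b\<^sub>n\<^sub>-\<^sub>k\<close>, i.e. the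
  \<open>*\<close>-product (the indeterminate is central), and \<^const>\<open>inverse\<close> is the two-sided inverse
  for it whenever the constant coefficient is nonzero.  Evaluation puts the coefficients on the
  right, unlike \<^const>\<open>eval_fps\<close>.
\<close>

definition series_at :: "quat fps \<Rightarrow> quat \<Rightarrow> quat"
  where "series_at f q = (\<Sum>n. q ^ n * fps_nth f n)"

definition hardy_space :: "quat fps set"
  where "hardy_space = {f. summable (\<lambda>n. (norm (fps_nth f n))\<^sup>2)}"

definition hardy_inner :: "quat fps \<Rightarrow> quat fps \<Rightarrow> quat"
  where "hardy_inner f g = (\<Sum>n. qcnj (fps_nth g n) * fps_nth f n)"

definition hardy_norm :: "quat fps \<Rightarrow> real"
  where "hardy_norm f = sqrt (\<Sum>n. (norm (fps_nth f n))\<^sup>2)"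

definition hardy_kernel :: "quat \<Rightarrow> quat fps"
  where "hardy_kernel w = Abs_fps (\<lambda>n. qcnj w ^ n)"

lemma hardy_kernel_in_hardy_space: "hardy_kernel w \<in> hardy_space" if "w \<in> \<bool>"
proof -
  have "(norm (qcnj w ^ n))\<^sup>2 = ((norm w)\<^sup>2) ^ n" for n
    by (simp add: norm_power power_mult [symmetric] mult.commute)
  moreover have "(norm w)\<^sup>2 < 1"
    using that by (simp add: quat_ball_def power_less_one_iff)
  ultimately show ?thesis
    by (simp add: hardy_space_def hardy_kernel_def)
qed

lemma series_at_eq_hardy_inner: "series_at f w = hardy_inner f (hardy_kernel w)"
  by (simp add: series_at_def hardy_inner_def hardy_kernel_def qcnj_power)

definition normalized_kernel :: "quat \<Rightarrow> quat fps"
  where "normalized_kernel w = hardy_kernel w * fps_const (of_real (1 / hardy_norm (hardy_kernel w)))"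

definition hardy_dist :: "quat \<Rightarrow> quat \<Rightarrow> real"
  where "hardy_dist p q =
    sqrt (1 - (norm (hardy_inner (normalized_kernel q) (normalized_kernel p)))\<^sup>2)"

section \<open>Length metrics\<close>

text \<open>Curves are parametrized by \<open>{0..1}\<close> and continuous with respect to \<open>d\<close> itself.\<close>

definition curve_in :: "'a set \<Rightarrow> ('a \<Rightarrow> 'a \<Rightarrow> real) \<Rightarrow> (real \<Rightarrow> 'a) \<Rightarrow> bool"
  where "curve_in X d c \<longleftrightarrow> c ` {0..1} \<subseteq> X \<and>
    (\<forall>t\<in>{0..1}. \<forall>e>0. \<exists>r>0. \<forall>s\<in>{0..1}. \<bar>s - t\<bar> < r \<longrightarrow> d (c s) (c t) < e)"

definition curve_length :: "('a \<Rightarrow> 'a \<Rightarrow> real) \<Rightarrow> (real \<Rightarrow> 'a) \<Rightarrow> ennreal"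
  where "curve_length d c =
    (SUP (n, t) \<in> {(n, t :: nat \<Rightarrow> real). t 0 = 0 \<and> t n = 1 \<and> (\<forall>i<n. t i \<le> t (Suc i))}.
      \<Sum>i<n. ennreal (d (c (t i)) (c (t (Suc i)))))"

definition length_metric :: "'a set \<Rightarrow> ('a \<Rightarrow> 'a \<Rightarrow> real) \<Rightarrow> 'a \<Rightarrow> 'a \<Rightarrow> ennreal"
  where "length_metric X d p q =
    (INF c \<in> {c. curve_in X d c \<and> c 0 = p \<and> c 1 = q}. curve_length d c)"

section \<open>Riemannian metrics on open subsets of a Euclidean space\<close>

text \<open>
  A Riemannian metric is given by its quadratic form: \<open>g w d\<close> is the squared length of the
  tangent vector \<open>d\<close> at \<open>w\<close>.  \<^const>\<open>valid_path\<close> means piecewise \<open>C\<^sup>1\<close>, but does not ask for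
  one-sided limits of the derivative at the break points; the Lebesgue integral in
  \<^typ>\<open>ennreal\<close> makes the length of a path with non-integrable speed infinite.
\<close>

definition riem_length :: "('a \<Rightarrow> 'a \<Rightarrow> real) \<Rightarrow> (real \<Rightarrow> 'a::euclidean_space) \<Rightarrow> ennreal"
  where "riem_length g c =
    (\<integral>\<^sup>+t\<in>{0..1}. ennreal (sqrt (g (c t) (vector_derivative c (at t)))) \<partial>lborel)"

definition riem_dist :: "'a set \<Rightarrow> ('a \<Rightarrow> 'a \<Rightarrow> real) \<Rightarrow> 'a \<Rightarrow> 'a::euclidean_space \<Rightarrow> ennreal"
  where "riem_dist X g p q =
    (INF c \<in> {c. valid_path c \<and> path_image c \<subseteq> X \<and> pathstart c = p \<and> pathfinish c = q}.
      riem_length g c)"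

primrec Ck_on :: "nat \<Rightarrow> 'a::euclidean_space set \<Rightarrow> ('a \<Rightarrow> 'b::euclidean_space) \<Rightarrow> bool"
  where
    "Ck_on 0 X f \<longleftrightarrow> continuous_on X f"
  | "Ck_on (Suc k) X f \<longleftrightarrow> (\<forall>x\<in>X. f differentiable (at x)) \<and>
      (\<forall>v. Ck_on k X (\<lambda>x. frechet_derivative f (at x) v))"

definition smooth_on :: "'a::euclidean_space set \<Rightarrow> ('a \<Rightarrow> 'b::euclidean_space) \<Rightarrow> bool"
  where "smooth_on X f \<longleftrightarrow> (\<forall>k. Ck_on k X f)"

text \<open>
  Smooth diffeomorphisms of the open set \<open>X\<close> preserving \<open>g\<close>, as elements of the group
  \<^term>\<open>BijGroup X\<close> of bijections of \<open>X\<close>, whose elements are \<^const>\<open>undefined\<close> outside \<open>X\<close>.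
\<close>

definition riem_isometries :: "'a::euclidean_space set \<Rightarrow> ('a \<Rightarrow> 'a \<Rightarrow> real) \<Rightarrow> ('a \<Rightarrow> 'a) set"
  where "riem_isometries X g = {f \<in> carrier (BijGroup X).
    smooth_on X f \<and> smooth_on X (inv_into X f) \<and>
    (\<forall>w\<in>X. \<forall>d. g (f w) (frechet_derivative f (at w) d) = g w d)}"

section \<open>The metric on the ball\<close>

text \<open>The choice of \<open>I\<close> does not matter, including for real \<open>w\<close>; see \<open>hardy_metric_eq\<close>.\<close>

definition hardy_metric :: "quat \<Rightarrow> quat \<Rightarrow> real"
  where "hardy_metric w d = (THE r. \<exists>I d1 d2. I \<in> \<S> \<and> w \<in> slice I \<and>
    d1 \<in> slice I \<and> d2 \<in> (slice I)\<^sup>\<bottom> \<and> d = d1 + d2 \<and>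
    r = 1 / (1 - (norm w)\<^sup>2)\<^sup>2 * (norm d1)\<^sup>2 + 1 / (norm (1 - w\<^sup>2))\<^sup>2 * (norm d2)\<^sup>2)"

lemma slice_decomp_norms:
  assumes I: "I \<in> \<S>" and d1: "d1 \<in> slice I" and d2: "d2 \<in> (slice I)\<^sup>\<bottom>"
  shows "(norm d1)\<^sup>2 = (qre (d1 + d2))\<^sup>2 + ((d1 + d2) \<bullet> I)\<^sup>2"
    and "(norm d2)\<^sup>2 = (norm (d1 + d2))\<^sup>2 - (norm d1)\<^sup>2"
proof -
  obtain a b where ab: "d1 = of_real a + of_real b * I"
    using d1 by (auto simp: slice_def)
  have I0: "qre I = 0" "I \<bullet> I = 1"
    using I by (simp_all add: imag_units_iff power2_norm_eq_inner [symmetric])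
  have "1 \<in> slice I" "I \<in> slice I"
    by (auto simp: slice_def intro: exI [of _ 0] exI [of _ 1])
  then have "1 \<bullet> d2 = 0" "I \<bullet> d2 = 0" and d12: "d1 \<bullet> d2 = 0"
    using d1 d2 by (auto simp: orthogonal_comp_def orthogonal_def)
  then have "qre d2 = 0" "d2 \<bullet> I = 0"
    by (simp_all add: inner_quat_def mult.commute)
  moreover have "qre d1 = a"
    using I0 by (simp add: ab quat_sel_times)
  moreover have d1I: "d1 \<bullet> I = b"
    using I0 by (simp add: ab inner_add_left scaleR_conv_of_real [symmetric])
      (simp add: inner_quat_def)
  moreover have "(norm d1)\<^sup>2 = a\<^sup>2 + b\<^sup>2"
  proof -
    have "d1 \<bullet> d1 = a * (d1 \<bullet> 1) + b * (d1 \<bullet> I)"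
      by (subst (2) ab)
        (simp add: inner_add_right scaleR_conv_of_real [symmetric] of_real_def)
    moreover have "d1 \<bullet> 1 = qre d1"
      by (simp add: inner_quat_def)
    ultimately show ?thesis
      using d1I \<open>qre d1 = a\<close> unfolding power2_norm_eq_inner by (simp add: power2_eq_square)
  qed
  ultimately show "(norm d1)\<^sup>2 = (qre (d1 + d2))\<^sup>2 + ((d1 + d2) \<bullet> I)\<^sup>2"
    by (simp add: inner_add_left)
  show "(norm d2)\<^sup>2 = (norm (d1 + d2))\<^sup>2 - (norm d1)\<^sup>2"
    using d12 by (simp add: power2_norm_eq_inner inner_add_left inner_add_right inner_commute)
qed

lemma hardy_metric_eq:
  assumes "w \<in> \<bool>" "I \<in> \<S>" "w \<in> slice I" "d1 \<in> slice I" "d2 \<in> (slice I)\<^sup>\<bottom>"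
  shows "hardy_metric w (d1 + d2) =
    1 / (1 - (norm w)\<^sup>2)\<^sup>2 * (norm d1)\<^sup>2 + 1 / (norm (1 - w\<^sup>2))\<^sup>2 * (norm d2)\<^sup>2"
    (is "_ = ?F d1 d2")
  unfolding hardy_metric_def
proof (rule the_equality)
  show "\<exists>J e1 e2. J \<in> \<S> \<and> w \<in> slice J \<and> e1 \<in> slice J \<and> e2 \<in> (slice J)\<^sup>\<bottom> \<and>
      d1 + d2 = e1 + e2 \<and> ?F d1 d2 = ?F e1 e2"
    using assms by blast
next
  fix r
  assume "\<exists>J e1 e2. J \<in> \<S> \<and> w \<in> slice J \<and> e1 \<in> slice J \<and> e2 \<in> (slice J)\<^sup>\<bottom> \<and>
      d1 + d2 = e1 + e2 \<and> r = ?F e1 e2"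
  then obtain J e1 e2 where J: "J \<in> \<S>" "w \<in> slice J" "e1 \<in> slice J" "e2 \<in> (slice J)\<^sup>\<bottom>"
    and eq: "d1 + d2 = e1 + e2" and r: "r = ?F e1 e2"
    by blast
  note nd = slice_decomp_norms [OF assms(2,4,5)] and ne = slice_decomp_norms [OF J(1,3,4)]
  obtain x y where xy: "w = of_real x + of_real y * I"
    using assms(3) by (auto simp: slice_def)
  obtain u v where uv: "w = of_real u + of_real v * J"
    using J(2) by (auto simp: slice_def)
  have re: "qre I = 0" "qre J = 0" and n1: "norm I = 1" "norm J = 1"
    using assms(2) J(1) by (simp_all add: imag_units_iff)
  have "qre w = x" "qre w = u"
    using re by (simp add: xy quat_sel_times, simp add: uv quat_sel_times)
  then have yv: "of_real y * I = of_real v * J"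
    using xy uv by simp
  then have "norm (of_real y * I) = norm (of_real v * J)"
    by simp
  then have abs: "\<bar>y\<bar> = \<bar>v\<bar>"
    using n1 by (simp add: norm_mult)
  show "r = ?F d1 d2"
  proof (cases "y = 0")
    case True
    have "\<bar>x\<bar> < 1"
      using assms(1) by (simp add: quat_ball_def xy True)
    then have "0 \<le> 1 - x\<^sup>2"
      by (simp add: abs_square_le_1)
    moreover have "norm (1 - w\<^sup>2) = \<bar>1 - x\<^sup>2\<bar>"
    proof -
      have "1 - w\<^sup>2 = of_real (1 - x\<^sup>2)"
        by (simp add: xy True)
      then show ?thesis
        by (simp only: norm_of_real)
    qed
    ultimately have c: "norm (1 - w\<^sup>2) = 1 - (norm w)\<^sup>2"
      by (simp add: xy True)
    show ?thesis
      unfolding r c using nd(2) ne(2) eq by (simp flip: distrib_left add_divide_distrib)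
  next
    case False
    then have "J = I \<or> J = - I"
    proof -
      have "y = v \<or> y = - v"
        using abs by (simp add: abs_eq_iff)
      moreover have "y *\<^sub>R I = v *\<^sub>R J"
        using yv by (simp add: scaleR_conv_of_real)
      ultimately have "y *\<^sub>R J = y *\<^sub>R I \<or> y *\<^sub>R J = y *\<^sub>R (- I)"
        by auto
      then show ?thesis
        using False by (metis scaleR_cancel_left)
    qed
    then have "(norm e1)\<^sup>2 = (norm d1)\<^sup>2"
      using nd(1) ne(1) eq by auto
    then show ?thesis
      unfolding r using nd(2) ne(2) eq by simp
  qed
qed

section \<open>The generators of the isometry group\<close>

definition quat_moebius :: "real \<Rightarrow> quat \<Rightarrow> quat"
  where "quat_moebius l = series_at
    (inverse (1 - fps_X * fps_const (of_real l)) * (fps_X - fps_const (of_real l)))"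

text \<open>The round (geodesic) distance of \<open>\<S>\<close>.\<close>

definition sphere_dist :: "quat \<Rightarrow> quat \<Rightarrow> real"
  where "sphere_dist I J = arccos (I \<bullet> J)"

definition sphere_isometry :: "(quat \<Rightarrow> quat) \<Rightarrow> bool"
  where "sphere_isometry A \<longleftrightarrow> bij_betw A \<S> \<S> \<and>
    (\<forall>I\<in>\<S>. \<forall>J\<in>\<S>. sphere_dist (A I) (A J) = sphere_dist I J)"

definition sphere_map :: "(quat \<Rightarrow> quat) \<Rightarrow> quat \<Rightarrow> quat"
  where "sphere_map A q = (THE p. \<exists>x y I. 0 \<le> y \<and> I \<in> \<S> \<and>
    q = of_real x + of_real y * I \<and> p = of_real x + of_real y * A I)"

lemma sphere_map_eq:
  assumes "0 \<le> y" "I \<in> \<S>"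
  shows "sphere_map A (of_real x + of_real y * I) = of_real x + of_real y * A I"
  unfolding sphere_map_def
proof (rule the_equality)
  fix p
  assume "\<exists>u v J. 0 \<le> v \<and> J \<in> \<S> \<and> of_real x + of_real y * I = of_real u + of_real v * J \<and>
    p = of_real u + of_real v * A J"
  then obtain u v J where J: "0 \<le> v" "J \<in> \<S>" and p: "p = of_real u + of_real v * A J"
    and eq: "of_real x + of_real y * I = of_real u + of_real v * J"
    by blast
  have re: "qre I = 0" "qre J = 0" and n1: "norm I = 1" "norm J = 1"
    using assms(2) J(2) by (simp_all add: imag_units_iff)
  have "qre (of_real x + of_real y * I) = x" "qre (of_real u + of_real v * J) = u"
    using re by (simp_all add: quat_sel_times)
  then have xu: "x = u"
    using eq by metis
  then have yv: "of_real y * I = of_real v * J"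
    using eq by simp
  then have "norm (of_real y * I) = norm (of_real v * J)"
    by simp
  then have "y = v"
    using n1 assms(1) J(1) by (simp add: norm_mult)
  with yv have "y = 0 \<or> I = J"
    by auto
  then show "p = of_real x + of_real y * A I"
    using p xu \<open>y = v\<close> by auto
qed (use assms in blast)

definition reflection :: "quat \<Rightarrow> quat"
  where "reflection q = - qcnj q"

definition generators :: "(quat \<Rightarrow> quat) set"
  where "generators =
    {restrict (quat_moebius l) \<bool> |l. l \<in> {-1<..<1}} \<union>
    {restrict (sphere_map A) \<bool> |A. sphere_isometry A} \<union>
    {restrict reflection \<bool>}"

end

theory Submission
  imports Defs
begin

text \<open>
  Write \<open>\<rho>\<close> for the Riemannian distance of \<open>g\<close>, and \<open>Im q\<close> for the imaginary part of \<open>q\<close>, a vector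
  of \<open>\<real>\<^sup>3\<close>.

  \<^bold>\<open>The length metric.\<close>  The series \<open>\<langle>k\<^sub>q, k\<^sub>p\<rangle> = \<Sum>n. p\<^sup>n (qcnj q)\<^sup>n\<close> can be summed, and
  \<open>\<delta>(p, q)\<^sup>2\<close> turns out to be the value at \<open>q - p\<close> of a quadratic form (\<open>polar_form p q\<close>) whose
  coefficients are continuous in \<open>(p, q)\<close> and which for \<open>p = q\<close> is the metric \<open>g\<close>.  No slice enters
  these coefficients, so they are continuous also on the real axis, where the slice is not determined.
  Consequently \<open>\<delta>(p, q)\<close> and the \<open>g\<close>-length of the segment from \<open>p\<close> to \<open>q\<close> have a ratio close to \<open>1\<close>
  if \<open>p\<close> and \<open>q\<close> are close to each other in a fixed compact part of \<open>\<bool>\<close>.  A curve that is continuous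
  for \<open>\<delta>\<close> is continuous in the ordinary sense, and the \<open>g\<close>-length of its inscribed polygons is at most
  slightly larger than its \<open>\<delta>\<close>-length; this gives \<open>\<rho> \<le>\<close> length metric.  For the other inequality \<open>\<delta>\<close> has to be a
  metric: being the sine of the angle between two lines of a quaternionic Hilbert space it satisfies the
  triangle inequality, so \<open>\<delta>(c s, c t)\<close> is at most the integral of the speed of \<open>c\<close> over \<open>[s, t]\<close>.

  \<^bold>\<open>Isometries.\<close>  That the generators are isometries is a computation in a slice and its
  orthogonal complement.  For the converse, send \<open>q = x + y I\<close> with \<open>y \<ge> 0\<close> to its meridian
  \<open>x + i y\<close> in the unit disc of \<open>\<complex>\<close>.  This map does not increase lengths from \<open>g\<close> to the
  hyperbolic metric, which bounds \<open>\<rho>\<close> from below; the bound is attained on radii and, within the half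
  \<open>y > 0\<close> of a slice, on hyperbolic geodesics.  Two facts follow.

  First, if an isometry \<open>h\<close> sends \<open>w\<close> to \<open>0\<close>, then it sends such minimizing geodesics from \<open>w\<close> to Euclidean
  radii (\<open>isometry_radial\<close>), because by Gauss' lemma only radii have the length of their
  distance from \<open>0\<close>.  For \<open>w = 0\<close> this makes \<open>h\<close> the restriction of an orthogonal map;
  preserving \<open>g\<close>, it preserves \<open>|Im q|\<close>, hence it is \<open>T\<^sub>A\<close> or \<open>R \<circ> T\<^sub>A\<close> (\<open>isometry_fixing_0\<close>).

  Second, a point \<open>w\<close> sent to \<open>0\<close> is real (\<open>isometry_preimage_0_real\<close>).  Suppose not.  More
  than half of the directions at \<open>w\<close> tangent to the slice of \<open>w\<close> belong to hyperbolic rays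
  that stay in the half slice, and the images of these rays are radii in a plane \<open>V\<close> of \<open>\<real>\<^sup>4\<close>.  A plane
  contains an imaginary direction, and among the image radii there are two that are mirror images
  of each other in the line of \<open>V\<close> perpendicular to that direction.  Points of the same norm on these two
  radii have the same real part, so a rotation of \<open>\<S>\<close> joins them by a path of length at most
  \<open>\<pi>/2\<close>.  But the two rays from \<open>w\<close> have different directions, so in the half slice, where \<open>\<rho>\<close> is hyperbolic,
  they diverge.

  Hence an isometry \<open>f\<close> has \<open>f 0\<close> real, and it differs by \<open>M\<^sub>\<lambda>\<close> with \<open>\<lambda> = f 0\<close> from one that fixes \<open>0\<close>.
\<close>

section \<open>The Hardy distance in closed form\<close>

definition qvec :: "quat \<Rightarrow> quat"
  where "qvec q = q - of_real (qre q)"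

lemma qvec_sel [simp]:
  "qre (qvec q) = 0" "qim1 (qvec q) = qim1 q" "qim2 (qvec q) = qim2 q" "qim3 (qvec q) = qim3 q"
  by (simp_all add: qvec_def)

lemma qvec_diff: "qvec (p - q) = qvec p - qvec q"
  and qvec_scaleR: "qvec (r *\<^sub>R p) = r *\<^sub>R qvec p"
  by (simp_all add: quat_eq_iff)

lemma norm_sq_qvec: "(norm q)\<^sup>2 = (qre q)\<^sup>2 + (norm (qvec q))\<^sup>2"
  by (simp add: norm_quat_sq)

lemma times_of_real_quat:
  "q * of_real r = r *\<^sub>R q" "of_real r * q = r *\<^sub>R q" for q :: quat
  by (simp_all add: quat_eq_iff quat_sel_times)

lemma bounded_linear_qre: "bounded_linear qre"
  and bounded_linear_qvec: "bounded_linear qvec"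
proof -
  have "bounded_linear (\<lambda>q :: quat. q \<bullet> 1)"
    by (rule bounded_linear_inner_left)
  moreover have "qre = (\<lambda>q. q \<bullet> 1)"
    by (simp add: inner_quat_def fun_eq_iff)
  ultimately show *: "bounded_linear qre"
    by simp
  show "bounded_linear qvec"
    unfolding qvec_def [abs_def]
    by (intro bounded_linear_sub bounded_linear_ident
        bounded_linear_compose [OF bounded_linear_of_real *])
qed

lemmas continuous_on_qre [continuous_intros] = bounded_linear.continuous_on [OF bounded_linear_qre]
lemmas continuous_on_qvec [continuous_intros] = bounded_linear.continuous_on [OF bounded_linear_qvec]

lemma in_ball_iff: "q \<in> \<bool> \<longleftrightarrow> (norm q)\<^sup>2 < 1"
  by (simp add: quat_ball_def abs_square_less_1)

lemma open_quat_ball [simp]: "open \<bool>"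
  by (simp add: quat_ball_def)

text \<open>
  With \<open>z = Re p + i |Im p|\<close> and \<open>z' = Re q + i |Im q|\<close> this is \<open>|1 - cnj z z'|\<^sup>2 |1 - z z'|\<^sup>2\<close>; it is also
  the squared norm of \<open>1 - 2 (Re q) p + |q|\<^sup>2 p\<^sup>2\<close>, the denominator in the closed form of the kernel.
\<close>

definition polar_denom :: "quat \<Rightarrow> quat \<Rightarrow> real"
  where "polar_denom p q =
    (1 + (norm p)\<^sup>2 * (norm q)\<^sup>2 - 2 * qre p * qre q)\<^sup>2 - 4 * (norm (qvec p))\<^sup>2 * (norm (qvec q))\<^sup>2"

text \<open>
  For fixed \<open>p\<close> and \<open>q\<close> a quadratic form in \<open>e\<close>.  On the diagonal it is the metric
  (\<open>hardy_metric_polar_form\<close>) and at \<open>e = q - p\<close> it is \<open>\<delta>(p, q)\<^sup>2\<close> (\<open>hardy_dist_sq\<close>), so it interpolates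
  between the two.
\<close>

definition polar_form :: "quat \<Rightarrow> quat \<Rightarrow> quat \<Rightarrow> real"
  where "polar_form p q e =
    ((1 - (norm p)\<^sup>2) * (1 - (norm q)\<^sup>2) * (norm e)\<^sup>2
      + (qre e)\<^sup>2 * ((qre p - qre q)\<^sup>2 + 2 * ((norm (qvec p))\<^sup>2 + (norm (qvec q))\<^sup>2))
      + (e \<bullet> (qvec p + qvec q))\<^sup>2) / polar_denom p q"

text \<open>
  Each of the two factors of the denominator is \<open>(1 - |p|\<^sup>2)(1 - |q|\<^sup>2)\<close> plus a sum of squares.
\<close>

lemma polar_denom_pos:
  assumes "p \<in> \<bool>" "q \<in> \<bool>"
  shows "polar_denom p q > 0"
proof -
  define x u Y V where "x = qre p" "u = qre q" "Y = norm (qvec p)" "V = norm (qvec q)"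
  note d = this
  have p: "(norm p)\<^sup>2 = x\<^sup>2 + Y\<^sup>2" and q: "(norm q)\<^sup>2 = u\<^sup>2 + V\<^sup>2"
    by (simp_all add: d norm_sq_qvec [of p] norm_sq_qvec [of q])
  have lt: "x\<^sup>2 + Y\<^sup>2 < 1" "u\<^sup>2 + V\<^sup>2 < 1"
    using assms p q by (simp_all add: in_ball_iff)
  define N where "N = 1 + (x\<^sup>2 + Y\<^sup>2) * (u\<^sup>2 + V\<^sup>2) - 2 * x * u"
  have pos: "(1 - (x\<^sup>2 + Y\<^sup>2)) * (1 - (u\<^sup>2 + V\<^sup>2)) > 0"
    using lt by simp
  have "N - 2 * Y * V = (1 - (x\<^sup>2 + Y\<^sup>2)) * (1 - (u\<^sup>2 + V\<^sup>2)) + (x - u)\<^sup>2 + (Y - V)\<^sup>2"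
    unfolding N_def by (simp add: algebra_simps power2_eq_square)
  then have 1: "N - 2 * Y * V > 0"
    using pos by (simp add: add_pos_nonneg)
  have "N + 2 * Y * V = (1 - (x\<^sup>2 + Y\<^sup>2)) * (1 - (u\<^sup>2 + V\<^sup>2)) + (x - u)\<^sup>2 + (Y + V)\<^sup>2"
    unfolding N_def by (simp add: algebra_simps power2_eq_square)
  then have 2: "N + 2 * Y * V > 0"
    using pos by (simp add: add_pos_nonneg)
  have "polar_denom p q = (N - 2 * Y * V) * (N + 2 * Y * V)"
    unfolding polar_denom_def p q unfolding N_def d(1,2) [symmetric] d(3,4) [symmetric]
    by (simp add: algebra_simps power2_eq_square)
  then show ?thesis
    using 1 2 by simp
qed

lemma polar_form_scaleR: "polar_form p q (r *\<^sub>R e) = r\<^sup>2 * polar_form p q e"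
proof -
  have "(norm (r *\<^sub>R e))\<^sup>2 = r\<^sup>2 * (norm e)\<^sup>2"
    by (simp add: power_mult_distrib)
  then show ?thesis
    unfolding polar_form_def times_divide_eq_right quat_sel_scaleR inner_scaleR_left
    by (intro arg_cong2 [where f = "(/)"] refl) algebra
qed

lemma summable_kernel:
  assumes "p \<in> \<bool>" "q \<in> \<bool>"
  shows "summable (\<lambda>n. p ^ n * qcnj q ^ n)"
proof (rule summable_comparison_test')
  have "norm p * norm q < 1"
  proof -
    have "norm p * norm q \<le> norm p * 1"
      using assms by (intro mult_left_mono) (auto simp: quat_ball_def)
    then show ?thesis
      using assms by (simp add: quat_ball_def)
  qed
  then show "summable (\<lambda>n. (norm p * norm q) ^ n)"
    by (simp add: abs_mult)
  show "norm (p ^ n * qcnj q ^ n) \<le> (norm p * norm q) ^ n" for n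
    by (simp add: norm_mult norm_power power_mult_distrib)
qed

text \<open>
  Shifting the index gives \<open>S = 1 + p S (qcnj q)\<close>.  Since \<open>qcnj q\<close> is a root of
  \<open>X\<^sup>2 - 2 (Re q) X + |q|\<^sup>2\<close>, using this twice eliminates the factors on the right of \<open>S\<close>.
\<close>

lemma kernel_sum_equation:
  assumes "p \<in> \<bool>" "q \<in> \<bool>"
  defines "S \<equiv> \<Sum>n. p ^ n * qcnj q ^ n"
  shows "(1 - (2 * qre q) *\<^sub>R p + (norm q)\<^sup>2 *\<^sub>R (p * p)) * S = 1 - p * q"
proof -
  note s = summable_kernel [OF assms(1,2)]
  have "S = p ^ 0 * qcnj q ^ 0 + (\<Sum>n. p ^ Suc n * qcnj q ^ Suc n)"
    unfolding S_def by (subst suminf_split_head [OF s]) simp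
  also have "(\<Sum>n. p ^ Suc n * qcnj q ^ Suc n) = (\<Sum>n. p * (p ^ n * qcnj q ^ n) * qcnj q)"
    by (simp add: mult.assoc power_commutes)
  also have "\<dots> = p * S * qcnj q"
    unfolding S_def
    by (subst suminf_mult2 [symmetric], rule summable_mult [OF s], subst suminf_mult [OF s]) simp
  finally have "S = 1 + p * S * qcnj q"
    by simp
  then have e1: "p * S * qcnj q = S - 1"
    by (metis add_diff_cancel_left')
  have qq: "qcnj q * q = of_real ((norm q)\<^sup>2)" "qcnj q = (2 * qre q) *\<^sub>R 1 - q"
    unfolding norm_quat_sq by (simp_all add: quat_eq_iff quat_sel_times power2_eq_square)
  have e2: "(norm q)\<^sup>2 *\<^sub>R (p * S) = S * q - q"
  proof -
    have "p * S * (qcnj q * q) = (S - 1) * q"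
      using e1 by (simp flip: mult.assoc)
    then show ?thesis
      unfolding qq(1) times_of_real_quat by (simp add: algebra_simps)
  qed
  have e3: "(2 * qre q) *\<^sub>R (p * S) - p * S * q = S - 1"
    using e1 unfolding qq(2) by (simp add: algebra_simps times_of_real_quat)
  have "(norm q)\<^sup>2 *\<^sub>R (p * p * S) = p * (S * q) - p * q"
    using arg_cong [OF e2, of "\<lambda>t. p * t"] by (simp add: algebra_simps)
  then show ?thesis
    using e3 by (simp add: algebra_simps)
qed

lemma norm_kernel_sum:
  assumes "p \<in> \<bool>" "q \<in> \<bool>"
  shows "(norm (\<Sum>n. p ^ n * qcnj q ^ n))\<^sup>2 * polar_denom p q =
    1 + (norm p)\<^sup>2 * (norm q)\<^sup>2 - 2 * (qre p * qre q - qvec p \<bullet> qvec q)"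
proof -
  define x u Y V c where "x = qre p" "u = qre q" "Y = (norm (qvec p))\<^sup>2" "V = (norm (qvec q))\<^sup>2"
    "c = qvec p \<bullet> qvec q"
  note d = this
  have n: "(norm p)\<^sup>2 = x\<^sup>2 + Y" "(norm q)\<^sup>2 = u\<^sup>2 + V"
    by (simp_all add: d norm_sq_qvec [of p] norm_sq_qvec [of q])
  have pp: "qre (p * p) = x\<^sup>2 - Y" "qvec (p * p) = (2 * x) *\<^sub>R qvec p"
    by (simp_all add: d quat_eq_iff quat_sel_times norm_quat_sq)
      (simp_all add: power2_eq_square)
  define r where "r = (norm q)\<^sup>2"
  have "qvec (1 - (2 * u) *\<^sub>R p + r *\<^sub>R (p * p)) = (2 * r * x - 2 * u) *\<^sub>R qvec p"
    using pp(2) by (simp add: quat_eq_iff algebra_simps)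
  then have "(norm (1 - (2 * u) *\<^sub>R p + r *\<^sub>R (p * p)))\<^sup>2 =
      (1 - 2 * u * x + r * (x\<^sup>2 - Y))\<^sup>2 + (2 * r * x - 2 * u)\<^sup>2 * Y"
    unfolding norm_sq_qvec [of "1 - _ + _"] by (simp add: pp(1) power_mult_distrib d)
  also have "\<dots> = (1 + (x\<^sup>2 + Y) * r - 2 * x * u)\<^sup>2 - 4 * Y * V"
    unfolding r_def n by algebra
  also have "\<dots> = polar_denom p q"
    by (simp add: polar_denom_def r_def n d)
  finally have "polar_denom p q = (norm (1 - (2 * qre q) *\<^sub>R p + (norm q)\<^sup>2 *\<^sub>R (p * p)))\<^sup>2"
    by (simp add: d r_def)
  moreover have "1 + (norm p)\<^sup>2 * (norm q)\<^sup>2 - 2 * (qre p * qre q - qvec p \<bullet> qvec q)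
      = (norm (1 - p * q))\<^sup>2"
  proof -
    have "(norm (1 - p * q))\<^sup>2 = 1 + (norm (p * q))\<^sup>2 - 2 * qre (p * q)"
      unfolding norm_quat_sq by (simp add: power2_eq_square algebra_simps)
    then show ?thesis
      by (simp add: norm_mult power_mult_distrib quat_sel_times inner_quat_def)
  qed
  ultimately show ?thesis
    unfolding kernel_sum_equation [OF assms, symmetric] norm_mult power_mult_distrib
    by (simp only: mult.commute)
qed

lemma hardy_norm_kernel:
  assumes "w \<in> \<bool>"
  shows "hardy_norm (hardy_kernel w) = 1 / sqrt (1 - (norm w)\<^sup>2)"
proof -
  have "(\<Sum>n. (norm (fps_nth (hardy_kernel w) n))\<^sup>2) = (\<Sum>n. ((norm w)\<^sup>2) ^ n)"
    by (simp add: hardy_kernel_def norm_power power_mult [symmetric] mult.commute)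
  also have "\<dots> = 1 / (1 - (norm w)\<^sup>2)"
    using assms by (intro suminf_geometric) (simp add: in_ball_iff)
  finally show ?thesis
    by (simp add: hardy_norm_def real_sqrt_divide)
qed

lemma normalized_kernel_nth:
  assumes "w \<in> \<bool>"
  shows "fps_nth (normalized_kernel w) n = sqrt (1 - (norm w)\<^sup>2) *\<^sub>R qcnj w ^ n"
  unfolding normalized_kernel_def hardy_norm_kernel [OF assms]
  by (simp add: hardy_kernel_def times_of_real_quat)

lemma hardy_inner_normalized:
  assumes "p \<in> \<bool>" "q \<in> \<bool>"
  shows "hardy_inner (normalized_kernel q) (normalized_kernel p) =
    (sqrt (1 - (norm p)\<^sup>2) * sqrt (1 - (norm q)\<^sup>2)) *\<^sub>R (\<Sum>n. p ^ n * qcnj q ^ n)"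
proof -
  have cs: "qcnj (r *\<^sub>R x) = r *\<^sub>R qcnj x" for r x
    by (simp add: quat_eq_iff)
  show ?thesis
    unfolding hardy_inner_def normalized_kernel_nth [OF assms(1)] normalized_kernel_nth [OF assms(2)]
    by (simp add: cs qcnj_power suminf_scaleR_right [OF summable_kernel [OF assms]] mult.commute)
qed

text \<open>
  After multiplication with the denominator this is a polynomial identity in the real parts, the
  norms of the imaginary parts, and their inner product.
\<close>

lemma hardy_dist_sq:
  assumes "p \<in> \<bool>" "q \<in> \<bool>"
  shows "1 - (norm (hardy_inner (normalized_kernel q) (normalized_kernel p)))\<^sup>2 = polar_form p q (q - p)"
proof -
  define n where "n = norm (\<Sum>n. p ^ n * qcnj q ^ n)"
  note pos = polar_denom_pos [OF assms]
  have lt: "(norm p)\<^sup>2 < 1" "(norm q)\<^sup>2 < 1"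
    using assms by (simp_all add: in_ball_iff)
  have nn: "n\<^sup>2 = (1 + (norm p)\<^sup>2 * (norm q)\<^sup>2 - 2 * (qre p * qre q - qvec p \<bullet> qvec q)) / polar_denom p q"
    using norm_kernel_sum [OF assms] pos by (simp add: n_def field_simps)
  have "1 - (norm (hardy_inner (normalized_kernel q) (normalized_kernel p)))\<^sup>2 =
      1 - (1 - (norm p)\<^sup>2) * (1 - (norm q)\<^sup>2) * n\<^sup>2"
    using lt by (simp add: hardy_inner_normalized [OF assms] n_def power_mult_distrib)
  also have "\<dots> = (polar_denom p q - (1 - (norm p)\<^sup>2) * (1 - (norm q)\<^sup>2) *
      (1 + (norm p)\<^sup>2 * (norm q)\<^sup>2 - 2 * (qre p * qre q - qvec p \<bullet> qvec q))) / polar_denom p q"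
    unfolding nn using pos by (simp add: field_simps)
  also have "\<dots> = polar_form p q (q - p)"
    unfolding polar_form_def
  proof (rule arg_cong [where f = "\<lambda>t. t / polar_denom p q"])
    define x u Y V c where "x = qre p" "u = qre q" "Y = (norm (qvec p))\<^sup>2" "V = (norm (qvec q))\<^sup>2"
      "c = qvec p \<bullet> qvec q"
    note d = this
    have 1: "(norm p)\<^sup>2 = x\<^sup>2 + Y" "(norm q)\<^sup>2 = u\<^sup>2 + V"
      by (simp_all add: d norm_sq_qvec [of p] norm_sq_qvec [of q])
    have 2: "(q - p) \<bullet> (qvec p + qvec q) = V - Y" "(norm (q - p))\<^sup>2 = (u - x)\<^sup>2 + V + Y - 2 * c"
      unfolding d norm_quat_sq by (simp_all add: inner_quat_def power2_eq_square algebra_simps)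
    show "polar_denom p q - (1 - (norm p)\<^sup>2) * (1 - (norm q)\<^sup>2) *
        (1 + (norm p)\<^sup>2 * (norm q)\<^sup>2 - 2 * (qre p * qre q - qvec p \<bullet> qvec q)) =
      (1 - (norm p)\<^sup>2) * (1 - (norm q)\<^sup>2) * (norm (q - p))\<^sup>2
      + (qre (q - p))\<^sup>2 * ((qre p - qre q)\<^sup>2 + 2 * ((norm (qvec p))\<^sup>2 + (norm (qvec q))\<^sup>2))
      + ((q - p) \<bullet> (qvec p + qvec q))\<^sup>2"
      unfolding polar_denom_def 2 1 quat_sel d [symmetric] by algebra
  qed
  finally show ?thesis .
qed

lemma polar_form_nonneg:
  assumes "p \<in> \<bool>" "q \<in> \<bool>"
  shows "polar_form p q e \<ge> 0"
  using assms polar_denom_pos [OF assms] unfolding polar_form_def in_ball_iff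
  by (intro divide_nonneg_pos add_nonneg_nonneg mult_nonneg_nonneg) auto

lemma hardy_dist_eq:
  assumes "p \<in> \<bool>" "q \<in> \<bool>"
  shows "hardy_dist p q = sqrt (polar_form p q (q - p))"
  by (simp add: hardy_dist_def hardy_dist_sq [OF assms])

lemma polar_denom_diag:
  "polar_denom w w = (1 - (norm w)\<^sup>2)\<^sup>2 * ((1 - (norm w)\<^sup>2)\<^sup>2 + 4 * (norm (qvec w))\<^sup>2)"
  unfolding polar_denom_def norm_sq_qvec [of w] by algebra

lemma polar_form_diag:
  "polar_form w w d = ((1 - (norm w)\<^sup>2)\<^sup>2 * (norm d)\<^sup>2 + 4 * ((norm (qvec w))\<^sup>2 * (qre d)\<^sup>2 + (d \<bullet> qvec w)\<^sup>2))
    / ((1 - (norm w)\<^sup>2)\<^sup>2 * ((1 - (norm w)\<^sup>2)\<^sup>2 + 4 * (norm (qvec w))\<^sup>2))"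
  unfolding polar_form_def polar_denom_diag
  by (rule arg_cong2 [where f = "(/)"]) (simp_all add: inner_add_right power2_eq_square algebra_simps)

section \<open>Slices as copies of the complex plane\<close>

definition slice_embed :: "quat \<Rightarrow> complex \<Rightarrow> quat"
  where "slice_embed I z = of_real (Re z) + Im z *\<^sub>R I"

lemma bounded_linear_slice_embed: "bounded_linear (slice_embed I)"
  unfolding slice_embed_def [abs_def]
  by (intro bounded_linear_add bounded_linear_compose [OF bounded_linear_of_real bounded_linear_Re]
      bounded_linear_compose [OF bounded_linear_scaleR_left bounded_linear_Im])

lemma slice_embed_sel:
  assumes "I \<in> \<S>"
  shows "qre (slice_embed I z) = Re z" "qvec (slice_embed I z) = Im z *\<^sub>R I" "norm (slice_embed I z) = cmod z"
proof -
  show 1: "qre (slice_embed I z) = Re z" and 2: "qvec (slice_embed I z) = Im z *\<^sub>R I"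
    using assms by (simp_all add: slice_embed_def imag_units_iff qvec_def)
  have "(norm (slice_embed I z))\<^sup>2 = (cmod z)\<^sup>2"
    using norm_sq_qvec [of "slice_embed I z"] assms
    by (simp add: 1 2 cmod_power2 imag_units_iff power_mult_distrib)
  then show "norm (slice_embed I z) = cmod z"
    by (rule power2_eq_imp_eq) (rule norm_ge_zero)+
qed

lemma slice_embed_in_ball: "I \<in> \<S> \<Longrightarrow> slice_embed I z \<in> \<bool> \<longleftrightarrow> cmod z < 1"
  by (simp add: quat_ball_def slice_embed_sel)

lemma slice_embed_mult:
  assumes "I \<in> \<S>"
  shows "slice_embed I (z * w) = slice_embed I z * slice_embed I w"
proof -
  have "I * I = - 1"
    using assms by (simp add: imag_units_def power2_eq_square)
  then show ?thesis
    by (simp add: slice_embed_def of_real_def algebra_simps)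
qed

lemma slice_embed_1: "slice_embed I 1 = 1"
  and slice_embed_of_real: "slice_embed I (of_real r) = of_real r"
  and slice_embed_diff: "slice_embed I (z - w) = slice_embed I z - slice_embed I w"
  by (simp_all add: slice_embed_def algebra_simps)

lemma slice_embed_ex:
  obtains I z where "I \<in> \<S>" "w = slice_embed I z"
proof -
  obtain x y I where "I \<in> \<S>" "w = of_real x + of_real y * I"
    by (rule quat_polar_ex)
  then show ?thesis
    using that [of I "Complex x y"] by (simp add: slice_embed_def times_of_real_quat)
qed

lemma slice_perp_decomposition:
  assumes I: "I \<in> \<S>"
  obtains \<zeta> d2 where "d = slice_embed I \<zeta> + d2" "d2 \<in> (slice I)\<^sup>\<bottom>" "qre d2 = 0" "d2 \<bullet> I = 0"
proof -
  have I0: "qre I = 0" "I \<bullet> I = 1"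
    using I by (simp_all add: imag_units_iff power2_norm_eq_inner [symmetric])
  define \<zeta> where "\<zeta> = Complex (qre d) (d \<bullet> I)"
  define d2 where "d2 = d - slice_embed I \<zeta>"
  have o1: "qre d2 = 0"
    using I0 by (simp add: d2_def \<zeta>_def slice_embed_def)
  have "of_real (qre d) \<bullet> I = 0"
    using I0 by (simp add: inner_quat_def)
  then have o2: "d2 \<bullet> I = 0"
    using I0 by (simp add: d2_def \<zeta>_def slice_embed_def inner_diff_left inner_add_left)
  have o3: "of_real a \<bullet> d2 = 0" for a
    using o1 by (simp add: inner_quat_def)
  have "d2 \<in> (slice I)\<^sup>\<bottom>"
    unfolding orthogonal_comp_def orthogonal_def slice_def
    using o2 o3 by (auto simp: times_of_real_quat inner_add_left inner_commute [of I d2])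
  then show ?thesis
    using that [of \<zeta> d2] o1 o2 by (simp add: d2_def)
qed

lemma hardy_metric_slice:
  assumes I: "I \<in> \<S>" and z: "cmod z < 1" and d2: "d2 \<in> (slice I)\<^sup>\<bottom>"
  shows "hardy_metric (slice_embed I z) (slice_embed I \<zeta> + d2) =
    (cmod \<zeta> / (1 - (cmod z)\<^sup>2))\<^sup>2 + (norm d2 / cmod (1 - z\<^sup>2))\<^sup>2"
proof -
  have S: "slice_embed I x \<in> slice I" for x
    by (auto simp: slice_def slice_embed_def times_of_real_quat)
  have "hardy_metric (slice_embed I z) (slice_embed I \<zeta> + d2) =
    1 / (1 - (cmod z)\<^sup>2)\<^sup>2 * (cmod \<zeta>)\<^sup>2 + 1 / (norm (1 - (slice_embed I z)\<^sup>2))\<^sup>2 * (norm d2)\<^sup>2"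
    using hardy_metric_eq [OF _ I S S d2] z by (simp add: slice_embed_sel [OF I] slice_embed_in_ball [OF I])
  moreover have "1 - (slice_embed I z)\<^sup>2 = slice_embed I (1 - z\<^sup>2)"
    by (simp add: power2_eq_square slice_embed_diff slice_embed_1 slice_embed_mult [OF I])
  ultimately show ?thesis
    by (simp add: slice_embed_sel [OF I] power_divide)
qed

text \<open>
  Since \<open>|1 - z\<^sup>2|\<^sup>2 = (1 - |z|\<^sup>2)\<^sup>2 + 4 (Im z)\<^sup>2\<close>, the two coefficients of \<open>g\<close> differ by a multiple of
  \<open>(Im z)\<^sup>2\<close>, which absorbs the normalization of the imaginary unit of the slice.
\<close>

lemma hardy_metric_polar_form:
  assumes w: "w \<in> \<bool>"
  shows "hardy_metric w d = polar_form w w d"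
proof -
  obtain I z where I: "I \<in> \<S>" and wz: "w = slice_embed I z"
    by (rule slice_embed_ex)
  have z: "cmod z < 1"
    using w by (simp add: wz slice_embed_in_ball [OF I])
  obtain \<zeta> d2 where d: "d = slice_embed I \<zeta> + d2" "d2 \<in> (slice I)\<^sup>\<bottom>" "qre d2 = 0" "d2 \<bullet> I = 0"
    by (rule slice_perp_decomposition [OF I])
  have I0: "qre I = 0" "norm I = 1" "I \<bullet> I = 1"
    using I by (simp_all add: imag_units_iff power2_norm_eq_inner [symmetric])
  define al b where "al = 1 - (cmod z)\<^sup>2" and "b = al\<^sup>2 + 4 * (Im z)\<^sup>2"
  have al: "al > 0"
    using z by (simp add: al_def abs_square_less_1)
  then have b: "b > 0"
    by (simp add: b_def add_pos_nonneg)
  have "(cmod (1 - z\<^sup>2))\<^sup>2 = b"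
    unfolding b_def al_def cmod_power2 by (simp add: power2_eq_square algebra_simps)
  then have "hardy_metric w d = (cmod \<zeta>)\<^sup>2 / al\<^sup>2 + (norm d2)\<^sup>2 / b"
    unfolding wz d(1) hardy_metric_slice [OF I z d(2)] by (simp add: power_divide al_def)
  also have "\<dots> = (b * (cmod \<zeta>)\<^sup>2 + al\<^sup>2 * (norm d2)\<^sup>2) / (al\<^sup>2 * b)"
    using al b by (simp add: field_simps)
  also have "\<dots> = polar_form w w d"
  proof -
    have r: "of_real r \<bullet> e = r * qre e" "e \<bullet> of_real r = r * qre e" for r and e :: quat
      by (simp_all add: inner_quat_def)
    have "slice_embed I \<zeta> \<bullet> d2 = 0"
      using d(3,4) by (simp add: slice_embed_def inner_add_left r inner_commute [of I d2])
    then have "(norm d)\<^sup>2 = (cmod \<zeta>)\<^sup>2 + (norm d2)\<^sup>2"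
      unfolding d(1) slice_embed_sel(3) [OF I, symmetric] power2_norm_eq_inner
      by (simp add: inner_add_left inner_add_right inner_commute)
    moreover have "d \<bullet> qvec w = Im z * Im \<zeta>"
      using I0 d(4) by (simp add: d(1) wz slice_embed_sel [OF I] inner_add_left) (simp add: slice_embed_def inner_add_left r)
    moreover have n: "qre d = Re \<zeta>" "(norm (qvec w))\<^sup>2 = (Im z)\<^sup>2" "norm w = cmod z"
      using d(3) I0 by (simp_all add: d(1) wz slice_embed_sel [OF I])
    ultimately have num: "(1 - (norm w)\<^sup>2)\<^sup>2 * (norm d)\<^sup>2 + 4 * ((norm (qvec w))\<^sup>2 * (qre d)\<^sup>2 + (d \<bullet> qvec w)\<^sup>2)
        = b * (cmod \<zeta>)\<^sup>2 + al\<^sup>2 * (norm d2)\<^sup>2"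
      unfolding b_def cmod_power2 [of \<zeta>]
      by (simp add: al_def [symmetric] cmod_power2 [of \<zeta>] power_mult_distrib algebra_simps)
    show ?thesis
      unfolding polar_form_diag num by (simp add: n b_def al_def)
  qed
  finally show ?thesis .
qed

lemma polar_form_slice_embed:
  assumes I: "I \<in> \<S>" and z: "cmod z < 1"
  shows "polar_form (slice_embed I z) (slice_embed I z) (slice_embed I d) = (cmod d / (1 - (cmod z)\<^sup>2))\<^sup>2"
  using hardy_metric_slice [OF I z, of 0 d] hardy_metric_polar_form [of "slice_embed I z"] z
  by (simp add: orthogonal_comp_def orthogonal_def slice_embed_in_ball [OF I])

section \<open>The triangle inequality for the Hardy distance\<close>

text \<open>
  Minkowski's inequality for sequences, from the one for finite sums by passing to the limit.
\<close>

lemma l2_triangle: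
  fixes f g :: "nat \<Rightarrow> 'a::real_normed_vector"
  assumes f: "(\<lambda>n. (norm (f n))\<^sup>2) sums A\<^sup>2" and g: "(\<lambda>n. (norm (g n))\<^sup>2) sums B\<^sup>2"
    and fg: "(\<lambda>n. (norm (f n + g n))\<^sup>2) sums C\<^sup>2"
    and "0 \<le> A" "0 \<le> B"
  shows "C \<le> A + B"
proof -
  have part: "L2_set (\<lambda>n. norm (h n)) {..<N} \<le> D"
    if "(\<lambda>n. (norm (h n))\<^sup>2) sums D\<^sup>2" "0 \<le> D" for h :: "nat \<Rightarrow> 'a" and D N
    unfolding L2_set_def
    by (rule real_le_lsqrt)
      (use that sum_le_suminf [of "\<lambda>n. (norm (h n))\<^sup>2" "{..<N}"] in \<open>auto simp: sums_iff\<close>)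
  have "(\<Sum>n<N. (norm (f n + g n))\<^sup>2) \<le> (A + B)\<^sup>2" for N
  proof -
    have "L2_set (\<lambda>n. norm (f n + g n)) {..<N} \<le> L2_set (\<lambda>n. norm (f n) + norm (g n)) {..<N}"
      by (rule L2_set_mono) (auto intro: norm_triangle_ineq)
    also have "\<dots> \<le> L2_set (\<lambda>n. norm (f n)) {..<N} + L2_set (\<lambda>n. norm (g n)) {..<N}"
      by (rule L2_set_triangle_ineq)
    also have "\<dots> \<le> A + B"
      using part [OF f] part [OF g] assms(4,5) by (intro add_mono) auto
    finally have "sqrt (\<Sum>n<N. (norm (f n + g n))\<^sup>2) \<le> A + B"
      by (simp add: L2_set_def)
    then show ?thesis
      using sqrt_le_D by blast
  qed
  then have "C\<^sup>2 \<le> (A + B)\<^sup>2"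
    using fg unfolding sums_def by (intro LIMSEQ_le_const2) auto
  then show ?thesis
    using assms(4,5) by (simp add: abs_le_square_iff [symmetric])
qed

lemma normalized_kernel_sums:
  assumes "p \<in> \<bool>" "q \<in> \<bool>"
  shows "(\<lambda>n. qcnj (fps_nth (normalized_kernel p) n) * fps_nth (normalized_kernel q) n)
    sums hardy_inner (normalized_kernel q) (normalized_kernel p)"
proof -
  have cs: "qcnj (r *\<^sub>R x) = r *\<^sub>R qcnj x" for r x
    by (simp add: quat_eq_iff)
  have "summable (\<lambda>n. qcnj (fps_nth (normalized_kernel p) n) * fps_nth (normalized_kernel q) n)"
    unfolding normalized_kernel_nth [OF assms(1)] normalized_kernel_nth [OF assms(2)]
    by (simp add: cs qcnj_power summable_scaleR_right [OF summable_kernel [OF assms]])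
  then show ?thesis
    unfolding hardy_inner_def by (rule summable_sums)
qed

lemma normalized_kernel_norm_sums:
  assumes "p \<in> \<bool>"
  shows "(\<lambda>n. (norm (fps_nth (normalized_kernel p) n))\<^sup>2) sums 1"
proof -
  have lt: "(norm p)\<^sup>2 < 1"
    using assms by (simp add: in_ball_iff)
  have "(\<lambda>n. ((norm p)\<^sup>2) ^ n) sums (1 / (1 - (norm p)\<^sup>2))"
    using lt by (intro geometric_sums) simp
  from sums_mult [OF this, of "1 - (norm p)\<^sup>2"] show ?thesis
    using lt by (simp add: normalized_kernel_nth [OF assms] norm_power power_mult_distrib
        power_mult [symmetric] mult.commute)
qed

text \<open>
  As \<open>l\<close> varies over the quaternions, the distance of the unit vector of \<open>q\<close> to the multiple by \<open>l\<close> of the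
  unit vector of \<open>p\<close> is smallest for \<open>l = s\<close>, where it equals \<open>\<delta>(p, q)\<close>.
\<close>

lemma hardy_dist_min_sums:
  assumes "p \<in> \<bool>" "q \<in> \<bool>"
  defines "s \<equiv> hardy_inner (normalized_kernel q) (normalized_kernel p)"
  shows "(\<lambda>n. (norm (fps_nth (normalized_kernel q) n - fps_nth (normalized_kernel p) n * l))\<^sup>2)
    sums ((hardy_dist p q)\<^sup>2 + (norm (l - s))\<^sup>2)"
proof -
  define a b where "a = fps_nth (normalized_kernel q)" "b = fps_nth (normalized_kernel p)"
  note d = this
  have e: "(norm (x - y))\<^sup>2 = (norm x)\<^sup>2 + (norm y)\<^sup>2 - 2 * qre (qcnj y * x)" for x y :: quat
    unfolding norm_quat_sq by (simp add: quat_sel_times power2_eq_square algebra_simps)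
  have "bounded_linear (\<lambda>x. qre (qcnj l * x))"
    using bounded_linear_compose [OF bounded_linear_qre bounded_linear_mult_right] .
  from bounded_linear.sums [OF this normalized_kernel_sums [OF assms(1,2)]]
  have 1: "(\<lambda>n. qre (qcnj (b n * l) * a n)) sums qre (qcnj l * s)"
    by (simp add: d s_def qcnj_mult mult.assoc)
  have 2: "(\<lambda>n. (norm (b n * l))\<^sup>2) sums (norm l)\<^sup>2"
    using sums_mult2 [OF normalized_kernel_norm_sums [OF assms(1)], of "(norm l)\<^sup>2"]
    by (simp add: d norm_mult power_mult_distrib)
  have "(\<lambda>n. (norm (a n - b n * l))\<^sup>2) sums (1 + (norm l)\<^sup>2 - 2 * qre (qcnj l * s))"
    unfolding e using normalized_kernel_norm_sums [OF assms(2)]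
    by (intro sums_add sums_diff sums_mult 1 2) (simp add: d)
  moreover have "(hardy_dist p q)\<^sup>2 = 1 - (norm s)\<^sup>2"
    using polar_form_nonneg [OF assms(1,2)]
    by (simp add: hardy_dist_def hardy_dist_sq [OF assms(1,2)] s_def)
  moreover have "(norm (l - s))\<^sup>2 = (norm l)\<^sup>2 + (norm s)\<^sup>2 - 2 * qre (qcnj l * s)"
    unfolding norm_quat_sq by (simp add: quat_sel_times power2_eq_square algebra_simps)
  ultimately have "1 + (norm l)\<^sup>2 - 2 * qre (qcnj l * s) = (hardy_dist p q)\<^sup>2 + (norm (l - s))\<^sup>2"
    and "(\<lambda>n. (norm (a n - b n * l))\<^sup>2) sums (1 + (norm l)\<^sup>2 - 2 * qre (qcnj l * s))"
    by linarith+
  then show ?thesis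
    by (simp add: d)
qed

lemma hardy_dist_nonneg: "p \<in> \<bool> \<Longrightarrow> q \<in> \<bool> \<Longrightarrow> 0 \<le> hardy_dist p q"
  by (simp add: hardy_dist_eq polar_form_nonneg)

text \<open>
  Approximate the unit vector of \<open>r\<close> by the multiple by \<open>l\<close> of that of \<open>q\<close>, and this in turn by a
  multiple of that of \<open>p\<close>.  The second error is scaled by \<open>|l| \<le> 1\<close>.
\<close>

lemma hardy_dist_triangle:
  assumes "p \<in> \<bool>" "q \<in> \<bool>" "r \<in> \<bool>"
  shows "hardy_dist p r \<le> hardy_dist p q + hardy_dist q r"
proof -
  define u where "u w = fps_nth (normalized_kernel w)" for w
  define l m where "l = hardy_inner (normalized_kernel r) (normalized_kernel q)"
    "m = hardy_inner (normalized_kernel q) (normalized_kernel p)"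
  note d = this
  have "(norm l)\<^sup>2 \<le> 1"
    using hardy_dist_sq [OF assms(2,3)] polar_form_nonneg [OF assms(2,3), of "r - q"] by (simp add: d)
  then have l1: "norm l \<le> 1"
    by (simp add: abs_square_le_1)
  have 1: "(\<lambda>n. (norm (u r n - u q n * l))\<^sup>2) sums (hardy_dist q r)\<^sup>2"
    using hardy_dist_min_sums [OF assms(2,3), of l] by (simp add: u_def d)
  have "(\<lambda>n. (norm (u q n - u p n * m))\<^sup>2) sums (hardy_dist p q)\<^sup>2"
    using hardy_dist_min_sums [OF assms(1,2), of m] by (simp add: u_def d)
  from sums_mult2 [OF this, of "(norm l)\<^sup>2"]
  have 2: "(\<lambda>n. (norm (u q n * l - u p n * (m * l)))\<^sup>2) sums (hardy_dist p q * norm l)\<^sup>2"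
    by (simp add: power_mult_distrib norm_mult [symmetric] left_diff_distrib mult.assoc
        flip: power_mult_distrib)
  define C where "C = sqrt ((hardy_dist p r)\<^sup>2 + (norm (m * l - hardy_inner (normalized_kernel r) (normalized_kernel p)))\<^sup>2)"
  have 3: "(\<lambda>n. (norm ((u r n - u q n * l) + (u q n * l - u p n * (m * l))))\<^sup>2) sums C\<^sup>2"
    using hardy_dist_min_sums [OF assms(1,3), of "m * l"] by (simp add: u_def C_def)
  have "hardy_dist p r \<le> C"
    unfolding C_def by (rule real_le_rsqrt) simp
  also have "C \<le> hardy_dist q r + hardy_dist p q * norm l"
    by (rule l2_triangle [OF 1 2 3]) (simp_all add: assms hardy_dist_nonneg)
  also have "hardy_dist p q * norm l \<le> hardy_dist p q"
    using l1 by (simp add: assms hardy_dist_nonneg mult_left_le)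
  finally show ?thesis
    by simp
qed

section \<open>Meridians\<close>

lemma disc_cosh_sinh_identity:
  "(cmod (1 - cnj z * w))\<^sup>2 = (cmod (z - w))\<^sup>2 + (1 - (cmod z)\<^sup>2) * (1 - (cmod w)\<^sup>2)"
  unfolding cmod_power2 by (simp add: power2_eq_square algebra_simps)

definition meridian :: "quat \<Rightarrow> complex"
  where "meridian q = Complex (qre q) (norm (qvec q))"

lemma cmod_meridian [simp]: "cmod (meridian q) = norm q"
  using norm_sq_qvec [of q] by (simp add: meridian_def cmod_def real_sqrt_unique)

text \<open>
  Here \<open>m\<close> is the contribution of the meridians and \<open>s\<close> the one of the angle between the
  imaginary parts.  For \<open>s = 0\<close> the quotient is the square of the pseudo-hyperbolic distance
  of the meridians.
\<close>

lemma polar_form_meridian: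
  assumes "p \<in> \<bool>" "q \<in> \<bool>"
  defines "m \<equiv> (cmod (meridian p - meridian q))\<^sup>2"
    and "k \<equiv> (1 - (norm p)\<^sup>2) * (1 - (norm q)\<^sup>2)"
  defines "s \<equiv> (norm (q - p))\<^sup>2 - m" and "K \<equiv> (cmod (1 - cnj (meridian p) * cnj (meridian q)))\<^sup>2"
  shows "polar_form p q (q - p) = (m * K + k * s) / ((m + k) * K)"
    and "0 \<le> s" "0 < k" "0 < m + k" "m + k \<le> K" "0 < K"
proof -
  define x u y v where "x = qre p" "u = qre q" "y = norm (qvec p)" "v = norm (qvec q)"
  note d = this
  have n: "(norm p)\<^sup>2 = x\<^sup>2 + y\<^sup>2" "(norm q)\<^sup>2 = u\<^sup>2 + v\<^sup>2"
    using norm_sq_qvec [of p] norm_sq_qvec [of q] by (simp_all add: d)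
  have m: "m = (x - u)\<^sup>2 + (y - v)\<^sup>2"
    by (simp add: m_def meridian_def cmod_power2 d)
  show k: "0 < k"
    using assms(1,2) by (simp add: k_def in_ball_iff)
  then show mk: "0 < m + k"
    by (simp add: m_def add_nonneg_pos)
  have "(cmod (meridian p - cnj (meridian q)))\<^sup>2 = m + 4 * y * v"
    unfolding m by (simp add: meridian_def cmod_power2 d [symmetric]) (simp add: power2_eq_square algebra_simps)
  then have K: "K = m + k + 4 * y * v"
    using disc_cosh_sinh_identity [of "meridian p" "cnj (meridian q)"] by (simp add: K_def k_def)
  have yv: "0 \<le> 4 * y * v"
    by (simp add: d)
  then show "m + k \<le> K" "0 < K"
    using mk unfolding K by linarith+
  have "(norm (q - p))\<^sup>2 = (u - x)\<^sup>2 + (norm (qvec q - qvec p))\<^sup>2"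
    using norm_sq_qvec [of "q - p"] by (simp add: d qvec_diff)
  moreover have "\<bar>v - y\<bar> \<le> norm (qvec q - qvec p)"
    unfolding d by (rule norm_triangle_ineq3)
  then have "(v - y)\<^sup>2 \<le> (norm (qvec q - qvec p))\<^sup>2"
    by (metis abs_le_square_iff abs_norm_cancel)
  ultimately show "0 \<le> s"
    by (simp add: s_def m power2_commute)
  have "(q - p) \<bullet> (qvec p + qvec q) = v\<^sup>2 - y\<^sup>2"
    unfolding d norm_quat_sq by (simp add: inner_quat_def power2_eq_square algebra_simps)
  moreover have "(norm (q - p))\<^sup>2 = s + m"
    by (simp add: s_def)
  ultimately have num: "k * (norm (q - p))\<^sup>2
      + (qre (q - p))\<^sup>2 * ((qre p - qre q)\<^sup>2 + 2 * ((norm (qvec p))\<^sup>2 + (norm (qvec q))\<^sup>2))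
      + ((q - p) \<bullet> (qvec p + qvec q))\<^sup>2 = m * K + k * s"
    unfolding K quat_sel d [symmetric] unfolding m by algebra
  have "polar_denom p q = (m + k) * K"
    unfolding polar_denom_def K n d [symmetric] unfolding m k_def n by algebra
  then show "polar_form p q (q - p) = (m * K + k * s) / ((m + k) * K)"
    unfolding polar_form_def num [symmetric] by (simp add: k_def)
qed

text \<open>
  Although \<open>k\<close> tends to \<open>0\<close> at the boundary, the Euclidean distance is bounded by \<open>\<delta>\<close> uniformly on
  \<open>\<bool>\<close>: with \<open>K \<le> 4\<close> and \<open>s \<le> 4\<close> both \<open>m\<close> and \<open>s\<close> are dominated by the quotient of \<open>polar_form_meridian\<close>.
\<close>

lemma norm_diff_le_hardy_dist:
  assumes pq: "p \<in> \<bool>" "q \<in> \<bool>"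
  shows "(norm (p - q))\<^sup>2 \<le> 8 * (hardy_dist p q)\<^sup>2"
proof -
  define m k K s where "m = (cmod (meridian p - meridian q))\<^sup>2"
    "k = (1 - (norm p)\<^sup>2) * (1 - (norm q)\<^sup>2)"
    "K = (cmod (1 - cnj (meridian p) * cnj (meridian q)))\<^sup>2" "s = (norm (q - p))\<^sup>2 - m"
  note d = this
  note P = polar_form_meridian [OF pq, folded d(1,2), folded d(3,4)]
  have lt: "norm p \<le> 1" "norm q \<le> 1"
    using pq by (simp_all add: quat_ball_def)
  have "cmod (1 - cnj (meridian p) * cnj (meridian q)) \<le> 1 + norm p * norm q"
    by (rule order.trans [OF norm_triangle_ineq4]) (simp add: norm_mult)
  moreover have "norm p * norm q \<le> 1"
    using lt by (intro mult_le_one) auto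
  ultimately have "K \<le> 2\<^sup>2"
    unfolding d by (intro power_mono) auto
  then have K4: "K \<le> 4" by simp
  have "norm (q - p) \<le> 2"
    using norm_triangle_ineq4 [of q p] lt by linarith
  then have "(norm (q - p))\<^sup>2 \<le> 2\<^sup>2"
    by (intro power_mono) auto
  moreover have m0: "0 \<le> m"
    by (simp add: d)
  ultimately have s4: "s \<le> 4"
    by (simp add: d(4))
  have mK: "0 \<le> m * K" and ks: "0 \<le> k * s"
    using m0 P by simp_all
  have "m * ((m + k) * K) \<le> 4 * (m * K)"
  proof -
    have "(m * K) * (m + k) \<le> (m * K) * 4"
      using P(5) K4 mK by (intro mult_left_mono) auto
    then show ?thesis by (simp add: mult_ac)
  qed
  moreover have "s * ((m + k) * K) \<le> 4 * (m * K) + 4 * (k * s)"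
  proof -
    have "(m * K) * s \<le> (m * K) * 4" "(k * s) * K \<le> (k * s) * 4"
      using mK ks s4 K4 by (intro mult_left_mono; simp)+
    then show ?thesis by (simp add: algebra_simps)
  qed
  ultimately have "(m + s) * ((m + k) * K) \<le> 4 * (m * K) + (4 * (m * K) + 4 * (k * s))"
    unfolding distrib_right [of m s] by (rule add_mono)
  also have "\<dots> \<le> 8 * (m * K + k * s)"
    using ks by simp
  finally have "(m + s) * ((m + k) * K) \<le> 8 * (m * K + k * s)" .
  then have "m + s \<le> 8 * polar_form p q (q - p)"
    unfolding P(1) using P(4,6) by (simp add: pos_le_divide_eq)
  then show ?thesis
    using polar_form_nonneg [OF pq] by (simp add: hardy_dist_eq [OF pq] d(4) norm_minus_commute)
qed

section \<open>Subadditive functions of intervals\<close>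

lemma ennreal_le_add:
  assumes "x \<le> y + z"
  shows "ennreal x \<le> ennreal y + ennreal z"
proof -
  have "ennreal x \<le> ennreal (max 0 y + max 0 z)"
    using assms by (intro ennreal_leI) (auto simp: max_def)
  also have "\<dots> = ennreal y + ennreal z"
    by (simp add: ennreal_plus ennreal_max_0 del: ennreal_plus [symmetric])
  finally show ?thesis .
qed

lemma nn_integral_split_interval:
  fixes f :: "real \<Rightarrow> ennreal"
  assumes [measurable]: "f \<in> borel_measurable borel" and "a \<le> b" "b \<le> c"
  shows "(\<integral>\<^sup>+x\<in>{a..b}. f x \<partial>lborel) + (\<integral>\<^sup>+x\<in>{b..c}. f x \<partial>lborel) = (\<integral>\<^sup>+x\<in>{a..c}. f x \<partial>lborel)"
proof -
  have "(\<integral>\<^sup>+x\<in>{a..b}. f x \<partial>lborel) + (\<integral>\<^sup>+x\<in>{b..c}. f x \<partial>lborel) =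
      (\<integral>\<^sup>+x. f x * indicator {a..b} x + f x * indicator {b..c} x \<partial>lborel)"
    by (rule nn_integral_add [symmetric]) simp_all
  also have "\<dots> = (\<integral>\<^sup>+x\<in>{a..c}. f x \<partial>lborel)"
  proof (rule nn_integral_cong_AE)
    show "AE x in lborel. f x * indicator {a..b} x + f x * indicator {b..c} x = f x * indicator {a..c} x"
      using AE_lborel_singleton [of b]
      by eventually_elim (use assms(2,3) in \<open>auto split: split_indicator\<close>)
  qed
  finally show ?thesis .
qed

lemma const_le_nn_integral_interval:
  assumes "a \<le> b" and "\<And>x. a \<le> x \<Longrightarrow> x \<le> b \<Longrightarrow> m \<le> f x"
  shows "ennreal (m * (b - a)) \<le> (\<integral>\<^sup>+x\<in>{a..b}. ennreal (f x) \<partial>lborel)"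
proof -
  have "ennreal (m * (b - a)) = (\<integral>\<^sup>+x\<in>{a..b}. ennreal m \<partial>lborel)"
    using assms(1) by (simp add: nn_integral_cmult_indicator ennreal_mult'')
  also have "\<dots> \<le> (\<integral>\<^sup>+x\<in>{a..b}. ennreal (f x) \<partial>lborel)"
    using assms(2) by (intro nn_integral_mono) (auto split: split_indicator intro: ennreal_leI)
  finally show ?thesis .
qed

text \<open>
  Bolzano's bisection principle: the estimate with an additional error \<open>e (t - s)\<close> holds for
  short intervals around each point and is inherited by unions of adjacent intervals.
\<close>

lemma subadditive_le_integral_no_break:
  fixes F :: "real \<Rightarrow> real \<Rightarrow> real"
  assumes tri: "\<And>a b c. 0 \<le> a \<Longrightarrow> a \<le> b \<Longrightarrow> b \<le> c \<Longrightarrow> c \<le> 1 \<Longrightarrow> F a c \<le> F a b + F b c"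
    and loc: "\<And>x e. x \<in> {0..1} - S \<Longrightarrow> e > 0 \<Longrightarrow> \<exists>r>0. \<forall>s\<in>{0..1}. \<forall>t\<in>{0..1}.
      s \<le> x \<and> x \<le> t \<and> t - s < r \<longrightarrow> F s t \<le> (sg x + e) * (t - s)"
    and meas [measurable]: "sg \<in> borel_measurable borel"
    and cont: "continuous_on ({0..1} - S) sg"
    and ab: "0 \<le> a" "a \<le> b" "b \<le> 1" "{a..b} \<inter> S = {}"
  shows "ennreal (F a b) \<le> (\<integral>\<^sup>+x\<in>{a..b}. ennreal (sg x) \<partial>lborel)"
proof (rule ennreal_le_epsilon)
  fix e :: real assume e: "e > 0"
  define P where "P s t \<longleftrightarrow> (a \<le> s \<and> s \<le> t \<and> t \<le> b \<longrightarrow>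
    ennreal (F s t) \<le> (\<integral>\<^sup>+x\<in>{s..t}. ennreal (sg x) \<partial>lborel) + ennreal (e * (t - s)))" for s t
  have "P a b"
  proof (rule Bolzano [OF ab(2)])
    fix s u t assume P: "P s u" "P u t" and st: "s \<le> u" "u \<le> t"
    show "P s t"
      unfolding P_def
    proof
      assume A: "a \<le> s \<and> s \<le> t \<and> t \<le> b"
      have "ennreal (F s t) \<le> ennreal (F s u) + ennreal (F u t)"
        using A st ab by (intro ennreal_le_add tri) auto
      also have "\<dots> \<le> ((\<integral>\<^sup>+x\<in>{s..u}. ennreal (sg x) \<partial>lborel) + ennreal (e * (u - s)))
          + ((\<integral>\<^sup>+x\<in>{u..t}. ennreal (sg x) \<partial>lborel) + ennreal (e * (t - u)))"
        using P A st unfolding P_def by (intro add_mono) auto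
      also have "\<dots> = ((\<integral>\<^sup>+x\<in>{s..u}. ennreal (sg x) \<partial>lborel) + (\<integral>\<^sup>+x\<in>{u..t}. ennreal (sg x) \<partial>lborel))
          + (ennreal (e * (u - s)) + ennreal (e * (t - u)))"
        by (simp add: ac_simps)
      also have "\<dots> = (\<integral>\<^sup>+x\<in>{s..t}. ennreal (sg x) \<partial>lborel) + ennreal (e * (t - s))"
        using st e by (subst nn_integral_split_interval)
          (simp_all add: ennreal_plus [symmetric] algebra_simps del: ennreal_plus)
      finally show "ennreal (F s t) \<le> \<dots>" .
    qed
  next
    fix x assume x: "a \<le> x" "x \<le> b"
    then have xS: "x \<in> {0..1} - S"
      using ab by auto
    obtain r where r: "r > 0" "\<And>s t. s \<in> {0..1} \<Longrightarrow> t \<in> {0..1} \<Longrightarrow> s \<le> x \<Longrightarrow> x \<le> t \<Longrightarrow> t - s < r \<Longrightarrow>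
        F s t \<le> (sg x + e / 2) * (t - s)"
      using loc [OF xS, of "e / 2"] e by auto
    obtain r' where r': "r' > 0" "\<And>y. y \<in> {0..1} - S \<Longrightarrow> dist y x < r' \<Longrightarrow> dist (sg y) (sg x) < e / 2"
      using cont [unfolded continuous_on_iff] xS e by (meson half_gt_zero)
    show "\<exists>d>0. \<forall>s t. s \<le> x \<and> x \<le> t \<and> t - s < d \<longrightarrow> P s t"
    proof (intro exI conjI allI impI)
      show "min r r' > 0"
        using r r' by simp
      fix s t assume st: "s \<le> x \<and> x \<le> t \<and> t - s < min r r'"
      show "P s t"
        unfolding P_def
      proof
        assume A: "a \<le> s \<and> s \<le> t \<and> t \<le> b"
        have "F s t \<le> (sg x + e / 2) * (t - s)"
          using r(2) [of s t] st A ab by auto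
        also have "\<dots> = (sg x - e / 2) * (t - s) + e * (t - s)"
          by (simp add: algebra_simps)
        finally have "ennreal (F s t) \<le> ennreal ((sg x - e / 2) * (t - s) + e * (t - s))"
          by (rule ennreal_leI)
        also have "\<dots> \<le> ennreal ((sg x - e / 2) * (t - s)) + ennreal (e * (t - s))"
          by (rule ennreal_le_add) simp
        also have "\<dots> \<le> (\<integral>\<^sup>+x\<in>{s..t}. ennreal (sg x) \<partial>lborel) + ennreal (e * (t - s))"
        proof (intro add_right_mono const_le_nn_integral_interval)
          show "s \<le> t" using A by simp
          fix y assume y: "s \<le> y" "y \<le> t"
          then have "dist y x < r'"
            using st by (auto simp: dist_real_def)
          moreover have "y \<in> {a..b}"
            using y A by auto
          then have "y \<in> {0..1} - S"
            using ab by (auto simp: disjoint_iff)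
          ultimately show "sg x - e / 2 \<le> sg y"
            using r'(2) [of y] by (auto simp: dist_real_def abs_if split: if_splits)
        qed
        finally show "ennreal (F s t) \<le> \<dots>" .
      qed
    qed
  qed
  then have "ennreal (F a b) \<le> (\<integral>\<^sup>+x\<in>{a..b}. ennreal (sg x) \<partial>lborel) + ennreal (e * (b - a))"
    using ab by (simp add: P_def)
  also have "\<dots> \<le> (\<integral>\<^sup>+x\<in>{a..b}. ennreal (sg x) \<partial>lborel) + ennreal e"
    using ab e by (intro add_left_mono ennreal_leI) (simp add: mult_left_le)
  finally show "ennreal (F a b) \<le> (\<integral>\<^sup>+x\<in>{a..b}. ennreal (sg x) \<partial>lborel) + ennreal e" .
qed

text \<open>
  The finite set \<open>S\<close> is for the break points of a piecewise \<open>C\<^sup>1\<close> path, at which the speed may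
  be unbounded.  Intervals that end at such a point are limits of intervals inside, by
  the assumption \<open>small\<close>; longer ones are subdivided there.
\<close>

lemma subadditive_le_integral:
  fixes F :: "real \<Rightarrow> real \<Rightarrow> real"
  assumes S: "finite S"
    and tri: "\<And>a b c. 0 \<le> a \<Longrightarrow> a \<le> b \<Longrightarrow> b \<le> c \<Longrightarrow> c \<le> 1 \<Longrightarrow> F a c \<le> F a b + F b c"
    and small: "\<And>x e. x \<in> {0..1} \<Longrightarrow> e > 0 \<Longrightarrow> \<exists>r>0. \<forall>s\<in>{0..1}. \<forall>t\<in>{0..1}.
      \<bar>s - x\<bar> < r \<and> \<bar>t - x\<bar> < r \<longrightarrow> F s t \<le> e"
    and loc: "\<And>x e. x \<in> {0..1} - S \<Longrightarrow> e > 0 \<Longrightarrow> \<exists>r>0. \<forall>s\<in>{0..1}. \<forall>t\<in>{0..1}.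
      s \<le> x \<and> x \<le> t \<and> t - s < r \<longrightarrow> F s t \<le> (sg x + e) * (t - s)"
    and meas [measurable]: "sg \<in> borel_measurable borel"
    and cont: "continuous_on ({0..1} - S) sg"
    and ab: "0 \<le> a" "a \<le> b" "b \<le> 1"
  shows "ennreal (F a b) \<le> (\<integral>\<^sup>+x\<in>{a..b}. ennreal (sg x) \<partial>lborel)"
proof -
  have inner: "ennreal (F a b) \<le> (\<integral>\<^sup>+x\<in>{a..b}. ennreal (sg x) \<partial>lborel)"
    if ab: "0 \<le> a" "a \<le> b" "b \<le> 1" and ne: "{a<..<b} \<inter> S = {}" for a b
  proof (rule ennreal_le_epsilon)
    fix e :: real assume e: "e > 0"
    obtain r where r: "r > 0" "\<And>s t. s \<in> {0..1} \<Longrightarrow> t \<in> {0..1} \<Longrightarrow> \<bar>s - a\<bar> < r \<Longrightarrow> \<bar>t - a\<bar> < r \<Longrightarrow> F s t \<le> e / 2"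
      using small [of a "e / 2"] ab e by auto
    obtain r' where r': "r' > 0" "\<And>s t. s \<in> {0..1} \<Longrightarrow> t \<in> {0..1} \<Longrightarrow> \<bar>s - b\<bar> < r' \<Longrightarrow> \<bar>t - b\<bar> < r' \<Longrightarrow> F s t \<le> e / 2"
      using small [of b "e / 2"] ab e by auto
    show "ennreal (F a b) \<le> (\<integral>\<^sup>+x\<in>{a..b}. ennreal (sg x) \<partial>lborel) + ennreal e"
    proof (cases "a = b")
      case True
      then have "F a b \<le> e"
        using r(2) [of a b] r(1) ab e by auto
      then show ?thesis
        by (simp add: add_increasing ennreal_leI)
    next
      case False
      \<comment> \<open>Retreat from both ends by a distance over which \<open>F\<close> is at most \<open>e / 2\<close>.\<close>
      define h where "h = min (min r r') (b - a) / 3"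
      have h: "h > 0" "h < r" "h < r'" "3 * h \<le> b - a"
        using False ab r r' by (auto simp: h_def min_def)
      have "F a b \<le> F a (a + h) + F (a + h) b"
        using h ab by (intro tri) auto
      also have "F (a + h) b \<le> F (a + h) (b - h) + F (b - h) b"
        using h ab by (intro tri) auto
      also have "F a (a + h) \<le> e / 2"
        using h ab by (intro r(2)) auto
      also have "F (b - h) b \<le> e / 2"
        using h ab by (intro r'(2)) auto
      finally have "F a b \<le> F (a + h) (b - h) + e"
        by simp
      then have "ennreal (F a b) \<le> ennreal (F (a + h) (b - h)) + ennreal e"
        by (rule ennreal_le_add)
      also have "ennreal (F (a + h) (b - h)) \<le> (\<integral>\<^sup>+x\<in>{a + h..b - h}. ennreal (sg x) \<partial>lborel)"
      proof (rule subadditive_le_integral_no_break [OF tri loc meas cont])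
        show "{a + h..b - h} \<inter> S = {}"
          using ne h by (auto simp: disjoint_iff)
      qed (use h ab in auto)
      also have "\<dots> \<le> (\<integral>\<^sup>+x\<in>{a..b}. ennreal (sg x) \<partial>lborel)"
        using h by (intro nn_integral_mono) (auto split: split_indicator)
      finally show ?thesis
        by (simp add: add_right_mono)
    qed
  qed
  define P where "P s t \<longleftrightarrow> (0 \<le> s \<and> s \<le> t \<and> t \<le> 1 \<longrightarrow>
    ennreal (F s t) \<le> (\<integral>\<^sup>+x\<in>{s..t}. ennreal (sg x) \<partial>lborel))" for s t
  have trans: "P s t" if P: "P s u" "P u t" and st: "s \<le> u" "u \<le> t" for s u t
    unfolding P_def
  proof
    assume A: "0 \<le> s \<and> s \<le> t \<and> t \<le> 1"
    have "ennreal (F s t) \<le> ennreal (F s u) + ennreal (F u t)"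
      using A st by (intro ennreal_le_add tri) auto
    also have "\<dots> \<le> (\<integral>\<^sup>+x\<in>{s..u}. ennreal (sg x) \<partial>lborel) + (\<integral>\<^sup>+x\<in>{u..t}. ennreal (sg x) \<partial>lborel)"
      using P A st unfolding P_def by (intro add_mono) auto
    also have "\<dots> = (\<integral>\<^sup>+x\<in>{s..t}. ennreal (sg x) \<partial>lborel)"
      using st by (intro nn_integral_split_interval) auto
    finally show "ennreal (F s t) \<le> \<dots>" .
  qed
  have "P a b"
  proof (rule Bolzano [OF ab(2) trans])
    fix x assume "a \<le> x" "x \<le> b"
    obtain d where d: "d > 0" "\<And>y. y \<in> S \<Longrightarrow> y \<noteq> x \<Longrightarrow> d \<le> dist x y"
      using finite_set_avoid [OF S, of x] by auto
    show "\<exists>d>0. \<forall>s t. s \<le> x \<and> x \<le> t \<and> t - s < d \<longrightarrow> P s t"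
    proof (intro exI conjI allI impI)
      show "d > 0" by fact
      fix s t assume st: "s \<le> x \<and> x \<le> t \<and> t - s < d"
      have "{s<..<x} \<inter> S = {}" "{x<..<t} \<inter> S = {}"
        using st d(2) by (force simp: dist_real_def)+
      then have "P s x" "P x t"
        using inner st unfolding P_def by auto
      then show "P s t"
        using trans st by blast
    qed
  qed
  then show ?thesis
    using ab by (simp add: P_def)
qed

section \<open>Comparison of the distance with the metric at small scale\<close>

lemma polar_form_ge:
  assumes "w \<in> \<bool>"
  shows "(norm d)\<^sup>2 / ((1 - (norm w)\<^sup>2)\<^sup>2 + 4 * (norm (qvec w))\<^sup>2) \<le> polar_form w w d"
proof -
  define al Y where "al = 1 - (norm w)\<^sup>2" "Y = (norm (qvec w))\<^sup>2"
  note dd = this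
  have al: "al > 0" and Y: "Y \<ge> 0"
    using assms by (simp_all add: dd in_ball_iff)
  then have B: "al\<^sup>2 * (al\<^sup>2 + 4 * Y) > 0"
    by (simp add: add_pos_nonneg)
  have "(norm d)\<^sup>2 / (al\<^sup>2 + 4 * Y) = (al\<^sup>2 * (norm d)\<^sup>2) / (al\<^sup>2 * (al\<^sup>2 + 4 * Y))"
    using al by simp
  also have "\<dots> \<le> polar_form w w d"
    unfolding polar_form_diag dd [symmetric] using B Y by (intro divide_right_mono) auto
  finally show ?thesis
    by (simp add: dd)
qed

text \<open>
  The metric dominates a multiple of the Euclidean one, so that additive errors in
  \<open>polar_form\<close> become relative errors.
\<close>

lemma polar_form_diag_ge:
  assumes w: "w \<in> \<bool>"
  shows "(norm d)\<^sup>2 \<le> 4 * polar_form w w d"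
proof -
  define al Y where "al = 1 - (norm w)\<^sup>2" "Y = (norm (qvec w))\<^sup>2"
  note dd = this
  have al: "0 < al" "al \<le> 1"
    using w by (auto simp: dd in_ball_iff)
  have "Y \<le> 1 - al"
    using norm_sq_qvec [of w] by (simp add: dd)
  moreover have "al\<^sup>2 \<le> al"
    using al by (simp add: power2_eq_square mult_left_le)
  ultimately have "al\<^sup>2 + 4 * Y \<le> 4"
    using al by linarith
  moreover have "0 < al\<^sup>2 + 4 * Y"
    using al by (simp add: dd add_pos_nonneg)
  ultimately have "(norm d)\<^sup>2 / 4 \<le> (norm d)\<^sup>2 / (al\<^sup>2 + 4 * Y)"
    by (intro divide_left_mono mult_pos_pos) auto
  then show ?thesis
    using polar_form_ge [OF w, of d, folded dd] by linarith
qed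

lemma continuous_on_polar_form:
  "continuous_on (\<bool> \<times> \<bool> \<times> UNIV) (\<lambda>(p, q, e). polar_form p q e)"
  unfolding case_prod_beta polar_form_def
proof (intro continuous_on_divide)
  show "\<forall>x\<in>\<bool> \<times> \<bool> \<times> UNIV. polar_denom (fst x) (fst (snd x)) \<noteq> 0"
    using polar_denom_pos by force
  show "continuous_on (\<bool> \<times> \<bool> \<times> UNIV) (\<lambda>x. polar_denom (fst x) (fst (snd x)))"
    unfolding polar_denom_def by (intro continuous_intros)
qed (intro continuous_intros)

lemma polar_form_continuous:
  assumes "x \<in> \<bool>" "e > 0"
  shows "\<exists>r>0. \<forall>p\<in>\<bool>. \<forall>q\<in>\<bool>. \<forall>d'. dist p x < r \<longrightarrow> dist q x < r \<longrightarrow> dist d' d < r \<longrightarrow>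
    \<bar>sqrt (polar_form p q d') - sqrt (polar_form x x d)\<bar> < e"
proof -
  have "continuous_on (\<bool> \<times> \<bool> \<times> UNIV) (\<lambda>z. sqrt ((\<lambda>(p, q, e). polar_form p q e) z))"
    by (intro continuous_intros continuous_on_polar_form)
  then obtain r where r: "r > 0" "\<And>z. z \<in> \<bool> \<times> \<bool> \<times> UNIV \<Longrightarrow> dist z (x, x, d) < r \<Longrightarrow>
      dist (sqrt ((\<lambda>(p, q, e). polar_form p q e) z)) (sqrt (polar_form x x d)) < e"
    unfolding continuous_on_iff using assms
    by (metis (no_types, lifting) SigmaI UNIV_I case_prod_conv)
  show ?thesis
  proof (intro exI conjI ballI allI impI)
    show "r / 3 > 0" using r by simp
    fix p q d' :: quat assume p: "p \<in> \<bool>" "q \<in> \<bool>" "dist p x < r / 3" "dist q x < r / 3" "dist d' d < r / 3"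
    have "dist (p, q, d') (x, x, d) \<le> dist p x + dist (q, d') (x, d)"
      unfolding dist_Pair_Pair [of p] by (rule sqrt_sum_squares_le_sum) simp_all
    also have "dist (q, d') (x, d) \<le> dist q x + dist d' d"
      unfolding dist_Pair_Pair by (rule sqrt_sum_squares_le_sum) simp_all
    finally have "dist (p, q, d') (x, x, d) < r"
      using p by simp
    then show "\<bar>sqrt (polar_form p q d') - sqrt (polar_form x x d)\<bar> < e"
      using r(2) [of "(p, q, d')"] p by (simp add: dist_real_def)
  qed
qed

lemma hardy_dist_continuous:
  assumes "x \<in> \<bool>" "e > 0"
  shows "\<exists>r>0. \<forall>p\<in>\<bool>. \<forall>q\<in>\<bool>. dist p x < r \<longrightarrow> dist q x < r \<longrightarrow> hardy_dist p q < e"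
proof -
  obtain r where r: "r > 0" "\<forall>p\<in>\<bool>. \<forall>q\<in>\<bool>. \<forall>d'. dist p x < r \<longrightarrow> dist q x < r \<longrightarrow> dist d' 0 < r \<longrightarrow>
    \<bar>sqrt (polar_form p q d') - sqrt (polar_form x x 0)\<bar> < e"
    using polar_form_continuous [OF assms, of 0] by blast
  have 0: "polar_form x x 0 = 0"
    by (simp add: polar_form_def)
  show ?thesis
  proof (intro exI conjI ballI impI)
    show "r / 2 > 0" using r by simp
    fix p q assume p: "p \<in> \<bool>" "q \<in> \<bool>" "dist p x < r / 2" "dist q x < r / 2"
    have "dist (q - p) 0 < r"
      using dist_triangle2 [of q p x] p by (simp add: dist_norm)
    then show "hardy_dist p q < e"
      using r(2) [rule_format, of p q "q - p"] p r(1) by (simp add: hardy_dist_eq 0)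
  qed
qed

lemma polar_form_uniformly_continuous:
  assumes "R < 1" "e > 0"
  shows "\<exists>r>0. \<forall>p\<in>cball 0 R. \<forall>q\<in>cball 0 R. \<forall>w\<in>cball 0 R. dist p w < r \<longrightarrow> dist q w < r \<longrightarrow>
    (\<forall>d. \<bar>polar_form p q d - polar_form w w d\<bar> \<le> e * (norm d)\<^sup>2)"
proof -
  define K where "K = cball (0::quat) R \<times> cball (0::quat) R \<times> sphere (0::quat) 1"
  have "cball 0 R \<subseteq> \<bool>"
    using assms by (auto simp: quat_ball_def)
  then have "continuous_on K (\<lambda>(p, q, e). polar_form p q e)"
    by (intro continuous_on_subset [OF continuous_on_polar_form]) (auto simp: K_def)
  moreover have "compact K"
    by (simp add: K_def compact_Times)
  ultimately have "uniformly_continuous_on K (\<lambda>(p, q, e). polar_form p q e)"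
    by (rule compact_uniformly_continuous)
  then obtain r where r: "r > 0" "\<And>z z'. z \<in> K \<Longrightarrow> z' \<in> K \<Longrightarrow> dist z' z < r \<Longrightarrow>
      dist ((\<lambda>(p, q, e). polar_form p q e) z') ((\<lambda>(p, q, e). polar_form p q e) z) < e"
    unfolding uniformly_continuous_on_def using assms(2) by meson
  show ?thesis
  proof (intro exI conjI ballI allI impI)
    show "r / 2 > 0" using r by simp
    fix p q w d :: quat assume p: "p \<in> cball 0 R" "q \<in> cball 0 R" "w \<in> cball 0 R" "dist p w < r / 2" "dist q w < r / 2"
    show "\<bar>polar_form p q d - polar_form w w d\<bar> \<le> e * (norm d)\<^sup>2"
    proof (cases "d = 0")
      case True
      then show ?thesis by (simp add: polar_form_def)
    next
      case False
      define u where "u = d /\<^sub>R norm d"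
      have u: "norm u = 1" "d = norm d *\<^sub>R u"
        using False by (simp_all add: u_def)
      have "dist (p, q, u) (w, w, u) \<le> dist p w + dist (q, u) (w, u)"
        unfolding dist_Pair_Pair [of p] by (rule sqrt_sum_squares_le_sum) simp_all
      then have "dist (p, q, u) (w, w, u) < r"
        using p by (simp add: dist_Pair_Pair)
      then have "\<bar>polar_form p q u - polar_form w w u\<bar> < e"
        using r(2) [of "(w, w, u)" "(p, q, u)"] p u by (simp add: K_def dist_real_def)
      then have "(norm d)\<^sup>2 * \<bar>polar_form p q u - polar_form w w u\<bar> \<le> (norm d)\<^sup>2 * e"
        by (intro mult_left_mono) auto
      moreover have "\<bar>polar_form p q d - polar_form w w d\<bar> = (norm d)\<^sup>2 * \<bar>polar_form p q u - polar_form w w u\<bar>"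
        by (subst (1 2) u(2)) (simp add: polar_form_scaleR abs_mult flip: right_diff_distrib)
      ultimately show ?thesis
        by (simp add: mult.commute)
    qed
  qed
qed

text \<open>
  This is what the convergence of \<open>\<delta>(p, q)\<^sup>2\<close> to the metric has to say about polygons: the length of a
  short segment is at most \<open>\<delta>(p, q) / (1 - e)\<close>.
\<close>

lemma hardy_dist_ge_segment:
  assumes "R < 1" "0 < e" "e < 1"
  shows "\<exists>r>0. \<forall>p\<in>cball 0 R. \<forall>q\<in>cball 0 R. dist p q < r \<longrightarrow>
    (\<forall>w\<in>closed_segment p q. (1 - e) * sqrt (polar_form w w (q - p)) \<le> hardy_dist p q)"
proof -
  obtain r where r: "r > 0" "\<forall>p\<in>cball 0 R. \<forall>q\<in>cball 0 R. \<forall>w\<in>cball 0 R. dist p w < r \<longrightarrow> dist q w < r \<longrightarrow>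
    (\<forall>d. \<bar>polar_form p q d - polar_form w w d\<bar> \<le> e / 4 * (norm d)\<^sup>2)"
    using polar_form_uniformly_continuous [OF assms(1), of "e / 4"] assms by auto
  have sub: "cball 0 R \<subseteq> \<bool>"
    using assms by (auto simp: quat_ball_def)
  show ?thesis
  proof (intro exI conjI ballI impI)
    show "r > 0" by fact
    fix p q w :: quat assume p: "p \<in> cball 0 R" "q \<in> cball 0 R" "dist p q < r" and w: "w \<in> closed_segment p q"
    have wR: "w \<in> cball 0 R"
      using w p closed_segment_subset [OF p(1,2) convex_cball] by auto
    have "dist p w < r" "dist q w < r"
      using dist_in_closed_segment [OF w] p by (simp_all add: dist_commute)
    then have "\<bar>polar_form p q (q - p) - polar_form w w (q - p)\<bar> \<le> e / 4 * (norm (q - p))\<^sup>2"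
      using r p wR by blast
    also have "\<dots> \<le> e / 4 * (4 * polar_form w w (q - p))"
      using wR sub assms by (intro mult_left_mono polar_form_diag_ge) auto
    finally have "(1 - e) * polar_form w w (q - p) \<le> polar_form p q (q - p)"
      by (simp add: algebra_simps)
    moreover have "(1 - e)\<^sup>2 * polar_form w w (q - p) \<le> (1 - e) * polar_form w w (q - p)"
      using assms wR sub by (intro mult_right_mono polar_form_nonneg)
        (auto simp: power2_eq_square mult_left_le)
    ultimately have "sqrt ((1 - e)\<^sup>2 * polar_form w w (q - p)) \<le> sqrt (polar_form p q (q - p))"
      by simp
    then show "(1 - e) * sqrt (polar_form w w (q - p)) \<le> hardy_dist p q"
      using assms p sub by (auto simp: hardy_dist_eq real_sqrt_mult subset_iff)
  qed
qed

abbreviation (input) ball_dist :: "quat \<Rightarrow> quat \<Rightarrow> ennreal"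
  where "ball_dist \<equiv> riem_dist \<bool> hardy_metric"

abbreviation (input) ball_length :: "(real \<Rightarrow> quat) \<Rightarrow> ennreal"
  where "ball_length \<equiv> riem_length hardy_metric"

abbreviation (input) path_speed :: "(real \<Rightarrow> quat) \<Rightarrow> real \<Rightarrow> real"
  where "path_speed c t \<equiv> sqrt (hardy_metric (c t) (vector_derivative c (at t)))"

abbreviation (input) ball_isometries :: "(quat \<Rightarrow> quat) set"
  where "ball_isometries \<equiv> riem_isometries \<bool> hardy_metric"

text \<open>
  The speed of a path, modified on a null set so that it is measurable.
\<close>

lemma valid_path_speed:
  assumes "valid_path c" "path_image c \<subseteq> \<bool>"
  obtains S c' sg where "finite S" "\<And>t. t \<in> {0..1} - S \<Longrightarrow> (c has_vector_derivative c' t) (at t)"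
    "continuous_on ({0..1} - S) c'"
    "\<And>t. t \<in> {0..1} - S \<Longrightarrow> sg t = sqrt (polar_form (c t) (c t) (c' t))"
    "continuous_on ({0..1} - S) sg" "sg \<in> borel_measurable borel"
    "\<And>a b. 0 \<le> a \<Longrightarrow> b \<le> 1 \<Longrightarrow>
      (\<integral>\<^sup>+t\<in>{a..b}. ennreal (path_speed c t) \<partial>lborel) =
      (\<integral>\<^sup>+t\<in>{a..b}. ennreal (sg t) \<partial>lborel)"
proof -
  obtain S where S: "finite S" "c C1_differentiable_on ({0..1} - S)" and cc: "continuous_on {0..1} c"
    using assms(1) by (auto simp: valid_path_def piecewise_C1_differentiable_on_def)
  obtain c' where c': "\<And>t. t \<in> {0..1} - S \<Longrightarrow> (c has_vector_derivative c' t) (at t)"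
      "continuous_on ({0..1} - S) c'"
    using S(2) unfolding C1_differentiable_on_def by blast
  define s where "s t = sqrt (polar_form (c t) (c t) (c' t))" for t
  define sg where "sg t = indicator ({0..1} - S) t *\<^sub>R s t" for t
  have cB: "c t \<in> \<bool>" if "t \<in> {0..1}" for t
    using assms(2) that by (auto simp: path_image_def)
  have "continuous_on ({0..1} - S) (\<lambda>t. (c t, c t, c' t))"
    using cc c'(2) by (intro continuous_intros) (auto elim: continuous_on_subset)
  moreover have "(\<lambda>t. (c t, c t, c' t)) ` ({0..1} - S) \<subseteq> \<bool> \<times> \<bool> \<times> UNIV"
    using cB by auto
  ultimately have "continuous_on ({0..1} - S) (\<lambda>t. polar_form (c t) (c t) (c' t))"
    using continuous_on_compose2 [OF continuous_on_polar_form] by fastforce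
  then have s: "continuous_on ({0..1} - S) s"
    unfolding s_def by (intro continuous_intros)
  have Sm: "{0..1} - S \<in> sets borel"
    using S(1) by (intro sets.Diff borel_closed) (auto simp: finite_imp_closed)
  have "sg \<in> borel_measurable borel"
    unfolding sg_def using borel_measurable_continuous_on_indicator [OF Sm s] .
  moreover have "continuous_on ({0..1} - S) sg"
    using s by (rule continuous_on_eq) (simp add: sg_def)
  moreover have "(\<integral>\<^sup>+t\<in>{a..b}. ennreal (path_speed c t) \<partial>lborel) =
      (\<integral>\<^sup>+t\<in>{a..b}. ennreal (sg t) \<partial>lborel)" if "0 \<le> a" "b \<le> 1" for a b
  proof (rule nn_integral_cong_AE)
    have "AE t in lborel. t \<notin> S"
      using S(1) by (intro AE_not_in) (rule finite_imp_null_set_lborel)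
    then show "AE t in lborel.
        ennreal (path_speed c t) * indicator {a..b} t =
        ennreal (sg t) * indicator {a..b} t"
    proof eventually_elim
      fix t assume t: "t \<notin> S"
      show "ennreal (path_speed c t) * indicator {a..b} t =
        ennreal (sg t) * indicator {a..b} t"
      proof (cases "t \<in> {a..b}")
        case True
        then have t: "t \<in> {0..1} - S"
          using t that by auto
        then show ?thesis
          using vector_derivative_at [OF c'(1) [OF t]] cB
          by (simp add: sg_def s_def hardy_metric_polar_form)
      qed simp
    qed
  qed
  moreover have "sg t = sqrt (polar_form (c t) (c t) (c' t))" if "t \<in> {0..1} - S" for t
    using that by (simp add: sg_def s_def)
  ultimately show ?thesis
    using that S(1) c' by blast
qed

text \<open>
  Any \<open>D\<close> with the triangle inequality that is at small scale not larger than \<open>\<delta>\<close> bounds lengths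
  from below.  It is used for \<open>D = \<delta>\<close> and for the hyperbolic distance of the meridians.
\<close>

lemma dist_le_riem_length:
  assumes tri: "\<And>p q r. p \<in> \<bool> \<Longrightarrow> q \<in> \<bool> \<Longrightarrow> r \<in> \<bool> \<Longrightarrow> D p r \<le> D p q + D q r"
    and loc: "\<And>x e. x \<in> \<bool> \<Longrightarrow> e > 0 \<Longrightarrow> \<exists>r>0. \<forall>p\<in>\<bool>. \<forall>q\<in>\<bool>. dist p x < r \<longrightarrow> dist q x < r \<longrightarrow>
      D p q \<le> (1 + e) * hardy_dist p q"
    and c: "valid_path c" "path_image c \<subseteq> \<bool>" and ab: "0 \<le> a" "a \<le> b" "b \<le> 1"
  shows "ennreal (D (c a) (c b)) \<le>
    (\<integral>\<^sup>+t\<in>{a..b}. ennreal (path_speed c t) \<partial>lborel)"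
proof -
  obtain S c' sg where S: "finite S" and c': "\<And>t. t \<in> {0..1} - S \<Longrightarrow> (c has_vector_derivative c' t) (at t)"
    "continuous_on ({0..1} - S) c'"
    and sg: "\<And>t. t \<in> {0..1} - S \<Longrightarrow> sg t = sqrt (polar_form (c t) (c t) (c' t))"
    "continuous_on ({0..1} - S) sg" "sg \<in> borel_measurable borel"
    and eq: "\<And>a b. 0 \<le> a \<Longrightarrow> b \<le> 1 \<Longrightarrow>
      (\<integral>\<^sup>+t\<in>{a..b}. ennreal (path_speed c t) \<partial>lborel) =
      (\<integral>\<^sup>+t\<in>{a..b}. ennreal (sg t) \<partial>lborel)"
    by (rule valid_path_speed [OF c]) (rule that)
  have cc: "continuous_on {0..1} c"
    using c by (auto simp: valid_path_def piecewise_C1_differentiable_on_def)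
  have cB: "c t \<in> \<bool>" if "t \<in> {0..1}" for t
    using c(2) that by (auto simp: path_image_def)
  show ?thesis
    unfolding eq [OF ab(1,3)]
  proof (rule subadditive_le_integral [OF S _ _ _ sg(3,2) ab])
    fix a b d :: real assume "0 \<le> a" "a \<le> b" "b \<le> d" "d \<le> 1"
    then show "D (c a) (c d) \<le> D (c a) (c b) + D (c b) (c d)"
      by (intro tri cB) auto
  next
    fix x e :: real assume x: "x \<in> {0..1}" and e: "e > 0"
    obtain r1 where r1: "r1 > 0" "\<forall>p\<in>\<bool>. \<forall>q\<in>\<bool>. dist p (c x) < r1 \<longrightarrow> dist q (c x) < r1 \<longrightarrow>
      D p q \<le> (1 + 1) * hardy_dist p q"
      using loc [OF cB [OF x], of 1] by auto
    obtain r2 where r2: "r2 > 0" "\<forall>p\<in>\<bool>. \<forall>q\<in>\<bool>. dist p (c x) < r2 \<longrightarrow> dist q (c x) < r2 \<longrightarrow>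
      hardy_dist p q < e / 2"
      using hardy_dist_continuous [OF cB [OF x], of "e / 2"] e by auto
    obtain r where r: "r > 0" "\<And>t. t \<in> {0..1} \<Longrightarrow> dist t x < r \<Longrightarrow> dist (c t) (c x) < min r1 r2"
      using cc [unfolded continuous_on_iff, rule_format, OF x, of "min r1 r2"] r1(1) r2(1) by auto
    show "\<exists>r>0. \<forall>s\<in>{0..1}. \<forall>t\<in>{0..1}. \<bar>s - x\<bar> < r \<and> \<bar>t - x\<bar> < r \<longrightarrow> D (c s) (c t) \<le> e"
    proof (intro exI conjI ballI impI)
      show "r > 0" by fact
      fix s t assume st: "s \<in> {0..1::real}" "t \<in> {0..1::real}" "\<bar>s - x\<bar> < r \<and> \<bar>t - x\<bar> < r"
      then have "dist (c s) (c x) < min r1 r2" "dist (c t) (c x) < min r1 r2"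
        using r(2) by (auto simp: dist_real_def)
      then have "D (c s) (c t) \<le> (1 + 1) * hardy_dist (c s) (c t)" "hardy_dist (c s) (c t) < e / 2"
        using r1(2) r2(2) cB st by auto
      then show "D (c s) (c t) \<le> e"
        by simp
    qed
  next
    fix x e :: real assume x: "x \<in> {0..1} - S" and e: "e > 0"
    then have xB: "c x \<in> \<bool>"
      by (simp add: cB)
    have sg0: "0 \<le> sg x"
      using sg(1) [OF x] polar_form_nonneg [OF xB xB] by simp
    \<comment> \<open>The budget \<open>e\<close> is split between the additive error \<open>e1\<close> of the speed and the relative error \<open>e2\<close> of \<open>D\<close>.\<close>
    define e1 where "e1 = e / 2"
    define e2 where "e2 = e / 2 / (sg x + e1 + 1)"
    have e1: "e1 > 0" and e2: "e2 > 0" and e3: "(1 + e2) * (sg x + e1) \<le> sg x + e"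
    proof -
      show "e1 > 0" "e2 > 0"
        using e sg0 by (simp_all add: e1_def e2_def)
      then have "e2 * (sg x + e1) \<le> e2 * (sg x + e1 + 1)"
        by simp
      also have "\<dots> = e / 2"
      proof -
        have "sg x + e1 + 1 \<noteq> 0"
          unfolding e1_def using e sg0 by linarith
        then show ?thesis
          unfolding e2_def by (metis nonzero_divide_eq_eq)
      qed
      finally have "sg x + e1 + e2 * (sg x + e1) \<le> sg x + e"
        by (simp add: e1_def)
      then show "(1 + e2) * (sg x + e1) \<le> sg x + e"
        by (simp add: distrib_right)
    qed
    obtain r1 where r1: "r1 > 0" "\<forall>p\<in>\<bool>. \<forall>q\<in>\<bool>. dist p (c x) < r1 \<longrightarrow> dist q (c x) < r1 \<longrightarrow>
      D p q \<le> (1 + e2) * hardy_dist p q"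
      using loc [OF xB e2] by auto
    obtain r2 where r2: "r2 > 0" "\<forall>p\<in>\<bool>. \<forall>q\<in>\<bool>. \<forall>d. dist p (c x) < r2 \<longrightarrow> dist q (c x) < r2 \<longrightarrow>
      dist d (c' x) < r2 \<longrightarrow> \<bar>sqrt (polar_form p q d) - sqrt (polar_form (c x) (c x) (c' x))\<bar> < e1"
      using polar_form_continuous [OF xB e1] by blast
    obtain r3 where r3: "r3 > 0" "\<And>t. t \<in> {0..1} \<Longrightarrow> dist t x < r3 \<Longrightarrow> dist (c t) (c x) < min r1 r2"
      using cc [unfolded continuous_on_iff, rule_format, of x "min r1 r2"] x r1(1) r2(1) by auto
    have "(c has_derivative (\<lambda>h. h *\<^sub>R c' x)) (at x)"
      using c'(1) [OF x] by (simp add: has_vector_derivative_def)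
    then obtain r4 where r4: "r4 > 0" "\<And>t. norm (t - x) < r4 \<Longrightarrow>
        norm (c t - c x - (t - x) *\<^sub>R c' x) \<le> r2 / 2 * norm (t - x)"
      unfolding has_derivative_at_alt using r2(1) by (metis half_gt_zero)
    show "\<exists>r>0. \<forall>s\<in>{0..1}. \<forall>t\<in>{0..1}. s \<le> x \<and> x \<le> t \<and> t - s < r \<longrightarrow>
        D (c s) (c t) \<le> (sg x + e) * (t - s)"
    proof (intro exI conjI ballI impI)
      show "min r3 r4 > 0" using r3 r4 by simp
      fix s t assume st: "s \<in> {0..1::real}" "t \<in> {0..1::real}" "s \<le> x \<and> x \<le> t \<and> t - s < min r3 r4"
      then have near: "dist (c s) (c x) < min r1 r2" "dist (c t) (c x) < min r1 r2"
        using r3(2) by (auto simp: dist_real_def)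
      have D: "D (c s) (c t) \<le> (1 + e2) * hardy_dist (c s) (c t)"
        using near r1(2) cB st by auto
      show "D (c s) (c t) \<le> (sg x + e) * (t - s)"
      proof (cases "s = t")
        case True
        then show ?thesis
          using D cB [OF st(1)] by (simp add: hardy_dist_eq polar_form_def)
      next
        case False
        then have lt: "s < t" using st by auto
        \<comment> \<open>The difference quotient is close to the derivative for all short intervals that contain \<open>x\<close>.\<close>
        have "norm (c t - c s - (t - s) *\<^sub>R c' x) =
            norm ((c t - c x - (t - x) *\<^sub>R c' x) - (c s - c x - (s - x) *\<^sub>R c' x))"
          by (simp add: algebra_simps)
        also have "\<dots> \<le> r2 / 2 * norm (t - x) + r2 / 2 * norm (s - x)"
          using st by (intro order.trans [OF norm_triangle_ineq4] add_mono r4(2)) auto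
        also have "\<dots> = r2 / 2 * ((t - x) + (x - s))"
        proof -
          have "norm (t - x) = t - x" "norm (s - x) = x - s"
            using st by auto
          then show ?thesis
            by (simp only: distrib_left)
        qed
        also have "\<dots> = r2 / 2 * (t - s)"
          by (rule arg_cong [where f = "(*) (r2 / 2)"]) simp
        finally have le: "norm (c t - c s - (t - s) *\<^sub>R c' x) \<le> r2 / 2 * (t - s)" .
        define d where "d = (c t - c s) /\<^sub>R (t - s)"
        have d: "c t - c s = (t - s) *\<^sub>R d"
          using lt by (simp add: d_def)
        have "(t - s) * norm (d - c' x) = norm (c t - c s - (t - s) *\<^sub>R c' x)"
          unfolding d using lt by (simp flip: scaleR_diff_right)
        then have "(t - s) * norm (d - c' x) \<le> (t - s) * (r2 / 2)"
          using le by (simp add: mult.commute)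
        then have "norm (d - c' x) \<le> r2 / 2"
          using lt by simp
        then have "dist d (c' x) < r2"
          using r2(1) by (simp add: dist_norm)
        then have "sqrt (polar_form (c s) (c t) d) \<le> sg x + e1"
          using r2(2) [rule_format, of "c s" "c t" d] near cB st sg(1) [OF x] by auto
        then have "hardy_dist (c s) (c t) \<le> (t - s) * (sg x + e1)"
          using lt st cB unfolding hardy_dist_eq [OF cB [OF st(1)] cB [OF st(2)]] d polar_form_scaleR
          by (simp add: real_sqrt_mult)
        then have "(1 + e2) * hardy_dist (c s) (c t) \<le> (1 + e2) * ((t - s) * (sg x + e1))"
          using e2 by (intro mult_left_mono) auto
        also have "\<dots> = (t - s) * ((1 + e2) * (sg x + e1))"
          by (simp add: mult_ac)
        also have "\<dots> \<le> (t - s) * (sg x + e)"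
          using e3 lt by (intro mult_left_mono) auto
        finally show ?thesis
          using D by (simp add: mult.commute)
      qed
    qed
  qed
qed

section \<open>The length metric is the Riemannian distance\<close>

lemma riem_length_le_const:
  assumes "\<And>t. 0 \<le> t \<Longrightarrow> t \<le> 1 \<Longrightarrow> sqrt (g (c t) (vector_derivative c (at t))) \<le> M"
  shows "riem_length g c \<le> ennreal M"
proof -
  have "riem_length g c \<le> (\<integral>\<^sup>+t\<in>{0..1::real}. ennreal M \<partial>lborel)"
    unfolding riem_length_def using assms
    by (intro nn_integral_mono) (auto split: split_indicator intro: ennreal_leI)
  then show ?thesis
    by (simp add: nn_integral_cmult_indicator)
qed

text \<open>
  Each half of the joined path runs at twice the speed in half the time.
\<close>

lemma riem_length_joinpaths_le:
  assumes g1: "valid_path g1" "path_image g1 \<subseteq> \<bool>" and g2: "valid_path g2" "path_image g2 \<subseteq> \<bool>"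
  shows "ball_length (g1 +++ g2) \<le> ball_length g1 + ball_length g2"
proof -
  obtain S1 c1 s1 where S1: "finite S1" and c1: "\<And>t. t \<in> {0..1} - S1 \<Longrightarrow> (g1 has_vector_derivative c1 t) (at t)"
    and s1: "\<And>t. t \<in> {0..1} - S1 \<Longrightarrow> s1 t = sqrt (polar_form (g1 t) (g1 t) (c1 t))"
    and m1 [measurable]: "s1 \<in> borel_measurable borel"
    and i1: "\<And>a b. 0 \<le> a \<Longrightarrow> b \<le> 1 \<Longrightarrow>
      (\<integral>\<^sup>+t\<in>{a..b}. ennreal (path_speed g1 t) \<partial>lborel) =
      (\<integral>\<^sup>+t\<in>{a..b}. ennreal (s1 t) \<partial>lborel)"
    by (rule valid_path_speed [OF g1]) (rule that)
  obtain S2 c2 s2 where S2: "finite S2" and c2: "\<And>t. t \<in> {0..1} - S2 \<Longrightarrow> (g2 has_vector_derivative c2 t) (at t)"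
    and s2: "\<And>t. t \<in> {0..1} - S2 \<Longrightarrow> s2 t = sqrt (polar_form (g2 t) (g2 t) (c2 t))"
    and m2 [measurable]: "s2 \<in> borel_measurable borel"
    and i2: "\<And>a b. 0 \<le> a \<Longrightarrow> b \<le> 1 \<Longrightarrow>
      (\<integral>\<^sup>+t\<in>{a..b}. ennreal (path_speed g2 t) \<partial>lborel) =
      (\<integral>\<^sup>+t\<in>{a..b}. ennreal (s2 t) \<partial>lborel)"
    by (rule valid_path_speed [OF g2]) (rule that)
  define f1 where "f1 t = ennreal (s1 t) * indicator {0..1} t" for t
  define f2 where "f2 t = ennreal (s2 t) * indicator {0..1} t" for t
  have [measurable]: "f1 \<in> borel_measurable borel" "f2 \<in> borel_measurable borel"
    unfolding f1_def f2_def by measurable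
  \<comment> \<open>The times at which the joined path passes the junction or a break point.\<close>
  define Z where "Z = {1/2} \<union> (\<lambda>x. x / 2) ` S1 \<union> (\<lambda>x. (x + 1) / 2) ` S2"
  have "AE t in lborel. t \<notin> Z"
    using S1 S2 by (intro AE_not_in finite_imp_null_set_lborel) (simp add: Z_def)
  then have "ball_length (g1 +++ g2) \<le> (\<integral>\<^sup>+t. 2 * f1 (0 + 2 * t) + 2 * f2 (-1 + 2 * t) \<partial>lborel)"
    unfolding riem_length_def
  proof (intro nn_integral_mono_AE, eventually_elim)
    fix t assume t: "t \<notin> Z"
    let ?I = "\<lambda>t. ennreal (path_speed (g1 +++ g2) t) * indicator {0..1} t"
    have half: "path_speed (g1 +++ g2) t = 2 * s (2 * t + k)"
      if "open U" "t \<in> U" "\<And>x. x \<in> U \<Longrightarrow> g (2 * x + k) = (g1 +++ g2) x"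
        and "(g has_vector_derivative d) (at (2 * t + k))" "g (2 * t + k) \<in> \<bool>"
        and "s (2 * t + k) = sqrt (polar_form (g (2 * t + k)) (g (2 * t + k)) d)"
      for g d s k U
    proof -
      have "((\<lambda>x. 2 * x + k) has_vector_derivative 2) (at t)"
        by (auto intro!: derivative_eq_intros)
      from vector_diff_chain_at [OF this that(4)]
      have "(g \<circ> (\<lambda>x. 2 * x + k) has_vector_derivative 2 *\<^sub>R d) (at t)" .
      then have "(g1 +++ g2 has_vector_derivative 2 *\<^sub>R d) (at t)"
        by (rule has_vector_derivative_transform_within_open [OF _ that(1,2)]) (simp add: that(3))
      then have vd: "vector_derivative (g1 +++ g2) (at t) = 2 *\<^sub>R d"
        by (rule vector_derivative_at)
      then show ?thesis
        using that(2,3,5,6) by (simp add: hardy_metric_polar_form polar_form_scaleR real_sqrt_mult flip: that(3))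
    qed
    consider "t \<notin> {0..1}" | "0 \<le> t" "t < 1/2" | "t > 1/2" "t \<le> 1"
      using t by (force simp: Z_def)
    then show "?I t \<le> 2 * f1 (0 + 2 * t) + 2 * f2 (-1 + 2 * t)"
    proof cases
      case 2
      have "2 * t \<notin> S1"
        using t image_eqI [of t "\<lambda>x. x / 2" "2 * t" S1] by (auto simp: Z_def)
      then have u: "2 * t + 0 \<in> {0..1} - S1"
        using 2 by auto
      have "path_speed (g1 +++ g2) t = 2 * s1 (2 * t + 0)"
        by (rule half [where g = g1 and d = "c1 (2 * t + 0)" and s = s1 and k = 0 and U = "{..<1/2}",
              OF _ _ _ c1 [OF u] _ s1 [OF u]])
          (use 2 u g1(2) in \<open>auto simp: joinpaths_def path_image_def\<close>)
      then have "?I t = 2 * f1 (0 + 2 * t)"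
        using u 2 by (simp add: f1_def ennreal_mult')
      then show ?thesis by simp
    next
      case 3
      have "2 * t - 1 \<notin> S2"
        using t image_eqI [of t "\<lambda>x. (x + 1) / 2" "2 * t - 1" S2] by (auto simp: Z_def)
      then have u: "2 * t + - 1 \<in> {0..1} - S2"
        using 3 by auto
      have "path_speed (g1 +++ g2) t = 2 * s2 (2 * t + - 1)"
        by (rule half [where g = g2 and d = "c2 (2 * t + - 1)" and s = s2 and k = "- 1" and U = "{1/2<..}",
              OF _ _ _ c2 [OF u] _ s2 [OF u]])
          (use 3 u g2(2) in \<open>auto simp: joinpaths_def path_image_def\<close>)
      then have "?I t = 2 * f2 (-1 + 2 * t)"
        using u 3 by (simp add: f2_def ennreal_mult')
      then show ?thesis by simp
    qed (simp add: f1_def f2_def)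
  qed
  also have "\<dots> = (\<integral>\<^sup>+t. 2 * f1 (0 + 2 * t) \<partial>lborel) + (\<integral>\<^sup>+t. 2 * f2 (-1 + 2 * t) \<partial>lborel)"
    by (rule nn_integral_add) measurable
  also have "\<dots> = (\<integral>\<^sup>+t. f1 t \<partial>lborel) + (\<integral>\<^sup>+t. f2 t \<partial>lborel)"
    using nn_integral_real_affine [of f1 2 0] nn_integral_real_affine [of f2 2 "-1"]
    by (simp add: nn_integral_cmult)
  also have "\<dots> = ball_length g1 + ball_length g2"
    unfolding riem_length_def f1_def f2_def by (simp add: i1 i2)
  finally show ?thesis .
qed

lemma riem_dist_triangle:
  "ball_dist p r \<le> ball_dist p q + ball_dist q r"
proof (rule ennreal_le_epsilon)
  fix e :: real
  assume fin: "ball_dist p q + ball_dist q r < Orderings.top" and e: "e > 0"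
  have near: "\<exists>c. valid_path c \<and> path_image c \<subseteq> \<bool> \<and> pathstart c = a \<and> pathfinish c = b \<and>
      ball_length c < ball_dist a b + ennreal (e / 2)"
    if "ball_dist a b < Orderings.top" for a b
  proof -
    have "ball_dist a b < ball_dist a b + ennreal (e / 2)"
      using that e by (simp add: ennreal_zero_less_divide)
    then show ?thesis
      by (subst (asm) riem_dist_def) (auto simp: INF_less_iff)
  qed
  obtain c1 where c1: "valid_path c1" "path_image c1 \<subseteq> \<bool>" "pathstart c1 = p" "pathfinish c1 = q"
      "ball_length c1 < ball_dist p q + ennreal (e / 2)"
    using near [of p q] fin by auto
  obtain c2 where c2: "valid_path c2" "path_image c2 \<subseteq> \<bool>" "pathstart c2 = q" "pathfinish c2 = r"
      "ball_length c2 < ball_dist q r + ennreal (e / 2)"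
    using near [of q r] fin by auto
  have "ball_dist p r \<le> ball_length (c1 +++ c2)"
    unfolding riem_dist_def using c1 c2
    by (intro INF_lower) (auto simp: path_image_join intro!: valid_path_join)
  also have "\<dots> \<le> ball_length c1 + ball_length c2"
    using c1 c2 by (intro riem_length_joinpaths_le)
  also have "\<dots> \<le> (ball_dist p q + ennreal (e / 2)) + (ball_dist q r + ennreal (e / 2))"
    using c1 c2 by (intro add_mono) auto
  also have "\<dots> = (ball_dist p q + ball_dist q r) + (ennreal (e / 2) + ennreal (e / 2))"
    by (simp add: ac_simps)
  also have "ennreal (e / 2) + ennreal (e / 2) = ennreal e"
    using e by (simp flip: ennreal_plus)
  finally show "ball_dist p r \<le>
      ball_dist p q + ball_dist q r + ennreal e" .
qed

lemma riem_dist_le_segment: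
  assumes "p \<in> \<bool>" "q \<in> \<bool>"
    and "\<And>w. w \<in> closed_segment p q \<Longrightarrow> sqrt (polar_form w w (q - p)) \<le> M"
  shows "ball_dist p q \<le> ennreal M"
proof -
  have sub: "closed_segment p q \<subseteq> \<bool>"
    using assms by (simp add: quat_ball_def closed_segment_subset)
  have "ball_dist p q \<le> ball_length (linepath p q)"
    unfolding riem_dist_def using sub by (intro INF_lower) auto
  also have "\<dots> \<le> ennreal M"
  proof (rule riem_length_le_const)
    fix t :: real assume "0 \<le> t" "t \<le> 1"
    then have w: "linepath p q t \<in> closed_segment p q"
      by (auto simp: linepath_in_path)
    then show "sqrt (hardy_metric (linepath p q t) (vector_derivative (linepath p q) (at t))) \<le> M"
      using assms(3) [OF w] sub by (auto simp: hardy_metric_polar_form)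
  qed
  finally show ?thesis .
qed

lemma riem_dist_self: "p \<in> \<bool> \<Longrightarrow> ball_dist p p = 0"
  using riem_dist_le_segment [of p p 0] by (simp add: polar_form_def)

lemma hardy_curve_continuous:
  assumes "curve_in \<bool> hardy_dist c"
  shows "continuous_on {0..1} c"
  unfolding continuous_on_iff
proof (intro ballI allI impI)
  fix t e :: real assume t: "t \<in> {0..1}" and e: "e > 0"
  have cB: "c s \<in> \<bool>" if "s \<in> {0..1}" for s
    using assms that by (auto simp: curve_in_def)
  have "0 < e / 3"
    using e by simp
  then obtain d where d: "d > 0" "\<forall>s\<in>{0..1}. \<bar>s - t\<bar> < d \<longrightarrow> hardy_dist (c s) (c t) < e / 3"
    using assms t unfolding curve_in_def by blast
  have "dist (c s) (c t) < e" if s: "s \<in> {0..1}" "dist s t < d" for s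
  proof -
    have "(hardy_dist (c s) (c t))\<^sup>2 \<le> (e / 3)\<^sup>2"
      using d(2) s hardy_dist_nonneg [OF cB cB, of s t] t by (intro power_mono) (auto simp: dist_real_def)
    then have "(norm (c s - c t))\<^sup>2 \<le> 8 * (e / 3)\<^sup>2"
      using norm_diff_le_hardy_dist [OF cB cB, of s t] s t by auto
    also have "\<dots> < e\<^sup>2"
      using e by (simp add: power_divide)
    finally show ?thesis
      using e by (simp add: dist_norm power2_less_imp_less)
  qed
  then show "\<exists>d>0. \<forall>s\<in>{0..1}. dist s t < d \<longrightarrow> dist (c s) (c t) < e"
    using d(1) by blast
qed

text \<open>
  Compare with inscribed polygons of small mesh.
\<close>

lemma riem_dist_le_curve_length:
  assumes c: "curve_in \<bool> hardy_dist c"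
  shows "ball_dist (c 0) (c 1) \<le> curve_length hardy_dist c"
proof (rule ennreal_le_epsilon)
  fix e' :: real assume fin: "curve_length hardy_dist c < Orderings.top" and e': "e' > 0"
  obtain L where L: "curve_length hardy_dist c = ennreal L" "L \<ge> 0"
    using fin by (cases "curve_length hardy_dist c") auto
  \<comment> \<open>So small that dividing \<open>L\<close> by \<open>1 - e\<close> raises it by at most the given error.\<close>
  define e where "e = e' / (L + e' + 1)"
  have e: "0 < e" "e < 1"
    using e' L by (auto simp: e_def field_simps)
  have "e * (L + e') \<le> e * (L + e' + 1)"
    using e by simp
  also have "\<dots> = e'"
  proof -
    have "L + e' + 1 \<noteq> 0"
      using e' L by linarith
    then show ?thesis
      unfolding e_def by (metis nonzero_divide_eq_eq)
  qed
  finally have L': "L / (1 - e) \<le> L + e'"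
    using e by (simp add: field_simps)
  have cB: "c s \<in> \<bool>" if "s \<in> {0..1}" for s
    using c that by (auto simp: curve_in_def)
  have cont: "continuous_on {0..1} c"
    by (rule hardy_curve_continuous [OF c])
  obtain m where m: "m \<in> {0..1}" "\<And>t. t \<in> {0..1} \<Longrightarrow> norm (c t) \<le> norm (c m)"
    using continuous_attains_sup [OF compact_Icc _ continuous_on_norm [OF cont]] by auto
  have "norm (c m) < 1"
    using cB [OF m(1)] by (simp add: quat_ball_def)
  from hardy_dist_ge_segment [OF this e]
  obtain r where r: "r > 0" "\<forall>p\<in>cball 0 (norm (c m)). \<forall>q\<in>cball 0 (norm (c m)). dist p q < r \<longrightarrow>
    (\<forall>w\<in>closed_segment p q. (1 - e) * sqrt (polar_form w w (q - p)) \<le> hardy_dist p q)"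
    by blast
  obtain d where d: "d > 0" "\<And>s t. s \<in> {0..1} \<Longrightarrow> t \<in> {0..1} \<Longrightarrow> dist t s < d \<Longrightarrow> dist (c t) (c s) < r"
    using compact_uniformly_continuous [OF cont] r(1) unfolding uniformly_continuous_on_def by auto
  obtain n where n0: "1 / d < real n"
    using reals_Archimedean2 by blast
  moreover have "0 < 1 / d"
    using d(1) by simp
  ultimately have n: "1 / d < real n" "n > 0"
    by (auto intro: gr0I)
  define t where "t i = real i / real n" for i
  have t01: "t i \<in> {0..1}" if "i \<le> n" for i
    using that n by (simp add: t_def)
  have step: "ball_dist (c (t i)) (c (t (Suc i))) \<le>
      ennreal (1 / (1 - e)) * ennreal (hardy_dist (c (t i)) (c (t (Suc i))))" if "i < n" for i
  proof -
    have ti: "t i \<in> {0..1}" "t (Suc i) \<in> {0..1}"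
      using t01 [of i] t01 [of "Suc i"] that by simp_all
    have "dist (t i) (t (Suc i)) = 1 / real n"
      using n by (simp add: t_def dist_real_def field_simps)
    also have "\<dots> < d"
      using n d by (simp add: field_simps)
    finally have "dist (c (t i)) (c (t (Suc i))) < r"
      using d(2) ti by auto
    then have *: "(1 - e) * sqrt (polar_form w w (c (t (Suc i)) - c (t i))) \<le> hardy_dist (c (t i)) (c (t (Suc i)))"
      if "w \<in> closed_segment (c (t i)) (c (t (Suc i)))" for w
      using r(2) m(2) ti that by auto
    have "ball_dist (c (t i)) (c (t (Suc i))) \<le> ennreal (1 / (1 - e) * hardy_dist (c (t i)) (c (t (Suc i))))"
      using * e by (intro riem_dist_le_segment cB ti) (auto simp: field_simps)
    also have "\<dots> = ennreal (1 / (1 - e)) * ennreal (hardy_dist (c (t i)) (c (t (Suc i))))"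
      using e by (intro ennreal_mult hardy_dist_nonneg cB ti) auto
    finally show ?thesis .
  qed
  have sum: "ball_dist (c (t 0)) (c (t k)) \<le>
      (\<Sum>i<k. ball_dist (c (t i)) (c (t (Suc i))))" if "k \<le> n" for k
    using that
  proof (induction k)
    case 0
    then show ?case
      using riem_dist_self [OF cB [OF t01 [of 0]]] by simp
  next
    case (Suc k)
    have "ball_dist (c (t 0)) (c (t (Suc k))) \<le>
        ball_dist (c (t 0)) (c (t k)) + ball_dist (c (t k)) (c (t (Suc k)))"
      by (rule riem_dist_triangle)
    also have "\<dots> \<le> (\<Sum>i<k. ball_dist (c (t i)) (c (t (Suc i)))) + ball_dist (c (t k)) (c (t (Suc k)))"
      using Suc by (intro add_right_mono) auto
    finally show ?case by simp
  qed
  have tn: "t 0 = 0" "t n = 1"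
    using n by (simp_all add: t_def)
  have "ball_dist (c 0) (c 1) \<le> (\<Sum>i<n. ball_dist (c (t i)) (c (t (Suc i))))"
    using sum [of n] tn by simp
  also have "\<dots> \<le> (\<Sum>i<n. ennreal (1 / (1 - e)) * ennreal (hardy_dist (c (t i)) (c (t (Suc i)))))"
    by (intro sum_mono step) auto
  also have "\<dots> = ennreal (1 / (1 - e)) * (\<Sum>i<n. ennreal (hardy_dist (c (t i)) (c (t (Suc i)))))"
    by (simp add: sum_distrib_left)
  also have "\<dots> \<le> ennreal (1 / (1 - e)) * curve_length hardy_dist c"
  proof (intro mult_left_mono)
    have "(n, t) \<in> {(n, t :: nat \<Rightarrow> real). t 0 = 0 \<and> t n = 1 \<and> (\<forall>i<n. t i \<le> t (Suc i))}"
      using tn by (auto simp: t_def divide_right_mono)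
    then show "(\<Sum>i<n. ennreal (hardy_dist (c (t i)) (c (t (Suc i))))) \<le> curve_length hardy_dist c"
      unfolding curve_length_def by (rule SUP_upper2) simp
  qed simp
  also have "\<dots> = ennreal (L / (1 - e))"
    unfolding L(1) using e L by (simp flip: ennreal_mult')
  also have "\<dots> \<le> ennreal (L + e')"
    using L' by (rule ennreal_leI)
  also have "\<dots> = curve_length hardy_dist c + ennreal e'"
    using L e' by simp
  finally show "ball_dist (c 0) (c 1) \<le> curve_length hardy_dist c + ennreal e'" .
qed

lemma valid_path_hardy_curve:
  assumes c: "valid_path c" "path_image c \<subseteq> \<bool>"
  shows "curve_in \<bool> hardy_dist c"
proof -
  have cc: "continuous_on {0..1} c"
    using c by (auto simp: valid_path_def piecewise_C1_differentiable_on_def)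
  have cB: "c t \<in> \<bool>" if "t \<in> {0..1}" for t
    using c(2) that by (auto simp: path_image_def)
  have "\<exists>r>0. \<forall>s\<in>{0..1}. \<bar>s - t\<bar> < r \<longrightarrow> hardy_dist (c s) (c t) < e" if t: "t \<in> {0..1}" "e > 0" for t e :: real
  proof -
    obtain r where r: "r > 0" "\<forall>p\<in>\<bool>. \<forall>q\<in>\<bool>. dist p (c t) < r \<longrightarrow> dist q (c t) < r \<longrightarrow> hardy_dist p q < e"
      using hardy_dist_continuous [OF cB [OF t(1)] t(2)] by blast
    obtain d where "d > 0" "\<forall>s\<in>{0..1}. dist s t < d \<longrightarrow> dist (c s) (c t) < r"
      using cc [unfolded continuous_on_iff, rule_format, OF t(1) r(1)] by auto
    then show ?thesis
      using r cB t by (intro exI [of _ d]) (auto simp: dist_real_def)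
  qed
  then show ?thesis
    using c(2) by (auto simp: curve_in_def path_image_def)
qed

text \<open>
  Add up \<open>dist_le_riem_length\<close> for \<open>D = \<delta>\<close> over the intervals of a partition.
\<close>

lemma curve_length_le_riem_length:
  assumes c: "valid_path c" "path_image c \<subseteq> \<bool>"
  shows "curve_length hardy_dist c \<le> ball_length c"
  unfolding curve_length_def
proof (rule SUP_least, clarify)
  fix n and t :: "nat \<Rightarrow> real"
  assume t: "t 0 = 0" "t n = 1" "\<forall>i<n. t i \<le> t (Suc i)"
  obtain S c' sg where sg: "sg \<in> borel_measurable borel"
    and eq: "\<And>a b. 0 \<le> a \<Longrightarrow> b \<le> 1 \<Longrightarrow>
      (\<integral>\<^sup>+t\<in>{a..b}. ennreal (path_speed c t) \<partial>lborel) =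
      (\<integral>\<^sup>+t\<in>{a..b}. ennreal (sg t) \<partial>lborel)"
    by (rule valid_path_speed [OF c]) (rule that)
  have esg: "(\<lambda>x. ennreal (sg x)) \<in> borel_measurable borel"
    using sg by measurable
  have mono: "t i \<le> t j" if "i \<le> j" "j \<le> n" for i j
    using that by (induction j rule: dec_induct) (use t(3) in \<open>auto intro: order.trans\<close>)
  have "(\<Sum>i<k. ennreal (hardy_dist (c (t i)) (c (t (Suc i))))) \<le> (\<integral>\<^sup>+x\<in>{0..t k}. ennreal (sg x) \<partial>lborel)"
    if "k \<le> n" for k
    using that
  proof (induction k)
    case (Suc k)
    have b: "0 \<le> t k" "t k \<le> t (Suc k)" "t (Suc k) \<le> 1"
      using mono [of 0 k] mono [of k "Suc k"] mono [of "Suc k" n] t Suc by auto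
    have "ennreal (hardy_dist (c (t k)) (c (t (Suc k)))) \<le>
      (\<integral>\<^sup>+t\<in>{t k..t (Suc k)}. ennreal (path_speed c t) \<partial>lborel)"
    proof (rule dist_le_riem_length [OF hardy_dist_triangle _ c b])
      fix x and e :: real assume "e > 0"
      then show "\<exists>r>0. \<forall>p\<in>\<bool>. \<forall>q\<in>\<bool>. dist p x < r \<longrightarrow> dist q x < r \<longrightarrow> hardy_dist p q \<le> (1 + e) * hardy_dist p q"
        by (intro exI [of _ 1]) (auto simp: distrib_right hardy_dist_nonneg)
    qed
    also have "\<dots> = (\<integral>\<^sup>+x\<in>{t k..t (Suc k)}. ennreal (sg x) \<partial>lborel)"
      using b by (intro eq) auto
    finally have "(\<Sum>i<Suc k. ennreal (hardy_dist (c (t i)) (c (t (Suc i))))) \<le>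
        (\<integral>\<^sup>+x\<in>{0..t k}. ennreal (sg x) \<partial>lborel) + (\<integral>\<^sup>+x\<in>{t k..t (Suc k)}. ennreal (sg x) \<partial>lborel)"
      using Suc by (simp add: add_mono)
    also have "\<dots> = (\<integral>\<^sup>+x\<in>{0..t (Suc k)}. ennreal (sg x) \<partial>lborel)"
      using b by (intro nn_integral_split_interval esg) auto
    finally show ?case .
  qed simp
  from this [of n]
  show "(\<Sum>i<n. ennreal (hardy_dist (c (t i)) (c (t (Suc i))))) \<le> ball_length c"
    using t by (simp add: riem_length_def eq)
qed

lemma length_metric_eq_riem_dist:
  "length_metric \<bool> hardy_dist p q = ball_dist p q"
proof (rule antisym)
  show "length_metric \<bool> hardy_dist p q \<le> ball_dist p q"
    unfolding riem_dist_def
  proof (rule INF_greatest, clarify)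
    fix c :: "real \<Rightarrow> quat" assume c: "valid_path c" "path_image c \<subseteq> \<bool>"
    have "length_metric \<bool> hardy_dist (pathstart c) (pathfinish c) \<le> curve_length hardy_dist c"
      unfolding length_metric_def using valid_path_hardy_curve [OF c]
      by (intro INF_lower) (auto simp: pathstart_def pathfinish_def)
    also have "\<dots> \<le> ball_length c"
      using c by (rule curve_length_le_riem_length)
    finally show "length_metric \<bool> hardy_dist (pathstart c) (pathfinish c) \<le> ball_length c" .
  qed
  show "ball_dist p q \<le> length_metric \<bool> hardy_dist p q"
    unfolding length_metric_def
    by (rule INF_greatest) (use riem_dist_le_curve_length in blast)
qed

section \<open>The hyperbolic lower bound for the Riemannian distance\<close>

text \<open>
  The hyperbolic distance, of curvature \<open>-4\<close>, in which \<open>artanh r\<close> is the distance of \<open>0\<close> to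
  points of norm \<open>r\<close>.
\<close>

definition disc_dist :: "complex \<Rightarrow> complex \<Rightarrow> real"
  where "disc_dist z w = arsinh (cmod (z - w) / sqrt ((1 - (cmod z)\<^sup>2) * (1 - (cmod w)\<^sup>2)))"

lemma disc_dist_nonneg: "cmod z < 1 \<Longrightarrow> cmod w < 1 \<Longrightarrow> 0 \<le> disc_dist z w"
  unfolding disc_dist_def
  by (rule iffD1 [OF sinh_real_nonneg_iff]) (simp add: abs_square_le_1)

lemma disc_dist_sinh_cosh:
  assumes "cmod z < 1" "cmod w < 1"
  shows "sinh (disc_dist z w) = cmod (z - w) / sqrt ((1 - (cmod z)\<^sup>2) * (1 - (cmod w)\<^sup>2))"
    and "cosh (disc_dist z w) = cmod (1 - cnj z * w) / sqrt ((1 - (cmod z)\<^sup>2) * (1 - (cmod w)\<^sup>2))"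
proof -
  show "sinh (disc_dist z w) = cmod (z - w) / sqrt ((1 - (cmod z)\<^sup>2) * (1 - (cmod w)\<^sup>2))"
    by (simp add: disc_dist_def)
  define k where "k = (1 - (cmod z)\<^sup>2) * (1 - (cmod w)\<^sup>2)"
  have k: "k > 0"
    using assms by (simp add: k_def abs_square_less_1)
  have "cosh (disc_dist z w) = sqrt ((cmod (z - w) / sqrt k)\<^sup>2 + 1)"
    by (simp add: disc_dist_def cosh_arsinh_real k_def)
  also have "(cmod (z - w) / sqrt k)\<^sup>2 + 1 = (cmod (1 - cnj z * w))\<^sup>2 / k"
    unfolding disc_cosh_sinh_identity k_def [symmetric] using k by (simp add: power_divide add_divide_distrib)
  also have "sqrt \<dots> = cmod (1 - cnj z * w) / sqrt k"
    by (simp add: real_sqrt_divide)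
  finally show "cosh (disc_dist z w) = cmod (1 - cnj z * w) / sqrt ((1 - (cmod z)\<^sup>2) * (1 - (cmod w)\<^sup>2))"
    by (simp add: k_def)
qed

text \<open>
  By the addition theorem the claim is \<open>cosh d(z, w) \<le> cosh (d(z, u) + d(u, w))\<close>, and all
  terms are explicit.  It reduces to the triangle inequality in \<open>\<complex>\<close> for the identity
  \<open>(1 - cnj z w)(1 - |u|\<^sup>2) = (1 - cnj z u)(1 - cnj u w) - (cnj z - cnj u)(w - u)\<close>.
\<close>

lemma disc_dist_triangle:
  assumes "cmod z < 1" "cmod u < 1" "cmod w < 1"
  shows "disc_dist z w \<le> disc_dist z u + disc_dist u w"
proof -
  define a b c where "a = 1 - (cmod z)\<^sup>2" "b = 1 - (cmod u)\<^sup>2" "c = 1 - (cmod w)\<^sup>2"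
  note d = this
  have pos: "a > 0" "b > 0" "c > 0"
    using assms by (simp_all add: d abs_square_less_1)
  have "(1 - cnj z * w) * of_real b = (1 - cnj z * u) * (1 - cnj u * w) - (cnj z - cnj u) * (w - u)"
    unfolding d of_real_diff of_real_1 complex_norm_square by (simp add: algebra_simps)
  then have "cmod (1 - cnj z * w) * b = cmod ((1 - cnj z * u) * (1 - cnj u * w) - (cnj z - cnj u) * (w - u))"
    using pos by (metis norm_mult norm_of_real abs_of_pos)
  also have "\<dots> \<le> cmod (1 - cnj z * u) * cmod (1 - cnj u * w) + cmod (z - u) * cmod (u - w)"
    by (rule order.trans [OF norm_triangle_ineq4])
      (simp add: norm_mult norm_minus_commute flip: complex_cnj_diff)
  finally have le: "cmod (1 - cnj z * w) * b \<le>
      cmod (1 - cnj z * u) * cmod (1 - cnj u * w) + cmod (z - u) * cmod (u - w)" .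
  have sq: "sqrt (a * b) * sqrt (b * c) = sqrt (a * c) * b"
    using pos by (simp add: real_sqrt_mult)
  have "cosh (disc_dist z w) = (cmod (1 - cnj z * w) * b) / (sqrt (a * c) * b)"
    using pos by (simp add: disc_dist_sinh_cosh assms d [symmetric])
  also have "\<dots> \<le> (cmod (1 - cnj z * u) * cmod (1 - cnj u * w) + cmod (z - u) * cmod (u - w)) / (sqrt (a * c) * b)"
    using le pos by (intro divide_right_mono) auto
  also have "\<dots> = cosh (disc_dist z u) * cosh (disc_dist u w) + sinh (disc_dist z u) * sinh (disc_dist u w)"
    by (simp add: disc_dist_sinh_cosh assms d [symmetric] add_divide_distrib flip: sq)
  also have "\<dots> = cosh (disc_dist z u + disc_dist u w)"
    by (simp add: cosh_add)
  finally show ?thesis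
    using disc_dist_nonneg assms by (subst (asm) cosh_real_nonneg_le_iff) auto
qed

text \<open>
  Moving \<open>q\<close> by a rotation into the slice of \<open>p\<close>, on the same side, does not increase \<open>\<delta>\<close>.
\<close>

lemma tanh_meridian_le_hardy_dist:
  assumes "p \<in> \<bool>" "q \<in> \<bool>"
  shows "tanh (disc_dist (meridian p) (meridian q)) \<le> hardy_dist p q"
proof -
  define m k where "m = (cmod (meridian p - meridian q))\<^sup>2" "k = (1 - (norm p)\<^sup>2) * (1 - (norm q)\<^sup>2)"
  note d = this
  note P = polar_form_meridian [OF assms, folded d]
  have lt: "norm p < 1" "norm q < 1"
    using assms by (simp_all add: quat_ball_def)
  have "(tanh (disc_dist (meridian p) (meridian q)))\<^sup>2 = m / (m + k)"
    using P(3) lt unfolding tanh_def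
    by (simp add: disc_dist_sinh_cosh power_divide disc_cosh_sinh_identity flip: d)
  also have "\<dots> = (m * (cmod (1 - cnj (meridian p) * cnj (meridian q)))\<^sup>2) /
      ((m + k) * (cmod (1 - cnj (meridian p) * cnj (meridian q)))\<^sup>2)"
    using P(6) by simp
  also have "\<dots> \<le> polar_form p q (q - p)"
    unfolding P(1) using P(2-6) by (intro divide_right_mono) auto
  also have "\<dots> = (hardy_dist p q)\<^sup>2"
    by (simp add: hardy_dist_eq [OF assms] polar_form_nonneg [OF assms])
  finally show ?thesis
    using hardy_dist_nonneg [OF assms] by (rule power2_le_imp_le)
qed

lemma le_sinh_real: "0 \<le> x \<Longrightarrow> x \<le> sinh (x::real)"
  using real_le_x_sinh [of x] by (simp add: sinh_field_def exp_minus)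

text \<open>
  At small scale \<open>tanh\<close> is close to the identity, so the preceding bound by \<open>\<delta>\<close> holds for the hyperbolic
  distance itself up to a factor close to \<open>1\<close>, which is all that \<open>dist_le_riem_length\<close> asks for.
\<close>

lemma meridian_le_riem_dist:
  "ennreal (disc_dist (meridian p) (meridian q)) \<le> ball_dist p q"
  unfolding riem_dist_def
proof (rule INF_greatest, clarify)
  fix c :: "real \<Rightarrow> quat"
  assume c: "valid_path c" "path_image c \<subseteq> \<bool>" "p = pathstart c" "q = pathfinish c"
  define D where "D p q = disc_dist (meridian p) (meridian q)" for p q
  have "ennreal (D (c 0) (c 1)) \<le>
    (\<integral>\<^sup>+t\<in>{0..1}. ennreal (path_speed c t) \<partial>lborel)"
  proof (rule dist_le_riem_length [OF _ _ c(1,2)])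
    show "D p r \<le> D p q + D q r" if "p \<in> \<bool>" "q \<in> \<bool>" "r \<in> \<bool>" for p q r
      using that unfolding D_def by (intro disc_dist_triangle) (auto simp: quat_ball_def)
    fix x and e :: real assume x: "x \<in> \<bool>" and e: "e > 0"
    \<comment> \<open>For \<open>tanh D \<le> h\<close> one has \<open>cosh\<^sup>2 D \<le> 1 + e\<close>.\<close>
    define h where "h = sqrt (e / (1 + e))"
    have h: "h > 0" "h\<^sup>2 = e / (1 + e)"
      using e by (simp_all add: h_def)
    obtain r where r: "r > 0" "\<forall>p\<in>\<bool>. \<forall>q\<in>\<bool>. dist p x < r \<longrightarrow> dist q x < r \<longrightarrow> hardy_dist p q < h"
      using hardy_dist_continuous [OF x h(1)] by blast
    have "D p q \<le> (1 + e) * hardy_dist p q"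
      if pq: "p \<in> \<bool>" "q \<in> \<bool>" and "hardy_dist p q < h" for p q
    proof -
      have n: "0 \<le> D p q"
        using pq unfolding D_def by (intro disc_dist_nonneg) (auto simp: quat_ball_def)
      have t: "0 \<le> tanh (D p q)" "tanh (D p q) \<le> hardy_dist p q"
        using n tanh_meridian_le_hardy_dist [OF pq] by (simp_all add: D_def)
      then have "(tanh (D p q))\<^sup>2 \<le> h\<^sup>2"
        using that by (intro power_mono) auto
      then have "1 / (1 + e) \<le> 1 - (tanh (D p q))\<^sup>2"
        using e by (simp add: h(2) field_simps)
      then have "(cosh (D p q))\<^sup>2 * (1 / (1 + e)) \<le> (cosh (D p q))\<^sup>2 * (1 - (tanh (D p q))\<^sup>2)"
        by (intro mult_left_mono) auto
      also have "\<dots> = 1"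
        by (simp add: tanh_def power_divide right_diff_distrib hyperbolic_pythagoras)
      finally have "(cosh (D p q))\<^sup>2 \<le> 1 + e"
        using e by (simp add: field_simps)
      also have "\<dots> \<le> (1 + e)\<^sup>2"
        using e by (simp add: power2_eq_square)
      finally have c: "cosh (D p q) \<le> 1 + e"
        by (rule power2_le_imp_le) (use e in simp)
      have "D p q \<le> sinh (D p q)"
        using n by (rule le_sinh_real)
      also have "\<dots> = cosh (D p q) * tanh (D p q)"
        by (simp add: tanh_def)
      also have "\<dots> \<le> (1 + e) * hardy_dist p q"
        using c t e by (intro mult_mono) auto
      finally show ?thesis .
    qed
    then show "\<exists>r>0. \<forall>p\<in>\<bool>. \<forall>q\<in>\<bool>. dist p x < r \<longrightarrow> dist q x < r \<longrightarrow> D p q \<le> (1 + e) * hardy_dist p q"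
      using r by blast
  qed auto
  then show "ennreal (disc_dist (meridian (pathstart c)) (meridian (pathfinish c))) \<le> ball_length c"
    by (simp add: riem_length_def D_def pathstart_def pathfinish_def)
qed

section \<open>Calculus of iterated differentiability\<close>

text \<open>
  \<open>Ck_on\<close> sees a function through its derivatives at the points of \<open>X\<close>, which for open \<open>X\<close> depend on its
  values on \<open>X\<close> only.
\<close>

lemma Ck_on_cong:
  assumes "open X" "\<And>x. x \<in> X \<Longrightarrow> f x = g x" "Ck_on k X f"
  shows "Ck_on k X g"
  using assms(2,3)
proof (induction k arbitrary: f g)
  case 0
  then show ?case by (simp cong: continuous_on_cong)
next
  case (Suc k)
  have d: "(g has_derivative frechet_derivative f (at x)) (at x)" if "x \<in> X" for x
  proof (rule has_derivative_transform_within_open [OF _ assms(1) that])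
    show "(f has_derivative frechet_derivative f (at x)) (at x)"
      using Suc.prems that by (simp flip: frechet_derivative_works)
  qed (use Suc.prems in auto)
  then have fr: "frechet_derivative f (at x) = frechet_derivative g (at x)" if "x \<in> X" for x
    using that frechet_derivative_at by blast
  have "Ck_on k X (\<lambda>x. frechet_derivative g (at x) v)" for v
    by (rule Suc.IH [of "\<lambda>x. frechet_derivative f (at x) v"]) (use Suc.prems fr in auto)
  then show ?case
    using d by (auto simp: differentiable_def)
qed

lemma Ck_on_Suc_imp: "Ck_on (Suc k) X f \<Longrightarrow> Ck_on k X f"
proof (induction k arbitrary: f)
  case 0
  then show ?case
    by (auto intro!: differentiable_imp_continuous_on differentiable_at_imp_differentiable_on)
next
  case (Suc k)
  then show ?case by auto
qed

text \<open>
  The derivative may be computed by any formula that holds on \<open>X\<close>.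
\<close>

lemma Ck_on_SucI:
  assumes "open X" "\<And>x. x \<in> X \<Longrightarrow> (f has_derivative f' x) (at x)"
    and "\<And>v. Ck_on k X (\<lambda>x. f' x v)"
  shows "Ck_on (Suc k) X f"
proof -
  have "frechet_derivative f (at x) = f' x" if "x \<in> X" for x
    using assms(2) [OF that] frechet_derivative_at by metis
  then have "Ck_on k X (\<lambda>x. frechet_derivative f (at x) v)" for v
    by (intro Ck_on_cong [OF assms(1) _ assms(3) [of v]]) simp
  then show ?thesis
    using assms(2) by (auto simp: differentiable_def)
qed

lemma Ck_on_SucD:
  assumes "Ck_on (Suc k) X f" "x \<in> X"
  shows "(f has_derivative frechet_derivative f (at x)) (at x)"
  using assms by (simp flip: frechet_derivative_works)

lemma Ck_on_const: "open X \<Longrightarrow> Ck_on k X (\<lambda>x. c)"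
proof (induction k arbitrary: c)
  case (Suc k)
  show ?case
    by (rule Ck_on_SucI [OF Suc.prems has_derivative_const Suc.IH [OF Suc.prems]])
qed simp

lemma Ck_on_linear:
  assumes "open X" "bounded_linear f"
  shows "Ck_on k X f"
proof (cases k)
  case 0
  then show ?thesis
    using assms(2) by (auto intro: bounded_linear.continuous_on [OF _ continuous_on_id])
next
  case (Suc k)
  show ?thesis
    unfolding Suc
    by (rule Ck_on_SucI [OF assms(1) bounded_linear_imp_has_derivative [OF assms(2)] Ck_on_const [OF assms(1)]])
qed

lemma Ck_on_add:
  assumes "open X" "Ck_on k X f" "Ck_on k X g"
  shows "Ck_on k X (\<lambda>x. f x + g x)"
  using assms(2,3)
proof (induction k arbitrary: f g)
  case 0
  then show ?case by (auto intro: continuous_intros)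
next
  case (Suc k)
  show ?case
  proof (rule Ck_on_SucI [OF assms(1)])
    show "((\<lambda>x. f x + g x) has_derivative (\<lambda>v. frechet_derivative f (at x) v + frechet_derivative g (at x) v)) (at x)"
      if "x \<in> X" for x
      by (intro has_derivative_add Ck_on_SucD [OF Suc.prems(1) that] Ck_on_SucD [OF Suc.prems(2) that])
  qed (use Suc in auto)
qed

lemma Ck_on_sum:
  assumes "open X" "\<And>i. i \<in> I \<Longrightarrow> Ck_on k X (f i)"
  shows "Ck_on k X (\<lambda>x. \<Sum>i\<in>I. f i x)"
proof (cases "finite I")
  case True
  then show ?thesis
    using assms(2)
    by (induction I) (auto intro!: Ck_on_add Ck_on_const assms(1))
qed (simp add: Ck_on_const assms(1))

lemma Ck_on_bilinear:
  assumes "open X" and B: "bounded_bilinear B" and "Ck_on k X f" "Ck_on k X g"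
  shows "Ck_on k X (\<lambda>x. B (f x) (g x))"
  using assms(3,4)
proof (induction k arbitrary: f g)
  case 0
  then show ?case
    by (auto intro: bounded_bilinear.continuous_on [OF B])
next
  case (Suc k)
  show ?case
  proof (rule Ck_on_SucI [OF assms(1)])
    show "((\<lambda>x. B (f x) (g x)) has_derivative
        (\<lambda>v. B (f x) (frechet_derivative g (at x) v) + B (frechet_derivative f (at x) v) (g x))) (at x)"
      if "x \<in> X" for x
      by (intro bounded_bilinear.FDERIV [OF B] Ck_on_SucD [OF Suc.prems(1) that] Ck_on_SucD [OF Suc.prems(2) that])
    show "Ck_on k X (\<lambda>x. B (f x) (frechet_derivative g (at x) v) + B (frechet_derivative f (at x) v) (g x))" for v
      using Suc.prems by (intro Ck_on_add assms(1) Suc.IH) (auto intro: Ck_on_Suc_imp)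
  qed
qed

text \<open>
  Expanding the inner derivative in a basis turns the chain rule into a sum of products, to which the
  induction hypothesis and \<open>Ck_on_bilinear\<close> apply.
\<close>

lemma Ck_on_compose:
  fixes f :: "'a::euclidean_space \<Rightarrow> 'b::euclidean_space" and g :: "'b \<Rightarrow> 'c::euclidean_space"
  assumes "open X" "open Y" "f ` X \<subseteq> Y" "Ck_on k Y g" "Ck_on k X f"
  shows "Ck_on k X (\<lambda>x. g (f x))"
  using assms(4,5)
proof (induction k arbitrary: g)
  case 0
  then show ?case
    using assms(3) by (auto intro: continuous_on_compose2)
next
  case (Suc k)
  have fk: "Ck_on k X f"
    by (rule Ck_on_Suc_imp [OF Suc.prems(2)])
  show ?case
  proof (rule Ck_on_SucI [OF assms(1)])
    fix x assume x: "x \<in> X"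
    have hd: "((\<lambda>x. g (f x)) has_derivative
        (\<lambda>v. frechet_derivative g (at (f x)) (frechet_derivative f (at x) v))) (at x)"
      using has_derivative_compose [OF Ck_on_SucD [OF Suc.prems(2) x] Ck_on_SucD [OF Suc.prems(1)]] x assms(3)
      by auto
    have rep: "frechet_derivative g (at (f x)) u =
        (\<Sum>b\<in>Basis. (u \<bullet> b) *\<^sub>R frechet_derivative g (at (f x)) b)" for u
    proof -
      have L: "linear (frechet_derivative g (at (f x)))"
        using Suc.prems(1) x assms(3) by (intro linear_frechet_derivative) auto
      have "frechet_derivative g (at (f x)) u = frechet_derivative g (at (f x)) (\<Sum>b\<in>Basis. (u \<bullet> b) *\<^sub>R b)"
        by (simp add: euclidean_representation)
      also have "\<dots> = (\<Sum>b\<in>Basis. (u \<bullet> b) *\<^sub>R frechet_derivative g (at (f x)) b)"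
        by (simp add: linear_sum [OF L] linear_cmul [OF L])
      finally show ?thesis .
    qed
    show "((\<lambda>x. g (f x)) has_derivative
        (\<lambda>v. \<Sum>b\<in>Basis. (frechet_derivative f (at x) v \<bullet> b) *\<^sub>R frechet_derivative g (at (f x)) b)) (at x)"
      by (rule has_derivative_eq_rhs [OF hd]) (rule ext, rule rep)
  next
    fix v
    have "Ck_on k X (\<lambda>x. frechet_derivative f (at x) v \<bullet> b)" for b
      using Suc.prems(2) by (intro Ck_on_bilinear [OF assms(1) bounded_bilinear_inner] Ck_on_const assms(1)) auto
    moreover have "Ck_on k X (\<lambda>x. frechet_derivative g (at (f x)) b)" for b
      using Suc.prems(1) fk by (intro Suc.IH [of "\<lambda>y. frechet_derivative g (at y) b"]) auto
    ultimately show "Ck_on k X (\<lambda>x. \<Sum>b\<in>Basis. (frechet_derivative f (at x) v \<bullet> b) *\<^sub>R frechet_derivative g (at (f x)) b)"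
      by (intro Ck_on_sum Ck_on_bilinear [OF assms(1) bounded_bilinear_scaleR] assms(1))
  qed
qed

lemma Ck_on_inverse_real: "Ck_on k (- {0}) (inverse :: real \<Rightarrow> real)"
proof (induction k)
  case 0
  then show ?case by (auto intro: continuous_intros)
next
  case (Suc k)
  show ?case
  proof (rule Ck_on_SucI)
    show "(inverse has_derivative (\<lambda>v. - (inverse x * v * inverse x))) (at x)" if "x \<in> - {0}" for x :: real
      using that by (intro has_derivative_inverse') auto
    have "Ck_on k (- {0}) (\<lambda>x::real. inverse x * (inverse x * (- v)))" for v
      by (intro Ck_on_bilinear [OF _ bounded_bilinear_mult] Suc Ck_on_const) auto
    then show "Ck_on k (- {0}) (\<lambda>x::real. - (inverse x * v * inverse x))" for v
      by (simp add: mult_ac)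
  qed auto
qed

lemma Ck_on_inverse:
  fixes f :: "'a::euclidean_space \<Rightarrow> real"
  assumes "open X" "\<And>x. x \<in> X \<Longrightarrow> f x \<noteq> 0" "Ck_on k X f"
  shows "Ck_on k X (\<lambda>x. inverse (f x))"
  by (rule Ck_on_compose [OF assms(1) _ _ Ck_on_inverse_real assms(3)]) (use assms(2) in auto)

section \<open>The group of Riemannian isometries\<close>

lemma riem_isometriesD:
  assumes "f \<in> riem_isometries X g"
  shows "f \<in> Bij X" "bij_betw f X X" "\<And>k. Ck_on k X f" "\<And>k. Ck_on k X (inv_into X f)"
    "\<And>w d. w \<in> X \<Longrightarrow> g (f w) (frechet_derivative f (at w) d) = g w d"
    "\<And>w. w \<in> X \<Longrightarrow> f w \<in> X"
  using assms by (auto simp: riem_isometries_def BijGroup_def Bij_def smooth_on_def dest: bij_betwE)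

lemma riem_isometries_derivative:
  assumes "f \<in> riem_isometries X g" "w \<in> X"
  shows "(f has_derivative frechet_derivative f (at w)) (at w)"
  by (rule Ck_on_SucD [OF riem_isometriesD(3) [OF assms(1), of "Suc 0"] assms(2)])

lemma smooth_on_cong_open: "open X \<Longrightarrow> (\<And>x. x \<in> X \<Longrightarrow> f x = g x) \<Longrightarrow> smooth_on X f \<Longrightarrow> smooth_on X g"
  unfolding smooth_on_def using Ck_on_cong by metis

text \<open>
  A criterion for functions that are given by a formula on the whole space.
\<close>

lemma riem_isometryI:
  assumes X: "open X" and f: "bij_betw f X X" "\<And>k. Ck_on k X f" "\<And>k. Ck_on k X f'"
    and inv: "\<And>w. w \<in> X \<Longrightarrow> f' w \<in> X" "\<And>w. w \<in> X \<Longrightarrow> f (f' w) = w"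
    and D: "\<And>w. w \<in> X \<Longrightarrow> (f has_derivative D w) (at w)" "\<And>w d. w \<in> X \<Longrightarrow> g (f w) (D w d) = g w d"
  shows "restrict f X \<in> riem_isometries X g"
proof -
  have "restrict f X \<in> Bij X"
    using f(1) by (simp add: Bij_def)
  moreover have "smooth_on X (restrict f X)"
    by (rule smooth_on_cong_open [OF X, of f]) (use f(2) in \<open>auto simp: smooth_on_def\<close>)
  moreover have "smooth_on X (inv_into X (restrict f X))"
  proof (rule smooth_on_cong_open [OF X, of f'])
    have inj: "inj_on (restrict f X) X"
      using f(1) by (simp add: bij_betw_def)
    show "f' x = inv_into X (restrict f X) x" if "x \<in> X" for x
      using inv_into_f_f [OF inj inv(1) [OF that]] inv that by simp
    show "smooth_on X f'"
      using f(3) by (simp add: smooth_on_def)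
  qed
  moreover have "g (restrict f X w) (frechet_derivative (restrict f X) (at w) d) = g w d" if "w \<in> X" for w d
  proof -
    have "(restrict f X has_derivative D w) (at w)"
      by (rule has_derivative_transform_within_open [OF D(1) [OF that] X that]) simp
    then have "frechet_derivative (restrict f X) (at w) = D w"
      by (rule frechet_derivative_at [symmetric])
    then show ?thesis
      using D(2) [OF that] that by simp
  qed
  ultimately show ?thesis
    by (simp add: riem_isometries_def BijGroup_def)
qed

lemma subgroup_riem_isometries:
  fixes X :: "'a::euclidean_space set"
  assumes X: "open X"
  shows "subgroup (riem_isometries X g) (BijGroup X)"
proof (rule group.subgroupI [OF group_BijGroup])
  show "riem_isometries X g \<subseteq> carrier (BijGroup X)"
    by (auto simp: riem_isometries_def)
  have "(\<lambda>x\<in>X. x) \<in> riem_isometries X g"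
    by (rule riem_isometryI [OF X, where f' = "\<lambda>x. x" and D = "\<lambda>w d. d"])
      (auto intro!: Ck_on_linear X bounded_linear_ident has_derivative_ident simp: bij_betw_def)
  then show "riem_isometries X g \<noteq> {}"
    by blast
next
  fix a assume a: "a \<in> riem_isometries X g"
  note A = riem_isometriesD [OF a]
  have inv: "inv_into X a w \<in> X" "a (inv_into X a w) = w" if "w \<in> X" for w
    using A(2) that by (auto simp: bij_betw_def inv_into_into f_inv_into_f)
  have "restrict (inv_into X a) X \<in> riem_isometries X g"
  proof (rule riem_isometryI [OF X bij_betw_inv_into [OF A(2)] A(4,3) A(6)])
    show "inv_into X a (a w) = w" if "w \<in> X" for w
      using A(2) that by (simp add: bij_betw_def)
    fix w assume w: "w \<in> X"
    show d: "(inv_into X a has_derivative frechet_derivative (inv_into X a) (at w)) (at w)"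
      by (rule Ck_on_SucD [OF A(4) [of "Suc 0"] w])
    fix d
    have "((\<lambda>x. a (inv_into X a x)) has_derivative
        (\<lambda>v. frechet_derivative a (at (inv_into X a w)) (frechet_derivative (inv_into X a) (at w) v))) (at w)"
      by (rule has_derivative_compose [OF d riem_isometries_derivative [OF a inv(1) [OF w]]])
    moreover have "((\<lambda>x. a (inv_into X a x)) has_derivative (\<lambda>v. v)) (at w)"
      by (rule has_derivative_transform_within_open [OF has_derivative_ident X w]) (simp add: inv)
    ultimately have "(\<lambda>v. frechet_derivative a (at (inv_into X a w)) (frechet_derivative (inv_into X a) (at w) v)) = (\<lambda>v. v)"
      by (rule has_derivative_unique)
    then have "frechet_derivative a (at (inv_into X a w)) (frechet_derivative (inv_into X a) (at w) d) = d"
      by meson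
    then show "g (inv_into X a w) (frechet_derivative (inv_into X a) (at w) d) = g w d"
      using A(5) [OF inv(1) [OF w], of "frechet_derivative (inv_into X a) (at w) d"] inv(2) [OF w] by simp
  qed
  then show "inv\<^bsub>BijGroup X\<^esub> a \<in> riem_isometries X g"
    by (simp add: inv_BijGroup A(1))
next
  fix a b assume a: "a \<in> riem_isometries X g" and b: "b \<in> riem_isometries X g"
  note A = riem_isometriesD [OF a] and B = riem_isometriesD [OF b]
  have "restrict (a \<circ> b) X \<in> riem_isometries X g"
  proof (rule riem_isometryI [OF X, where f' = "inv_into X b \<circ> inv_into X a"
        and D = "\<lambda>w. frechet_derivative a (at (b w)) \<circ> frechet_derivative b (at w)"])
    show "bij_betw (a \<circ> b) X X"
      using A(2) B(2) by (rule bij_betw_trans [rotated])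
    show "Ck_on k X (a \<circ> b)" for k
      unfolding o_def by (rule Ck_on_compose [OF X X _ A(3) B(3)]) (use B(6) in auto)
    show "Ck_on k X (inv_into X b \<circ> inv_into X a)" for k
      unfolding o_def by (rule Ck_on_compose [OF X X _ B(4) A(4)])
        (use A(2) in \<open>auto simp: bij_betw_def inv_into_into\<close>)
    fix w assume w: "w \<in> X"
    show "(a \<circ> b has_derivative frechet_derivative a (at (b w)) \<circ> frechet_derivative b (at w)) (at w)"
      by (rule diff_chain_at [OF riem_isometries_derivative [OF b w] riem_isometries_derivative [OF a B(6) [OF w]]])
    show "g ((a \<circ> b) w) ((frechet_derivative a (at (b w)) \<circ> frechet_derivative b (at w)) d) = g w d" for d
      by (simp add: A(5) B(5,6) w)
    show "(inv_into X b \<circ> inv_into X a) w \<in> X"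
      using A(2) B(2) w by (simp add: bij_betw_def inv_into_into)
    show "(a \<circ> b) ((inv_into X b \<circ> inv_into X a) w) = w"
      using A(2) B(2) w by (simp add: bij_betw_def inv_into_into f_inv_into_f)
  qed
  then show "a \<otimes>\<^bsub>BijGroup X\<^esub> b \<in> riem_isometries X g"
    using A(1) B(1) by (simp add: BijGroup_def compose_def o_def)
qed

lemma linear_basis_expansion:
  fixes f :: "'a::euclidean_space \<Rightarrow> 'b::real_vector"
  assumes "linear f"
  shows "f u = (\<Sum>b\<in>Basis. (u \<bullet> b) *\<^sub>R f b)"
proof -
  have "f u = f (\<Sum>b\<in>Basis. (u \<bullet> b) *\<^sub>R b)"
    by (simp add: euclidean_representation)
  then show ?thesis
    by (simp add: linear_sum [OF assms] linear_cmul [OF assms])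
qed

lemma riem_isometry_valid_path:
  fixes X :: "'a::euclidean_space set"
  assumes f: "f \<in> riem_isometries X g" and c: "valid_path c" "path_image c \<subseteq> X"
  shows "valid_path (f \<circ> c)" and "riem_length g (f \<circ> c) = riem_length g c"
proof -
  note F = riem_isometriesD [OF f]
  obtain S where S: "finite S" "c C1_differentiable_on ({0..1} - S)" and cc: "continuous_on {0..1} c"
    using c(1) by (auto simp: valid_path_def piecewise_C1_differentiable_on_def)
  obtain c' where c': "\<And>t. t \<in> {0..1} - S \<Longrightarrow> (c has_vector_derivative c' t) (at t)"
      "continuous_on ({0..1} - S) c'"
    using S(2) unfolding C1_differentiable_on_def by blast
  have cX: "c t \<in> X" if "t \<in> {0..1}" for t
    using c(2) that by (auto simp: path_image_def)
  have lin: "linear (frechet_derivative f (at w))" if "w \<in> X" for w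
    using riem_isometries_derivative [OF f that] by (rule has_derivative_linear)
  define d where "d t = frechet_derivative f (at (c t)) (c' t)" for t
  have d: "((f \<circ> c) has_vector_derivative d t) (at t)" if t: "t \<in> {0..1} - S" for t
  proof -
    have "(c has_derivative (\<lambda>h. h *\<^sub>R c' t)) (at t)"
      using c'(1) [OF t] by (simp add: has_vector_derivative_def)
    from diff_chain_at [OF this riem_isometries_derivative [OF f cX]]
    show ?thesis
      unfolding has_vector_derivative_def o_def d_def
      using t lin [OF cX] by (simp add: linear_cmul)
  qed
  have fc: "continuous_on {0..1} (f \<circ> c)"
    using F(3) [of 0] cX by (intro continuous_on_compose cc) (auto elim: continuous_on_subset)
  have cb: "continuous_on ({0..1} - S) (\<lambda>t. frechet_derivative f (at (c t)) b)" for b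
    using F(3) [of "Suc 0"] cX
    by (intro continuous_on_compose2 [of X "\<lambda>w. frechet_derivative f (at w) b" _ c])
      (auto intro: continuous_on_subset [OF cc])
  have "continuous_on ({0..1} - S) (\<lambda>t. \<Sum>b\<in>Basis. (c' t \<bullet> b) *\<^sub>R frechet_derivative f (at (c t)) b)"
    by (intro continuous_intros c'(2) cb)
  then have "continuous_on ({0..1} - S) d"
    by (rule continuous_on_eq) (use linear_basis_expansion [OF lin [OF cX]] in \<open>auto simp: d_def\<close>)
  then have "(f \<circ> c) C1_differentiable_on ({0..1} - S)"
    unfolding C1_differentiable_on_def using d by blast
  then show "valid_path (f \<circ> c)"
    using fc S(1) by (auto simp: valid_path_def piecewise_C1_differentiable_on_def)
  show "riem_length g (f \<circ> c) = riem_length g c"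
    unfolding riem_length_def
  proof (rule nn_integral_cong_AE)
    have "AE t in lborel. t \<notin> S"
      using S(1) by (intro AE_not_in) (rule finite_imp_null_set_lborel)
    then show "AE t in lborel.
        ennreal (sqrt (g ((f \<circ> c) t) (vector_derivative (f \<circ> c) (at t)))) * indicator {0..1} t =
        ennreal (sqrt (g (c t) (vector_derivative c (at t)))) * indicator {0..1} t"
    proof eventually_elim
      case (elim t)
      show ?case
      proof (cases "t \<in> {0..1}")
        case True
        then have t: "t \<in> {0..1} - S"
          using elim by simp
        show ?thesis
          using vector_derivative_at [OF c'(1) [OF t]] vector_derivative_at [OF d [OF t]] F(5) [OF cX [OF True]]
          by (simp add: d_def)
      qed simp
    qed
  qed
qed

lemma riem_isometry_riem_dist_le:
  fixes X :: "'a::euclidean_space set"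
  assumes f: "f \<in> riem_isometries X g"
  shows "riem_dist X g (f p) (f q) \<le> riem_dist X g p q"
  unfolding riem_dist_def [of X g p q]
proof (rule INF_greatest, clarify)
  fix c assume c: "valid_path c" "path_image c \<subseteq> X"
  have "riem_dist X g (f (pathstart c)) (f (pathfinish c)) \<le> riem_length g (f \<circ> c)"
    unfolding riem_dist_def
    by (rule INF_lower) (use riem_isometry_valid_path(1) [OF f c] c(2) riem_isometriesD(6) [OF f] in
        \<open>auto simp: path_image_compose pathstart_compose pathfinish_compose\<close>)
  then show "riem_dist X g (f (pathstart c)) (f (pathfinish c)) \<le> riem_length g c"
    by (simp add: riem_isometry_valid_path(2) [OF f c])
qed

lemma riem_isometry_riem_dist:
  fixes X :: "'a::euclidean_space set"
  assumes X: "open X" and f: "f \<in> riem_isometries X g" and pq: "p \<in> X" "q \<in> X"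
  shows "riem_dist X g (f p) (f q) = riem_dist X g p q"
proof (rule antisym [OF riem_isometry_riem_dist_le [OF f]])
  note F = riem_isometriesD [OF f]
  have "inv\<^bsub>BijGroup X\<^esub> f \<in> riem_isometries X g"
    using subgroup_riem_isometries [OF X] f by (rule subgroup.m_inv_closed)
  from riem_isometry_riem_dist_le [OF this, of "f p" "f q"]
  show "riem_dist X g p q \<le> riem_dist X g (f p) (f q)"
    using F(2) pq by (simp add: inv_BijGroup F(1,6) bij_betw_def)
qed

section \<open>Upper bounds for the Riemannian distance\<close>

lemma riem_dist_le_parametrized:
  assumes T: "0 \<le> T"
    and P: "\<And>t. 0 \<le> t \<Longrightarrow> t \<le> T \<Longrightarrow> (P has_vector_derivative P' t) (at t)" "continuous_on {0..T} P'"
      "\<And>t. 0 \<le> t \<Longrightarrow> t \<le> T \<Longrightarrow> P t \<in> \<bool>"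
    and s: "\<And>t. 0 \<le> t \<Longrightarrow> t \<le> T \<Longrightarrow> sqrt (polar_form (P t) (P t) (P' t)) \<le> s t" "s \<in> borel_measurable borel"
    and F: "\<And>t. 0 \<le> t \<Longrightarrow> t \<le> T \<Longrightarrow> (F has_real_derivative s t) (at t)"
  shows "ball_dist (P 0) (P T) \<le> ennreal (F T - F 0)"
proof -
  define c where "c = P \<circ> (\<lambda>u. T * u)"
  have Tu: "0 \<le> T * u" "T * u \<le> T" if "u \<in> {0..1}" for u
    using T that by (auto simp: mult_left_le)
  have d: "(c has_vector_derivative T *\<^sub>R P' (T * u)) (at u)" if "u \<in> {0..1}" for u
    unfolding c_def using that Tu
    by (intro vector_diff_chain_at P(1)) (auto intro!: derivative_eq_intros)
  have cts: "continuous_on {0..1} (\<lambda>u. T *\<^sub>R P' (T * u))"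
    using Tu by (intro continuous_intros continuous_on_compose2 [OF P(2)]) auto
  have "c C1_differentiable_on {0..1}"
    unfolding C1_differentiable_on_def
    by (rule exI [of _ "\<lambda>u. T *\<^sub>R P' (T * u)"]) (intro conjI ballI d cts)
  then have v: "valid_path c"
    by (simp add: valid_path_def C1_differentiable_imp_piecewise)
  have "ball_dist (P 0) (P T) \<le> ball_length c"
    unfolding riem_dist_def using P(3) Tu v
    by (intro INF_lower) (auto simp: path_image_def pathstart_def pathfinish_def c_def)
  also have "\<dots> \<le> (\<integral>\<^sup>+u. ennreal (T * s (T * u)) * indicator {0..1} u \<partial>lborel)"
    unfolding riem_length_def
  proof (rule nn_integral_mono)
    fix u :: real
    show "ennreal (path_speed c u) * indicator {0..1} u
        \<le> ennreal (T * s (T * u)) * indicator {0..1} u"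
    proof (cases "u \<in> {0..1}")
      case True
      have "path_speed c u = T * sqrt (polar_form (P (T * u)) (P (T * u)) (P' (T * u)))"
        using vector_derivative_at [OF d [OF True]] P(3) Tu [OF True] T
        by (simp add: hardy_metric_polar_form c_def polar_form_scaleR real_sqrt_mult)
      also have "\<dots> \<le> T * s (T * u)"
        using s(1) Tu [OF True] T by (intro mult_left_mono) auto
      finally show ?thesis
        using True by (simp add: ennreal_leI)
    qed simp
  qed
  also have "\<dots> = F (T * 1) - F (T * 0)"
  proof (rule nn_integral_FTC_Icc)
    show "(\<lambda>u. T * s (T * u)) \<in> borel_measurable borel"
      using s(2) by measurable
    fix u :: real assume u: "u \<in> {0..1}"
    have "((\<lambda>u. F (T * u)) has_real_derivative s (T * u) * T) (at u)"
      by (rule DERIV_chain2 [OF F]) (use Tu [OF u] in \<open>auto intro!: derivative_eq_intros\<close>)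
    then show "((\<lambda>u. F (T * u)) has_real_derivative T * s (T * u)) (at u)"
      by (simp add: mult.commute)
    have "0 \<le> sqrt (polar_form (P (T * u)) (P (T * u)) (P' (T * u)))"
      using P(3) Tu [OF u] by (simp add: polar_form_nonneg)
    then show "0 \<le> T * s (T * u)"
      using s(1) Tu [OF u] T by (meson mult_nonneg_nonneg order.trans)
  qed simp
  finally show ?thesis
    by simp
qed

lemma quat_orthogonal_imag_unit:
  fixes a b :: quat
  obtains K where "K \<in> \<S>" "K \<bullet> a = 0" "K \<bullet> b = 0"
proof -
  have "dim (span {1, a, b}) \<le> card {1, a, b}"
    by (simp add: dim_le_card')
  also have "\<dots> \<le> 3"
    by (simp add: card_insert_if)
  also have "\<dots> < DIM(quat)"
    by (simp add: Basis_quat_def)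
  finally obtain x where x: "x \<noteq> 0" "\<And>y. y \<in> span {1, a, b} \<Longrightarrow> orthogonal x y"
    using orthogonal_to_subspace_exists by (metis dim_span)
  have o: "x \<bullet> 1 = 0" "x \<bullet> a = 0" "x \<bullet> b = 0"
    using x(2) by (auto simp: orthogonal_def span_base)
  show ?thesis
  proof (rule that [of "x /\<^sub>R norm x"])
    show "x /\<^sub>R norm x \<in> \<S>"
      using x(1) o(1) by (simp add: imag_units_iff inner_quat_def)
  qed (use o in auto)
qed

text \<open>
  In the direction of the rotation the metric is \<open>y\<^sup>2 / |1 - w\<^sup>2|\<^sup>2\<close>, which is at most \<open>1/4\<close> everywhere
  in \<open>\<bool>\<close>: the spheres \<open>x + y \<S>\<close> have bounded diameter, however close to the boundary.
\<close>

lemma riem_dist_quarter_turn: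
  assumes "I \<in> \<S>" "K \<in> \<S>" "I \<bullet> K = 0" and B: "of_real x + y *\<^sub>R I \<in> \<bool>"
  shows "ball_dist (of_real x + y *\<^sub>R I) (of_real x + y *\<^sub>R K) \<le> ennreal (pi / 4)"
proof -
  have I: "qre I = 0" "qre K = 0" "I \<bullet> I = 1" "K \<bullet> K = 1"
    using assms by (simp_all add: imag_units_iff power2_norm_eq_inner [symmetric])
  define V where "V t = cos t *\<^sub>R I + sin t *\<^sub>R K" for t
  define W where "W t = (- sin t) *\<^sub>R I + cos t *\<^sub>R K" for t
  define P where "P t = of_real x + y *\<^sub>R V t" for t
  have V: "qre (V t) = 0" "norm (V t) = 1" "qre (W t) = 0" "norm (W t) = 1" "W t \<bullet> V t = 0" for t
  proof -
    show "qre (V t) = 0" "qre (W t) = 0"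
      by (simp_all add: V_def W_def I)
    have "V t \<bullet> V t = 1" "W t \<bullet> W t = 1"
      using I assms(3) sin_cos_squared_add3 [of t]
      by (simp_all add: V_def W_def inner_add_left inner_add_right inner_diff_left inner_diff_right
          inner_commute [of K I] power2_eq_square)
    then show "norm (V t) = 1" "norm (W t) = 1"
      by (simp_all add: norm_eq_sqrt_inner)
    show "W t \<bullet> V t = 0"
      using I assms(3)
      by (simp add: V_def W_def inner_add_left inner_add_right inner_diff_left inner_commute [of K I])
  qed
  have qv: "qvec (P t) = y *\<^sub>R V t" and qr: "qre (P t) = x" for t
    by (simp_all add: P_def qvec_def V)
  have nP: "(norm (P t))\<^sup>2 = x\<^sup>2 + y\<^sup>2" for t
    by (simp add: norm_sq_qvec [of "P t"] qv qr V power_mult_distrib)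
  have P0: "P 0 = of_real x + y *\<^sub>R I" "P (pi / 2) = of_real x + y *\<^sub>R K"
    by (simp_all add: P_def V_def)
  then have lt: "x\<^sup>2 + y\<^sup>2 < 1"
    using B nP [of 0] by (simp add: in_ball_iff)
  have PB: "P t \<in> \<bool>" for t
    using lt by (simp add: in_ball_iff nP)
  have "ball_dist (P 0) (P (pi / 2)) \<le> ennreal ((\<lambda>t. t / 2) (pi / 2) - (\<lambda>t. t / 2) 0)"
  proof (rule riem_dist_le_parametrized [where P' = "\<lambda>t. y *\<^sub>R W t" and s = "\<lambda>t. 1/2"])
    fix t :: real
    show "(P has_vector_derivative y *\<^sub>R W t) (at t)"
      unfolding P_def V_def W_def
      by (auto intro!: derivative_eq_intros simp: has_vector_derivative_scaleR)
    define al where "al = 1 - (x\<^sup>2 + y\<^sup>2)"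
    have al: "al > 0"
      using lt by (simp add: al_def)
    then have 4: "0 < al\<^sup>2 + 4 * y\<^sup>2"
      by (simp add: add_pos_nonneg)
    have "polar_form (P t) (P t) (y *\<^sub>R W t) = al\<^sup>2 * y\<^sup>2 / (al\<^sup>2 * (al\<^sup>2 + 4 * y\<^sup>2))"
      unfolding polar_form_diag by (simp add: nP qv V al_def)
    also have "\<dots> = y\<^sup>2 / (al\<^sup>2 + 4 * y\<^sup>2)"
      using al by simp
    also have "\<dots> \<le> (1/2)\<^sup>2"
      using 4 by (simp add: pos_divide_le_eq power2_eq_square)
    finally show "sqrt (polar_form (P t) (P t) (y *\<^sub>R W t)) \<le> 1/2"
      by (intro real_le_lsqrt) simp_all
    show "((\<lambda>t. t / 2) has_real_derivative 1/2) (at t)"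
      by (auto intro!: derivative_eq_intros)
  qed (auto simp: PB W_def intro!: continuous_intros)
  then show ?thesis
    by (simp add: P0)
qed

text \<open>
  Two quarter turns, with an imaginary unit orthogonal to both imaginary parts in between.
\<close>

lemma riem_dist_same_meridian:
  assumes B: "p \<in> \<bool>" and m: "meridian p = meridian q"
  shows "ball_dist p q \<le> ennreal (pi / 2)"
proof -
  have *: "\<exists>I. I \<in> \<S> \<and> q = of_real (qre q) + norm (qvec q) *\<^sub>R I" for q
  proof (cases "qvec q = 0")
    case True
    obtain K where "K \<in> \<S>" using quat_orthogonal_imag_unit by blast
    then show ?thesis
      using True by (intro exI [of _ K]) (simp add: qvec_def)
  next
    case False
    then show ?thesis
      by (intro exI [of _ "qvec q /\<^sub>R norm (qvec q)"]) (simp add: imag_units_iff, simp add: qvec_def)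
  qed
  define x y where "x = qre p" "y = norm (qvec p)"
  have xy: "qre q = x" "norm (qvec q) = y"
    using m by (simp_all add: meridian_def x_y_def)
  obtain I where I: "I \<in> \<S>" "p = of_real x + y *\<^sub>R I"
    using * [of p] by (auto simp: x_y_def)
  obtain J where J: "J \<in> \<S>" "q = of_real x + y *\<^sub>R J"
    using * [of q] by (auto simp: xy)
  obtain K where K: "K \<in> \<S>" "K \<bullet> I = 0" "K \<bullet> J = 0"
    by (rule quat_orthogonal_imag_unit)
  define r where "r = of_real x + y *\<^sub>R K"
  have rB: "r \<in> \<bool>"
  proof -
    have n: "(norm (of_real x + y *\<^sub>R L))\<^sup>2 = x\<^sup>2 + y\<^sup>2" if "L \<in> \<S>" for L
    proof -
      have "qvec (of_real x + y *\<^sub>R L) = y *\<^sub>R L" "qre (of_real x + y *\<^sub>R L) = x"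
        using that by (simp_all add: imag_units_iff qvec_def)
      then show ?thesis
        using that norm_sq_qvec [of "of_real x + y *\<^sub>R L"] by (simp add: imag_units_iff power_mult_distrib)
    qed
    have "(norm r)\<^sup>2 = (norm p)\<^sup>2"
      by (simp only: r_def I(2) n [OF I(1)] n [OF K(1)])
    then have "norm r = norm p"
      by (rule power2_eq_imp_eq) (rule norm_ge_zero)+
    then show ?thesis
      using B by (simp add: quat_ball_def)
  qed
  have "ball_dist p q \<le> ball_dist p r + ball_dist r q"
    by (rule riem_dist_triangle)
  also have "\<dots> \<le> ennreal (pi / 4) + ennreal (pi / 4)"
    using riem_dist_quarter_turn [of I K x y] riem_dist_quarter_turn [of K J x y] I J K B rB
    by (intro add_mono) (auto simp: r_def inner_commute)
  also have "\<dots> = ennreal (pi / 2)"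
    by (simp flip: ennreal_plus)
  finally show ?thesis .
qed

section \<open>Geodesics through the origin\<close>

lemma tanh_artanh_real:
  assumes "\<bar>t\<bar> < 1"
  shows "tanh (artanh t) = (t :: real)" and "arsinh (t / sqrt (1 - t\<^sup>2)) = artanh t"
proof -
  define s where "s = sqrt (1 - t\<^sup>2)"
  have t: "1 - t\<^sup>2 > 0"
    using assms by (simp add: abs_square_less_1)
  then have s: "s > 0" "s\<^sup>2 = 1 - t\<^sup>2"
    by (simp_all add: s_def)
  have "(t / s)\<^sup>2 + 1 = (1 / s)\<^sup>2"
    using s by (simp add: power_divide field_simps)
  then have "cosh (arsinh (t / s)) = 1 / s"
    using s by (simp add: cosh_arsinh_real del: power_divide power_one_over)
  then have *: "tanh (arsinh (t / s)) = t"
    using s by (simp add: tanh_def)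
  from artanh_tanh_real [of "arsinh (t / s)"]
  show "arsinh (t / sqrt (1 - t\<^sup>2)) = artanh t"
    unfolding * by (simp add: s_def)
  then show "tanh (artanh t) = t"
    using * by (simp add: s_def)
qed

lemma meridian_0: "meridian 0 = 0"
  by (simp add: meridian_def qvec_def complex_eq_iff)

lemma disc_dist_0:
  assumes "cmod z < 1"
  shows "disc_dist 0 z = artanh (cmod z)"
  using assms by (simp add: disc_dist_def tanh_artanh_real(2))

text \<open>
  Gauss' lemma.  The first term is the radial part of the metric; what is left controls the
  part of \<open>d\<close> orthogonal to \<open>w\<close>, with a positive factor.
\<close>

lemma polar_form_radial_ge:
  assumes w: "w \<in> \<bool>" "w \<noteq> 0"
  defines "al \<equiv> 1 - (norm w)\<^sup>2"
  shows "(d \<bullet> w)\<^sup>2 / (norm w)\<^sup>2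
      + al\<^sup>2 / (al\<^sup>2 + 4 * (norm (qvec w))\<^sup>2) * ((norm d)\<^sup>2 - (d \<bullet> w)\<^sup>2 / (norm w)\<^sup>2)
    \<le> al\<^sup>2 * polar_form w w d"
proof -
  define x Y r c where "x = qre w" "Y = (norm (qvec w))\<^sup>2" "r = qre d" "c = d \<bullet> qvec w"
  note dd = this
  have al: "al > 0"
    using w by (simp add: al_def in_ball_iff)
  have Y: "Y \<ge> 0"
    by (simp add: dd)
  have B: "al\<^sup>2 + 4 * Y > 0"
    using al Y by (simp add: add_pos_nonneg)
  have nw: "(norm w)\<^sup>2 = x\<^sup>2 + Y"
    by (simp add: dd norm_sq_qvec [of w])
  have n0: "x\<^sup>2 + Y > 0"
    using w(2) by (simp flip: nw)
  have dw: "d \<bullet> w = r * x + c"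
    by (simp add: dd inner_quat_def)
  define q where "q = (d \<bullet> w)\<^sup>2 / (norm w)\<^sup>2"
  have "Y * (r * x + c)\<^sup>2 \<le> (Y * r\<^sup>2 + c\<^sup>2) * (x\<^sup>2 + Y)"
  proof -
    have "(Y * r\<^sup>2 + c\<^sup>2) * (x\<^sup>2 + Y) - Y * (r * x + c)\<^sup>2 = (Y * r - x * c)\<^sup>2"
      by algebra
    then show ?thesis
      by (metis diff_ge_0_iff_ge zero_le_power2)
  qed
  then have Yq: "Y * q \<le> Y * r\<^sup>2 + c\<^sup>2"
    using n0 unfolding q_def dw nw by (simp add: pos_divide_le_eq)
  have "q + al\<^sup>2 / (al\<^sup>2 + 4 * Y) * ((norm d)\<^sup>2 - q) = (al\<^sup>2 * (norm d)\<^sup>2 + 4 * (Y * q)) / (al\<^sup>2 + 4 * Y)"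
    using B by (simp add: field_simps)
  also have "\<dots> \<le> (al\<^sup>2 * (norm d)\<^sup>2 + 4 * (Y * r\<^sup>2 + c\<^sup>2)) / (al\<^sup>2 + 4 * Y)"
    using Yq B by (intro divide_right_mono) auto
  also have "\<dots> = al\<^sup>2 * polar_form w w d"
    unfolding polar_form_diag al_def [symmetric] dd [symmetric] using al by simp
  finally show ?thesis
    by (simp add: q_def dd)
qed

lemma polar_form_radial:
  assumes "norm u = 1" "\<bar>t\<bar> < 1"
  shows "polar_form (t *\<^sub>R u) (t *\<^sub>R u) u = (1 / (1 - t\<^sup>2))\<^sup>2"
proof -
  obtain I z where I: "I \<in> \<S>" and u: "u = slice_embed I z"
    by (rule slice_embed_ex)
  have "t *\<^sub>R u = slice_embed I (t *\<^sub>R z)"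
    by (simp add: u slice_embed_def of_real_def algebra_simps)
  then show ?thesis
    using assms polar_form_slice_embed [OF I, of "t *\<^sub>R z" z] by (simp add: u slice_embed_sel [OF I])
qed

lemma polar_form_0: "polar_form 0 0 d = (norm d)\<^sup>2"
  unfolding polar_form_diag by (simp add: qvec_def)

lemma riem_dist_unit_speed_le:
  assumes T: "0 \<le> T" "T < 1"
    and P: "\<And>t. 0 \<le> t \<Longrightarrow> t < 1 \<Longrightarrow> (P has_vector_derivative P' t) (at t)"
      "continuous_on {0..<1} P'" "\<And>t. 0 \<le> t \<Longrightarrow> t < 1 \<Longrightarrow> P t \<in> \<bool>"
      "\<And>t. 0 \<le> t \<Longrightarrow> t < 1 \<Longrightarrow> polar_form (P t) (P t) (P' t) = (1 / (1 - t\<^sup>2))\<^sup>2"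
  shows "ball_dist (P 0) (P T) \<le> ennreal (artanh T)"
proof -
  have "ball_dist (P 0) (P T) \<le> ennreal (artanh T - artanh 0)"
  proof (rule riem_dist_le_parametrized [where P' = P' and s = "\<lambda>t. 1 / (1 - t\<^sup>2)"])
    show "continuous_on {0..T} P'"
      using P(2) by (rule continuous_on_subset) (use T in auto)
    fix t assume t: "0 \<le> t" "t \<le> T"
    then have "t\<^sup>2 \<le> 1"
      using T by (simp add: abs_square_le_1)
    then show "sqrt (polar_form (P t) (P t) (P' t)) \<le> 1 / (1 - t\<^sup>2)"
      using P(4) [of t] t T by (simp del: power_one_over power_divide)
    show "(artanh has_real_derivative 1 / (1 - t\<^sup>2)) (at t)"
      using t T by (intro artanh_real_has_field_derivative) auto
  qed (use P T in auto)
  then show ?thesis by simp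
qed

lemma riem_dist_0_le:
  assumes "w \<in> \<bool>"
  shows "ball_dist 0 w \<le> ennreal (artanh (norm w))"
proof (cases "w = 0")
  case True
  then show ?thesis using riem_dist_self [of 0] by (simp add: quat_ball_def)
next
  case False
  define u where "u = w /\<^sub>R norm w"
  have u: "norm u = 1" "w = norm w *\<^sub>R u"
    using False by (simp_all add: u_def)
  have "ball_dist ((\<lambda>t. t *\<^sub>R u) 0) ((\<lambda>t. t *\<^sub>R u) (norm w)) \<le> ennreal (artanh (norm w))"
    by (rule riem_dist_unit_speed_le [where P' = "\<lambda>t. u"])
      (use assms u(1) in \<open>auto intro!: derivative_eq_intros polar_form_radial simp: quat_ball_def\<close>)
  then show ?thesis
    using u by simp
qed

text \<open>
  The distances from the origin show that \<open>c t = h (P t)\<close> has norm \<open>t\<close>.  As \<open>c\<close> has the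
  speed of a radius, Gauss' lemma leaves no room for a component of \<open>c'\<close> orthogonal to \<open>c\<close>.
\<close>

lemma isometry_radial:
  assumes h: "h \<in> ball_isometries"
    and P: "\<And>t. 0 \<le> t \<Longrightarrow> t < 1 \<Longrightarrow> (P has_vector_derivative P' t) (at t)"
      "continuous_on {0..<1} P'" "\<And>t. 0 \<le> t \<Longrightarrow> t < 1 \<Longrightarrow> P t \<in> \<bool>"
      "\<And>t. 0 \<le> t \<Longrightarrow> t < 1 \<Longrightarrow> polar_form (P t) (P t) (P' t) = (1 / (1 - t\<^sup>2))\<^sup>2"
      "\<And>t. 0 \<le> t \<Longrightarrow> t < 1 \<Longrightarrow> artanh t \<le> disc_dist (meridian (P 0)) (meridian (P t))"
    and h0: "h (P 0) = 0" and t: "0 \<le> t" "t < 1"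
  shows "h (P t) = t *\<^sub>R frechet_derivative h (at (P 0)) (P' 0)"
proof -
  note H = riem_isometriesD [OF h]
  define c where "c t = h (P t)" for t
  define c' where "c' t = frechet_derivative h (at (P t)) (P' t)" for t
  have cB: "c t \<in> \<bool>" if "0 \<le> t" "t < 1" for t
    using H(6) P(3) that by (simp add: c_def)
  have norm_c: "norm (c t) = t" if t: "0 \<le> t" "t < 1" for t
  proof -
    have n1: "norm (c t) < 1"
      using cB [OF t] by (simp add: quat_ball_def)
    have eq: "ball_dist 0 (c t) = ball_dist (P 0) (P t)"
      using riem_isometry_riem_dist [OF open_quat_ball h, of "P 0" "P t"] P(3) t h0 by (simp add: c_def)
    have "ennreal (disc_dist (meridian 0) (meridian (c t))) \<le> ball_dist 0 (c t)"
      by (rule meridian_le_riem_dist)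
    also have "\<dots> \<le> ennreal (artanh t)"
      unfolding eq by (rule riem_dist_unit_speed_le [OF t P(1-4)]) auto
    finally have "ennreal (artanh (norm (c t))) \<le> ennreal (artanh t)"
      using n1 by (simp add: meridian_0 disc_dist_0)
    moreover have "0 \<le> artanh t"
      using t tanh_artanh_real(1) [of t] by (metis abs_of_nonneg tanh_real_nonneg_iff)
    ultimately have "artanh (norm (c t)) \<le> artanh t"
      by (simp add: ennreal_le_iff)
    then have 1: "tanh (artanh (norm (c t))) \<le> tanh (artanh t)"
      by simp
    have "ennreal (artanh t) \<le> ennreal (disc_dist (meridian (P 0)) (meridian (P t)))"
      using P(5) t by (intro ennreal_leI) auto
    also have "\<dots> \<le> ball_dist 0 (c t)"
      unfolding eq by (rule meridian_le_riem_dist)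
    also have "\<dots> \<le> ennreal (artanh (norm (c t)))"
      by (rule riem_dist_0_le [OF cB [OF t]])
    finally have 2: "ennreal (artanh t) \<le> ennreal (artanh (norm (c t)))" .
    have "0 \<le> artanh (norm (c t))"
      using n1 tanh_artanh_real(1) [of "norm (c t)"] by (metis abs_norm_cancel norm_ge_zero tanh_real_nonneg_iff)
    then have "artanh t \<le> artanh (norm (c t))"
      using 2 by (simp add: ennreal_le_iff)
    then have "tanh (artanh t) \<le> tanh (artanh (norm (c t)))"
      by simp
    then show ?thesis
      using 1 tanh_artanh_real(1) [of t] tanh_artanh_real(1) [of "norm (c t)"] t n1 by simp
  qed
  have c': "(c has_vector_derivative c' t) (at t)" if t: "0 \<le> t" "t < 1" for t
  proof -
    have "(P has_derivative (\<lambda>h. h *\<^sub>R P' t)) (at t)"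
      using P(1) [OF t] by (simp add: has_vector_derivative_def)
    from diff_chain_at [OF this riem_isometries_derivative [OF h P(3) [OF t]]]
    show ?thesis
      using has_derivative_linear [OF riem_isometries_derivative [OF h P(3) [OF t]]]
      unfolding has_vector_derivative_def o_def c_def [abs_def] c'_def by (simp add: linear_cmul)
  qed
  have radial: "c' t = c t /\<^sub>R t" if t: "0 < t" "t < 1" for t
  proof -
    have t': "0 \<le> t" "t < 1" "1 - t\<^sup>2 > 0"
      using t by (auto simp: abs_square_less_1)
    have "((\<lambda>t. c t \<bullet> c t) has_real_derivative c t \<bullet> c' t + c' t \<bullet> c t) (at t)"
      using bounded_bilinear.has_vector_derivative [OF bounded_bilinear_inner c' [OF t'(1,2)] c' [OF t'(1,2)]]
      by (simp add: has_real_derivative_iff_has_vector_derivative)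
    moreover have "((\<lambda>t. c t \<bullet> c t) has_real_derivative 2 * t) (at t)"
    proof (rule has_field_derivative_transform_within_open [where S = "{0<..<1}"])
      show "((\<lambda>t. t\<^sup>2) has_real_derivative 2 * t) (at t)"
        by (auto intro!: derivative_eq_intros)
      show "s\<^sup>2 = c s \<bullet> c s" if "s \<in> {0<..<1}" for s
        using norm_c [of s] that by (simp flip: power2_norm_eq_inner)
    qed (use t in auto)
    ultimately have "c t \<bullet> c' t + c' t \<bullet> c t = 2 * t"
      by (rule DERIV_unique)
    then have cc: "c' t \<bullet> c t = t"
      by (simp add: inner_commute)
    have "polar_form (c t) (c t) (c' t) = (1 / (1 - t\<^sup>2))\<^sup>2"
      using H(5) [OF P(3) [OF t'(1,2)], of "P' t"] P(4) [OF t'(1,2)] cB [OF t'(1,2)] P(3) [OF t'(1,2)]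
      by (simp add: c_def c'_def hardy_metric_polar_form)
    then have one: "(1 - t\<^sup>2)\<^sup>2 * polar_form (c t) (c t) (c' t) = 1"
      using t' by (simp add: power_divide)
    define k where "k = (1 - t\<^sup>2)\<^sup>2 / ((1 - t\<^sup>2)\<^sup>2 + 4 * (norm (qvec (c t)))\<^sup>2)"
    have k: "k > 0"
      using t' by (simp add: k_def add_pos_nonneg)
    have "c t \<noteq> 0"
      using norm_c [OF t'(1,2)] t by auto
    from polar_form_radial_ge [OF cB [OF t'(1,2)] this, of "c' t"]
    have "1 + k * ((norm (c' t))\<^sup>2 - 1) \<le> 1"
      using t by (simp add: norm_c [OF t'(1,2)] cc one k_def)
    then have le: "(norm (c' t))\<^sup>2 \<le> 1"
      using k by (simp add: mult_le_0_iff)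
    have sq: "(norm (a - b))\<^sup>2 = (norm a)\<^sup>2 - 2 * (a \<bullet> b) + (norm b)\<^sup>2" for a b :: quat
      by (simp add: power2_norm_eq_inner inner_diff_left inner_diff_right inner_commute)
    have "(norm (c' t - c t /\<^sub>R t))\<^sup>2 = (norm (c' t))\<^sup>2 - 2 + 1"
      unfolding sq using t by (simp add: cc norm_c [OF t'(1,2)])
    also have "\<dots> \<le> 0"
      using le by simp
    finally show ?thesis
      by simp
  qed
  \<comment> \<open>By \<open>radial\<close>, the direction \<open>c t / t\<close> has derivative zero.\<close>
  have "\<exists>u. \<forall>t\<in>{0<..<1}. (1 / t) *\<^sub>R c t = u"
  proof (rule has_derivative_zero_constant)
    fix t :: real assume t: "t \<in> {0<..<1}"
    have "((\<lambda>t. (1 / t) *\<^sub>R c t) has_vector_derivative (1 / t) *\<^sub>R c' t + (- (1 / t\<^sup>2)) *\<^sub>R c t) (at t)"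
      by (rule has_vector_derivative_scaleR [OF _ c'])
        (use t in \<open>auto intro!: derivative_eq_intros simp: power2_eq_square\<close>)
    moreover have "(1 / t) *\<^sub>R c' t + (- (1 / t\<^sup>2)) *\<^sub>R c t = 0"
      using t by (simp add: radial power2_eq_square divide_inverse)
    ultimately show "((\<lambda>t. (1 / t) *\<^sub>R c t) has_derivative (\<lambda>h. 0)) (at t within {0<..<1})"
      by (simp add: has_vector_derivative_def has_derivative_at_withinI)
  qed simp
  then obtain u where u: "\<And>t. 0 < t \<Longrightarrow> t < 1 \<Longrightarrow> (1 / t) *\<^sub>R c t = u"
    by auto
  have cu: "c t = t *\<^sub>R u" if t: "0 \<le> t" "t < 1" for t
  proof (cases "t = 0")
    case True
    then show ?thesis using h0 by (simp add: c_def)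
  next
    case False
    then show ?thesis
      using t u [of t] by (auto simp flip: u [of t])
  qed
  have "c' 0 = u"
  proof (rule vector_derivative_unique_within)
    show "at (0::real) within {0..<1} \<noteq> bot"
    proof -
      have "{0..<1::real} - {0} = {0<..<1}"
        by auto
      then show ?thesis
        by (simp add: at_within_eq_bot_iff)
    qed
    show "(c has_vector_derivative c' 0) (at 0 within {0..<1})"
      by (rule has_vector_derivative_at_within [OF c']) auto
    have "((\<lambda>t. t *\<^sub>R u) has_vector_derivative u) (at 0 within {0..<1})"
      by (auto intro!: derivative_eq_intros)
    then show "(c has_vector_derivative u) (at 0 within {0..<1})"
      by (rule has_vector_derivative_transform [rotated 2]) (simp_all add: cu)
  qed
  then show ?thesis
    using cu [OF t] by (simp add: c_def c'_def)
qed

section \<open>Isometries fixing the origin\<close>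

text \<open>
  Every radius is mapped to a radius, whose direction is given by the derivative at \<open>0\<close>.
\<close>

lemma isometry_fixing_0_linear:
  assumes f: "f \<in> ball_isometries" and f0: "f 0 = 0"
  obtains U where "orthogonal_transformation U" "\<And>w. w \<in> \<bool> \<Longrightarrow> f w = U w"
    "\<And>w d. w \<in> \<bool> \<Longrightarrow> polar_form (U w) (U w) (U d) = polar_form w w d"
proof -
  note F = riem_isometriesD [OF f]
  define U where "U = frechet_derivative f (at 0)"
  have B0: "0 \<in> \<bool>"
    by (simp add: quat_ball_def)
  have lin: "linear U"
    unfolding U_def by (rule has_derivative_linear [OF riem_isometries_derivative [OF f B0]])
  have nU: "norm (U d) = norm d" for d
  proof -
    have "(norm (U d))\<^sup>2 = (norm d)\<^sup>2"
      using F(5) [OF B0, of d] by (simp add: f0 hardy_metric_polar_form B0 polar_form_0 U_def)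
    then show ?thesis
      by (rule power2_eq_imp_eq) (rule norm_ge_zero)+
  qed
  have fU: "f w = U w" if w: "w \<in> \<bool>" for w
  proof (cases "w = 0")
    case True
    then show ?thesis using f0 linear_0 [OF lin] by simp
  next
    case False
    define u where "u = w /\<^sub>R norm w"
    have u: "norm u = 1" "w = norm w *\<^sub>R u"
      using False by (simp_all add: u_def)
    have n: "norm (t *\<^sub>R u) = t" if "0 \<le> t" for t
      using u that by simp
    have "f (norm w *\<^sub>R u) = norm w *\<^sub>R frechet_derivative f (at (0 *\<^sub>R u)) u"
    proof (rule isometry_radial [OF f, of "\<lambda>t. t *\<^sub>R u" "\<lambda>t. u"])
      fix t :: real assume t: "0 \<le> t" "t < 1"
      show "artanh t \<le> disc_dist (meridian (0 *\<^sub>R u)) (meridian (t *\<^sub>R u))"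
        using t u by (simp add: meridian_0 disc_dist_0)
    qed (use u(1) w f0 in \<open>auto intro!: derivative_eq_intros polar_form_radial simp: quat_ball_def\<close>)
    then show ?thesis
      using u(2) linear_cmul [OF lin, of "norm w" u] by (simp add: U_def)
  qed
  have "polar_form (U w) (U w) (U d) = polar_form w w d" if w: "w \<in> \<bool>" for w d
  proof -
    have "(f has_derivative U) (at w)"
      by (rule has_derivative_transform_within_open [OF linear_imp_has_derivative [OF lin] open_quat_ball w])
        (simp add: fU)
    then have "frechet_derivative f (at w) = U"
      by (rule frechet_derivative_at [symmetric])
    moreover have "U w \<in> \<bool>"
      using w by (simp add: quat_ball_def nU)
    ultimately show ?thesis
      using F(5) [OF w, of d] by (simp add: hardy_metric_polar_form w fU)
  qed
  moreover have "orthogonal_transformation U"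
    using lin nU by (simp add: orthogonal_transformation)
  ultimately show ?thesis
    using that fU by blast
qed

text \<open>
  The smallest value of the metric at \<open>w\<close> on unit vectors is \<open>1 / |1 - w\<^sup>2|\<^sup>2\<close>.  As the norm is preserved,
  \<open>|Im w|\<close> cannot decrease, so imaginary quaternions remain imaginary and \<open>1\<close> goes to \<open>1\<close> or \<open>-1\<close>.
\<close>

lemma isometry_fixing_0:
  assumes f: "f \<in> ball_isometries" and f0: "f 0 = 0"
  obtains A where "sphere_isometry A"
    "(\<forall>w\<in>\<bool>. f w = sphere_map A w) \<or> (\<forall>w\<in>\<bool>. f w = reflection (sphere_map A w))"
proof -
  obtain U where U: "orthogonal_transformation U" and fU: "\<And>w. w \<in> \<bool> \<Longrightarrow> f w = U w"
    and iso: "\<And>w d. w \<in> \<bool> \<Longrightarrow> polar_form (U w) (U w) (U d) = polar_form w w d"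
    by (rule isometry_fixing_0_linear [OF f f0]) (rule that)
  have lin: "linear U" and iU: "U d \<bullet> U e = d \<bullet> e" for d e
    using U by (simp_all add: orthogonal_transformation_def)
  have nU: "norm (U d) = norm d" for d
    by (simp add: norm_eq_sqrt_inner iU)
  have vle: "(norm (qvec w))\<^sup>2 \<le> (norm (qvec (U w)))\<^sup>2" if w: "w \<in> \<bool>" for w
  proof -
    \<comment> \<open>A direction in which the metric at \<open>w\<close> is smallest.\<close>
    obtain K where K: "K \<in> \<S>" "K \<bullet> qvec w = 0"
      by (rule quat_orthogonal_imag_unit)
    define al where "al = 1 - (norm w)\<^sup>2"
    have al: "al > 0"
      using w by (simp add: al_def in_ball_iff)
    have K1: "norm K = 1" "qre K = 0"
      using K(1) by (simp_all add: imag_units_iff)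
    have Uw: "U w \<in> \<bool>"
      using w by (simp add: quat_ball_def nU)
    have "1 / (al\<^sup>2 + 4 * (norm (qvec (U w)))\<^sup>2) \<le> polar_form (U w) (U w) (U K)"
      using polar_form_ge [OF Uw, of "U K"] by (simp add: nU K1 al_def)
    also have "\<dots> = 1 / (al\<^sup>2 + 4 * (norm (qvec w))\<^sup>2)"
      unfolding iso [OF w] unfolding polar_form_diag al_def [symmetric] using K K1 al by simp
    finally have "al\<^sup>2 + 4 * (norm (qvec w))\<^sup>2 \<le> al\<^sup>2 + 4 * (norm (qvec (U w)))\<^sup>2"
      using al by (simp add: divide_simps add_pos_nonneg split: if_splits)
    then show ?thesis by simp
  qed
  have UI: "U I \<in> \<S>" if I: "I \<in> \<S>" for I
  proof -
    have I1: "norm I = 1" "qre I = 0"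
      using I by (simp_all add: imag_units_iff)
    then have qI: "qvec I = I"
      by (simp add: qvec_def)
    define w where "w = (1/2) *\<^sub>R I"
    have w: "w \<in> \<bool>" "(norm w)\<^sup>2 = 1/4" "(norm (qvec w))\<^sup>2 = 1/4"
      by (simp_all add: w_def quat_ball_def qvec_scaleR qI I1 power_divide)
    have "(norm (U w))\<^sup>2 = 1/4"
      by (simp add: nU w)
    then have "(qre (U w))\<^sup>2 \<le> 0"
      using vle [OF w(1)] norm_sq_qvec [of "U w"] w(3) by linarith
    then have "qre (U w) = 0"
      by simp
    moreover have "U w = (1/2) *\<^sub>R U I"
      by (simp add: w_def linear_cmul [OF lin])
    ultimately show ?thesis
      by (simp add: imag_units_iff nU I1)
  qed
  have Uim: "qre (U v) = 0" if v: "qre v = 0" for v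
  proof (cases "v = 0")
    case True
    then show ?thesis by (simp add: linear_0 [OF lin])
  next
    case False
    then have "v /\<^sub>R norm v \<in> \<S>"
      using v by (simp add: imag_units_iff)
    from UI [OF this] show ?thesis
      using False by (simp add: linear_cmul [OF lin] imag_units_iff)
  qed
  define s where "s = qre (U 1)"
  have Uz: "qre (U z) = qre z * s" for z
  proof -
    have "z = qre z *\<^sub>R 1 + qvec z"
      by (simp add: qvec_def of_real_def)
    then have "U z = qre z *\<^sub>R U 1 + U (qvec z)"
      by (metis linear_add [OF lin] linear_cmul [OF lin])
    then show ?thesis
      using Uim [of "qvec z"] by (simp add: s_def)
  qed
  \<comment> \<open>Surjectivity forces the real part \<open>s\<close> of \<open>U 1\<close> to have absolute value \<open>1\<close>: the imaginary part of \<open>z\<close> does not contribute to the real part of \<open>U z\<close>.\<close>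
  obtain z where z: "U z = 1"
    using orthogonal_transformation_surj [OF U] by (metis surjD)
  have reb: "\<bar>qre x\<bar> \<le> norm x" for x
    using norm_sq_qvec [of x] by (simp add: abs_le_square_iff [of "qre x" "norm x", simplified])
  have "\<bar>qre z\<bar> * \<bar>s\<bar> = 1"
    using Uz [of z] z by (simp flip: abs_mult)
  moreover have "\<bar>qre z\<bar> \<le> 1" "\<bar>s\<bar> \<le> 1"
    using reb [of z] reb [of "U 1"] nU [of z] nU [of 1] z by (simp_all add: s_def)
  moreover from this(1) have "\<bar>qre z\<bar> * \<bar>s\<bar> \<le> 1 * \<bar>s\<bar>"
    by (rule mult_right_mono) simp
  ultimately have s1: "\<bar>s\<bar> = 1"
    by linarith
  have "(norm (U 1))\<^sup>2 = s\<^sup>2 + (norm (qvec (U 1)))\<^sup>2"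
    using norm_sq_qvec [of "U 1"] by (simp add: s_def)
  moreover have "s\<^sup>2 = 1"
    using s1 by (simp add: abs_square_eq_1)
  ultimately have "qvec (U 1) = 0"
    by (simp add: nU)
  then have U1: "U 1 = of_real s"
    by (simp add: qvec_def s_def)
  have "bij_betw U \<S> \<S>"
  proof (rule bij_betwI')
    show "(U x = U y) = (x = y)" for x y
      using orthogonal_transformation_inj [OF U] by (simp add: inj_eq)
    show "\<exists>x\<in>\<S>. y = U x" if y: "y \<in> \<S>" for y
    proof -
      obtain x where x: "U x = y"
        using orthogonal_transformation_surj [OF U] by (metis surjD)
      then have "x \<in> \<S>"
        using y Uz [of x] nU [of x] s1 by (auto simp: imag_units_iff)
      then show ?thesis
        using x by blast
    qed
  qed (rule UI)
  then have A: "sphere_isometry U"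
    by (simp add: sphere_isometry_def sphere_dist_def iU)
  have Uw: "U w = of_real (s * x) + of_real y * U I" "sphere_map U w = of_real x + of_real y * U I"
    if "w = of_real x + of_real y * I" "0 \<le> y" "I \<in> \<S>" for w x y I
  proof -
    have "w = x *\<^sub>R 1 + y *\<^sub>R I"
      using that by (simp add: times_of_real_quat of_real_def)
    then have "U w = x *\<^sub>R U 1 + y *\<^sub>R U I"
      by (simp add: linear_add [OF lin] linear_cmul [OF lin])
    then show "U w = of_real (s * x) + of_real y * U I"
      by (simp add: U1 times_of_real_quat of_real_def mult.commute)
    show "sphere_map U w = of_real x + of_real y * U I"
      using that sphere_map_eq by simp
  qed
  show ?thesis
  proof (cases "s = 1")
    case True
    have "f w = sphere_map U w" if "w \<in> \<bool>" for w
      using quat_polar_ex [of w] Uw fU [OF that] True by (metis mult_1)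
    then show ?thesis
      using that A by blast
  next
    case False
    then have s: "s = -1"
      using s1 by linarith
    have "f w = reflection (sphere_map U w)" if "w \<in> \<bool>" for w
    proof -
      obtain x y I where w: "0 \<le> y" "I \<in> \<S>" "w = of_real x + of_real y * I"
        by (rule quat_polar_ex)
      have "qre (U I) = 0"
        using UI [OF w(2)] by (simp add: imag_units_iff)
      then have "of_real (s * x) + of_real y * U I = reflection (of_real x + of_real y * U I)"
        by (simp add: quat_eq_iff reflection_def times_of_real_quat s)
      then show ?thesis
        using Uw [OF w(3,1,2)] fU [OF that] by simp
    qed
    then show ?thesis
      using that A by blast
  qed
qed

section \<open>Isometries preserve the real axis\<close>

definition disc_moebius :: "complex \<Rightarrow> complex \<Rightarrow> complex"
  where "disc_moebius a z = (z + a) / (1 + cnj a * z)"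

lemma disc_moebius_denom:
  assumes "cmod a < 1" "cmod z < 1"
  shows "1 + cnj a * z \<noteq> 0"
proof
  assume "1 + cnj a * z = 0"
  then have "cnj a * z = - 1"
    by (simp add: add_eq_0_iff)
  then have "cmod a * cmod z = 1"
    by (metis complex_mod_cnj norm_minus_cancel norm_mult norm_one)
  moreover have "cmod a * cmod z \<le> cmod a * 1"
    using assms by (intro mult_left_mono) auto
  ultimately show False
    using assms by simp
qed

lemma disc_moebius_one_minus:
  assumes "cmod a < 1" "cmod z < 1"
  shows "1 - (cmod (disc_moebius a z))\<^sup>2 = (1 - (cmod a)\<^sup>2) * (1 - (cmod z)\<^sup>2) / (cmod (1 + cnj a * z))\<^sup>2"
proof -
  have "- a - z = - (z + a)"
    by simp
  then have "cmod (- a - z) = cmod (z + a)"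
    by (simp only: norm_minus_cancel)
  then have "(cmod (1 + cnj a * z))\<^sup>2 = (cmod (z + a))\<^sup>2 + (1 - (cmod a)\<^sup>2) * (1 - (cmod z)\<^sup>2)"
    using disc_cosh_sinh_identity [of "- a" z] by simp
  moreover define D where "D = (cmod (1 + cnj a * z))\<^sup>2"
  ultimately have eq: "D = (cmod (z + a))\<^sup>2 + (1 - (cmod a)\<^sup>2) * (1 - (cmod z)\<^sup>2)"
    by simp
  have D: "D \<noteq> 0"
    using disc_moebius_denom [OF assms] by (simp add: D_def)
  have "1 - (cmod (disc_moebius a z))\<^sup>2 = (D - (cmod (z + a))\<^sup>2) / D"
    using D by (simp add: disc_moebius_def norm_divide power_divide D_def [symmetric] diff_divide_distrib)
  then show ?thesis
    by (simp add: eq D_def [symmetric])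
qed

lemma disc_moebius_in_disc:
  assumes "cmod a < 1" "cmod z < 1"
  shows "cmod (disc_moebius a z) < 1"
proof -
  have "0 < 1 - (cmod (disc_moebius a z))\<^sup>2"
    unfolding disc_moebius_one_minus [OF assms] using assms disc_moebius_denom [OF assms]
    by (simp add: abs_square_less_1)
  then show ?thesis
    by (simp add: abs_square_less_1)
qed

lemma disc_dist_moebius:
  assumes "cmod a < 1" "cmod z < 1" "cmod w < 1"
  shows "disc_dist (disc_moebius a z) (disc_moebius a w) = disc_dist z w"
proof -
  define A where "A = 1 - (cmod a)\<^sup>2"
  have A: "A > 0"
    using assms by (simp add: A_def abs_square_less_1)
  define m n where "m = cmod (1 + cnj a * z)" "n = cmod (1 + cnj a * w)"
  have mn: "m > 0" "n > 0"
    using disc_moebius_denom assms by (simp_all add: m_n_def)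
  define k l where "k = 1 - (cmod z)\<^sup>2" "l = 1 - (cmod w)\<^sup>2"
  have kl: "k > 0" "l > 0"
    using assms by (simp_all add: k_l_def abs_square_less_1)
  have "disc_moebius a z - disc_moebius a w =
      of_real A * (z - w) / ((1 + cnj a * z) * (1 + cnj a * w))"
  proof -
    have "(z + a) * (1 + cnj a * w) - (w + a) * (1 + cnj a * z) = of_real A * (z - w)"
      unfolding A_def of_real_diff of_real_1 complex_norm_square by (simp add: algebra_simps)
    then show ?thesis
      using disc_moebius_denom assms unfolding disc_moebius_def by (simp add: diff_frac_eq)
  qed
  then have 1: "cmod (disc_moebius a z - disc_moebius a w) = A * cmod (z - w) / (m * n)"
    using A by (simp add: norm_divide norm_mult m_n_def)
  have 2: "(1 - (cmod (disc_moebius a z))\<^sup>2) * (1 - (cmod (disc_moebius a w))\<^sup>2) = (A / (m * n))\<^sup>2 * (k * l)"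
    unfolding disc_moebius_one_minus [OF assms(1,2)] disc_moebius_one_minus [OF assms(1,3)]
      m_n_def [symmetric] k_l_def [symmetric] A_def [symmetric]
    by (simp add: power2_eq_square mult_ac)
  have "sqrt ((A / (m * n))\<^sup>2 * (k * l)) = A / (m * n) * sqrt (k * l)"
    using A mn by (simp add: real_sqrt_mult)
  then show ?thesis
    unfolding disc_dist_def 1 2 k_l_def [symmetric] using A mn by simp
qed

lemma disc_moebius_derivative:
  assumes "cmod a < 1" "cmod z < 1"
  shows "(disc_moebius a has_field_derivative of_real (1 - (cmod a)\<^sup>2) / (1 + cnj a * z)\<^sup>2) (at z)"
proof -
  have "((\<lambda>z. (z + a) / (1 + cnj a * z)) has_field_derivative
      (1 * (1 + cnj a * z) - (z + a) * cnj a) / ((1 + cnj a * z) * (1 + cnj a * z))) (at z)"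
    using disc_moebius_denom [OF assms] by (auto intro!: derivative_eq_intros)
  moreover have eq: "1 * (1 + cnj a * z) - (z + a) * cnj a = of_real (1 - (cmod a)\<^sup>2)"
    unfolding of_real_diff of_real_1 complex_norm_square by (simp add: algebra_simps)
  ultimately show ?thesis
    by (simp only: eq disc_moebius_def [abs_def] power2_eq_square [of "1 + cnj a * z"])
qed

text \<open>
  The numerator of the imaginary part is \<open>t Im (z + a\<^sup>2 cnj z) + (1 + t\<^sup>2) Im a\<close>, and \<open>1 + t\<^sup>2 \<ge> 2 t\<close>.
  The condition on \<open>z\<close> says that the whole hyperbolic ray from \<open>a\<close> in direction \<open>z\<close> lies in the
  upper half of the disc.
\<close>

lemma disc_moebius_Im_pos:
  assumes a: "cmod a < 1" "Im a > 0" and z: "cmod z = 1" "Im (z + a\<^sup>2 * cnj z) > - 2 * Im a"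
    and t: "0 \<le> t" "t < 1"
  shows "Im (disc_moebius a (of_real t * z)) > 0"
proof -
  have tz: "cmod (of_real t * z) < 1"
    using z t by (simp add: norm_mult)
  define d where "d = 1 + cnj a * (of_real t * z)"
  have d: "d \<noteq> 0"
    unfolding d_def by (rule disc_moebius_denom [OF a(1) tz])
  have zz: "z * cnj z = 1"
    using z by (simp add: complex_norm_square [symmetric])
  have "disc_moebius a (of_real t * z) = (of_real t * z + a) * cnj d / of_real ((cmod d)\<^sup>2)"
    unfolding disc_moebius_def d_def [symmetric] complex_norm_square using d by simp
  then have "Im (disc_moebius a (of_real t * z)) = Im ((of_real t * z + a) * cnj d) / (cmod d)\<^sup>2"
    by simp
  moreover have "(of_real t * z + a) * cnj d = of_real t * (z + a\<^sup>2 * cnj z) + of_real (1 + t\<^sup>2) * a"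
  proof -
    have "(of_real t * z + a) * cnj d = of_real t * z + a + of_real (t\<^sup>2) * a * (z * cnj z) + of_real t * (a\<^sup>2 * cnj z)"
      by (simp add: d_def algebra_simps power2_eq_square)
    then show ?thesis
      unfolding zz by (simp add: algebra_simps)
  qed
  moreover have "Im (of_real t * (z + a\<^sup>2 * cnj z) + of_real (1 + t\<^sup>2) * a) > 0"
  proof -
    have "Im (of_real t * (z + a\<^sup>2 * cnj z) + of_real (1 + t\<^sup>2) * a) =
        t * Im (z + a\<^sup>2 * cnj z) + (1 + t\<^sup>2) * Im a"
    proof -
      have "Im (of_real r * w) = r * Im w" for r w
        by simp
      then show ?thesis
        by (simp only: plus_complex.simps)
    qed
    also have "\<dots> \<ge> t * (- 2 * Im a) + (1 + t\<^sup>2) * Im a"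
      using z t by (intro add_right_mono mult_left_mono) auto
    moreover have "t * (- 2 * Im a) + (1 + t\<^sup>2) * Im a = (1 - t)\<^sup>2 * Im a"
      by (simp add: power2_eq_square algebra_simps)
    moreover have "(1 - t)\<^sup>2 * Im a > 0"
      using a t by simp
    ultimately show ?thesis
      by linarith
  qed
  ultimately show ?thesis
    using d by simp
qed

lemma meridian_slice_embed:
  assumes "I \<in> \<S>" "Im z \<ge> 0"
  shows "meridian (slice_embed I z) = z"
  using assms by (simp add: meridian_def slice_embed_sel imag_units_iff complex_eq_iff)

text \<open>
  In the upper half of a slice the hyperbolic rays from a point are minimizing for \<open>\<rho>\<close>, so that
  \<open>isometry_radial\<close> applies to them.
\<close>

lemma isometry_unit_speed_ray:
  assumes h: "h \<in> ball_isometries" and h0: "h (slice_embed I a) = 0"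
    and I: "I \<in> \<S>" and a: "cmod a < 1" "Im a > 0"
    and z: "cmod z = 1" "Im (z + a\<^sup>2 * cnj z) > - 2 * Im a" and t: "0 \<le> t" "t < 1"
  shows "h (slice_embed I (disc_moebius a (of_real t * z))) =
    t *\<^sub>R frechet_derivative h (at (slice_embed I a)) (slice_embed I (of_real (1 - (cmod a)\<^sup>2) * z))"
proof -
  define P where "P t = slice_embed I (disc_moebius a (of_real t * z))" for t
  define P' where "P' t = slice_embed I (z * (of_real (1 - (cmod a)\<^sup>2) / (1 + cnj a * (of_real t * z))\<^sup>2))" for t
  have tz: "cmod (of_real t * z) < 1" if "0 \<le> t" "t < 1" for t
    using z that by (simp add: norm_mult)
  have P0: "P 0 = slice_embed I a" "P' 0 = slice_embed I (of_real (1 - (cmod a)\<^sup>2) * z)"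
    by (simp_all add: P_def P'_def disc_moebius_def mult.commute)
  have "h (P t) = t *\<^sub>R frechet_derivative h (at (P 0)) (P' 0)"
  proof (rule isometry_radial [OF h _ _ _ _ _ _ t])
    show "h (P 0) = 0"
      by (simp add: P0 h0)
    show "continuous_on {0..<1} P'"
      unfolding P'_def using disc_moebius_denom [OF a(1) tz]
      by (intro bounded_linear.continuous_on [OF bounded_linear_slice_embed] continuous_intros) auto
    fix s :: real assume s: "0 \<le> s" "s < 1"
    note sz = tz [OF s]
    show "P s \<in> \<bool>"
      using disc_moebius_in_disc [OF a(1) sz] by (simp add: P_def quat_ball_def slice_embed_sel [OF I])
    have "((\<lambda>t. of_real t * z) has_vector_derivative z) (at s)"
      by (auto intro!: derivative_eq_intros)
    from field_vector_diff_chain_at [OF this disc_moebius_derivative [OF a(1) sz]]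
    show "(P has_vector_derivative P' s) (at s)"
      unfolding P_def [abs_def] P'_def
      by (intro bounded_linear.has_vector_derivative [OF bounded_linear_slice_embed]) (simp add: o_def)
    have pos: "1 - (cmod a)\<^sup>2 > 0" "cmod (1 + cnj a * (of_real s * z)) > 0" "1 - s\<^sup>2 > 0"
      using a s disc_moebius_denom [OF a(1) sz] by (simp_all add: abs_square_less_1)
    have "polar_form (P s) (P s) (P' s) =
        (cmod (z * (of_real (1 - (cmod a)\<^sup>2) / (1 + cnj a * (of_real s * z))\<^sup>2)) / (1 - (cmod (disc_moebius a (of_real s * z)))\<^sup>2))\<^sup>2"
      unfolding P_def P'_def by (rule polar_form_slice_embed [OF I disc_moebius_in_disc [OF a(1) sz]])
    also have "cmod (z * (of_real (1 - (cmod a)\<^sup>2) / (1 + cnj a * (of_real s * z))\<^sup>2)) =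
        (1 - (cmod a)\<^sup>2) / (cmod (1 + cnj a * (of_real s * z)))\<^sup>2"
      using pos(1) by (simp only: norm_mult norm_divide z norm_of_real norm_power)
    also have "\<dots> / (1 - (cmod (disc_moebius a (of_real s * z)))\<^sup>2) = 1 / (1 - s\<^sup>2)"
    proof -
      have "(cmod (of_real s * z))\<^sup>2 = s\<^sup>2"
        using z by (simp add: norm_mult)
      then show ?thesis
        unfolding disc_moebius_one_minus [OF a(1) sz] using pos by simp
    qed
    finally show "polar_form (P s) (P s) (P' s) = (1 / (1 - s\<^sup>2))\<^sup>2" .
    have "disc_dist (meridian (P 0)) (meridian (P s)) = disc_dist (disc_moebius a 0) (disc_moebius a (of_real s * z))"
      using disc_moebius_Im_pos [OF a z s] disc_moebius_Im_pos [OF a z, of 0]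
      by (simp add: P_def meridian_slice_embed [OF I])
    also have "\<dots> = artanh s"
      using s z sz by (simp add: disc_dist_moebius [OF a(1)] disc_dist_0 norm_mult)
    finally show "artanh s \<le> disc_dist (meridian (P 0)) (meridian (P s))"
      by simp
  qed
  then show ?thesis
    unfolding P0 by (simp add: P_def)
qed

lemma disc_dist_unbounded:
  assumes D: "cmod (z - w) > 0" "cmod z = 1" "cmod w = 1"
  shows "\<exists>r. 0 \<le> r \<and> r < 1 \<and> disc_dist (of_real r * z) (of_real r * w) > M"
proof -
  define D where "D = cmod (z - w)"
  define m where "m = \<bar>sinh M\<bar> + 1"
  \<comment> \<open>With \<open>r \<ge> 1/2\<close> and \<open>1 - r\<^sup>2 \<le> 2 (1 - r) \<le> D / (4 m)\<close> the ratio \<open>r D / (1 - r\<^sup>2)\<close> exceeds \<open>m\<close>.\<close>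
  define r where "r = 1 - min (1/2) (D / (8 * m))"
  have m: "m > 0" and D: "D > 0"
    using assms by (simp_all add: m_def D_def)
  have r: "1/2 \<le> r" "r < 1" "1 - r \<le> D / (8 * m)"
    using m D by (auto simp: r_def)
  have r1: "1 - r\<^sup>2 > 0"
    using r by (simp add: abs_square_less_1)
  have "1 - r\<^sup>2 = (1 - r) * (1 + r)"
    by (simp add: power2_eq_square algebra_simps)
  also have "\<dots> \<le> D / (8 * m) * 2"
    using r m D by (intro mult_mono) auto
  finally have "m * (1 - r\<^sup>2) \<le> m * (D / (8 * m) * 2)"
    using m by (intro mult_left_mono) auto
  also have "\<dots> = D / 4"
    using m by simp
  also have "\<dots> < (1/2) * D"
    using D by simp
  also have "\<dots> \<le> r * D"
    using r D by (intro mult_right_mono) auto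
  finally have "m < r * D / (1 - r\<^sup>2)"
    using r1 by (simp add: pos_less_divide_eq)
  moreover have "cmod (of_real r * z - of_real r * w) = r * D"
    unfolding D_def using r by (simp add: norm_mult flip: right_diff_distrib)
  moreover have "sqrt ((1 - (cmod (of_real r * z))\<^sup>2) * (1 - (cmod (of_real r * w))\<^sup>2)) = 1 - r\<^sup>2"
    using assms r1 by (simp add: norm_mult power2_eq_square [symmetric])
  ultimately have "m < sinh (disc_dist (of_real r * z) (of_real r * w))"
    by (simp add: disc_dist_def)
  moreover have "sinh M < m"
    unfolding m_def by linarith
  ultimately have "sinh M < sinh (disc_dist (of_real r * z) (of_real r * w))"
    by (rule less_trans [rotated])
  then have "M < disc_dist (of_real r * z) (of_real r * w)"
    by (simp only: sinh_real_less_iff)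
  then show ?thesis
    using r by (intro exI [of _ r]) auto
qed

text \<open>
  For the real part of the image under a derivative this provides a direction that becomes imaginary.
\<close>

lemma real_functional_unit_kernel:
  fixes g :: "complex \<Rightarrow> real"
  assumes "linear g"
  obtains z where "cmod z = 1" "g z = 0"
proof (cases "g 1 = 0")
  case True
  then show ?thesis using that [of 1] by simp
next
  case False
  define w where "w = Complex (- g \<i>) (g 1)"
  have w: "w \<noteq> 0"
    using False by (simp add: w_def complex_eq_iff)
  have "w = (- g \<i>) *\<^sub>R 1 + g 1 *\<^sub>R \<i>"
    by (simp add: w_def complex_eq_iff)
  then have "g w = (- g \<i>) * g 1 + g 1 * g \<i>"
    by (metis linear_add [OF assms] linear_cmul [OF assms] real_scaleR_def)
  then have "g w = 0"
    by simp
  show ?thesis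
  proof (rule that [of "w /\<^sub>R cmod w"])
    show "g (w /\<^sub>R cmod w) = 0"
      by (simp add: linear_cmul [OF assms] \<open>g w = 0\<close>)
  qed (use w in simp)
qed

text \<open>
  The map \<open>G\<close> is the derivative of \<open>h\<close> at \<open>w\<close> on the slice of \<open>w\<close>, in the coordinate of the disc centred
  at \<open>w\<close>.  The contradiction comes from two rays that leave \<open>w\<close> in the directions \<open>z 1\<close> and \<open>z (-1)\<close>:
  they diverge, but their images stay within distance \<open>\<pi>/2\<close> of each other.
\<close>

lemma isometry_preimage_0_real:
  assumes h: "h \<in> ball_isometries" and w: "w \<in> \<bool>" and h0: "h w = 0"
  shows "qvec w = 0"
proof (rule ccontr)
  assume v: "qvec w \<noteq> 0"
  note H = riem_isometriesD [OF h]
  define I where "I = qvec w /\<^sub>R norm (qvec w)"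
  define a where "a = meridian w"
  have I: "I \<in> \<S>"
    using v by (simp add: I_def imag_units_iff)
  have a: "cmod a < 1" "Im a > 0"
    using w v by (simp_all add: a_def quat_ball_def) (simp add: meridian_def)
  have wa: "w = slice_embed I a"
    using v by (simp add: slice_embed_def a_def meridian_def I_def) (simp add: qvec_def)
  note h0' = h0 [unfolded wa]
  define G where "G z = frechet_derivative h (at w) (slice_embed I (of_real (1 - (cmod a)\<^sup>2) * z))" for z
  have linG: "linear G"
  proof -
    have "linear (slice_embed I)"
      using bounded_linear_slice_embed by (rule bounded_linear.linear)
    moreover have "linear (\<lambda>z. of_real (1 - (cmod a)\<^sup>2) * z :: complex)"
      by (rule bounded_linear.linear [OF bounded_linear_mult_right])
    moreover have "linear (frechet_derivative h (at w))"
      by (rule has_derivative_linear [OF riem_isometries_derivative [OF h w]])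
    ultimately have "linear (frechet_derivative h (at w) \<circ> (slice_embed I \<circ> (\<lambda>z. of_real (1 - (cmod a)\<^sup>2) * z)))"
      by (intro linear_compose)
    then show ?thesis
      by (simp add: G_def [abs_def] o_def)
  qed
  have ray: "h (slice_embed I (disc_moebius a (of_real t * z))) = t *\<^sub>R G z"
    if "cmod z = 1" "Im (z + a\<^sup>2 * cnj z) > - 2 * Im a" "0 \<le> t" "t < 1" for z t
    unfolding G_def using isometry_unit_speed_ray [OF h h0' I a that] by (simp add: wa)
  have nG: "norm (G z) = 1" if "cmod z = 1" for z
  proof -
    have "(norm (G z))\<^sup>2 = polar_form w w (slice_embed I (of_real (1 - (cmod a)\<^sup>2) * z))"
      using H(5) [OF w, of "slice_embed I (of_real (1 - (cmod a)\<^sup>2) * z)"] w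
      by (simp add: h0 G_def hardy_metric_polar_form polar_form_0 quat_ball_def)
    also have "\<dots> = (cmod (of_real (1 - (cmod a)\<^sup>2) * z) / (1 - (cmod a)\<^sup>2))\<^sup>2"
      unfolding wa by (rule polar_form_slice_embed [OF I a(1)])
    also have "\<dots> = 1"
    proof -
      have "1 - (cmod a)\<^sup>2 > 0"
        using a by (simp add: abs_square_less_1)
      then show ?thesis
        unfolding norm_mult norm_of_real using that by simp
    qed
    finally show ?thesis
      by (simp add: abs_square_eq_1)
  qed
  have "linear (\<lambda>z. qre (G z))"
    using linear_compose [OF linG bounded_linear.linear [OF bounded_linear_qre]] by (simp add: o_def)
  then obtain z0 where z0: "cmod z0 = 1" "qre (G z0) = 0"
    using real_functional_unit_kernel by blast
  \<comment> \<open>The rays in direction \<open>z\<close> with \<open>m z > - 2 Im a\<close> stay in the half slice.  The sign \<open>e\<close> picks the perpendicular to \<open>z0\<close> that lies well inside this range, and \<open>k\<close> is a tilt that does not leave it.\<close>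
  define m where "m z = Im (z + a\<^sup>2 * cnj z)" for z
  have m_lin: "m (r *\<^sub>R x + s *\<^sub>R y) = r * m x + s * m y" for r s x y
    by (simp add: m_def algebra_simps scaleR_conv_of_real)
  define e :: real where "e = (if m (\<i> * z0) \<ge> 0 then 1 else -1)"
  have me: "e * m (\<i> * z0) \<ge> 0" "e\<^sup>2 = 1"
    by (simp_all add: e_def)
  define k where "k = Im a / (\<bar>m z0\<bar> + 1)"
  have k: "k > 0"
    using a by (simp add: k_def add_nonneg_pos)
  have km: "k * \<bar>m z0\<bar> \<le> Im a"
  proof -
    have "k * \<bar>m z0\<bar> \<le> k * (\<bar>m z0\<bar> + 1)"
      using k by simp
    also have "\<dots> = Im a"
      unfolding k_def by (simp add: add_nonneg_eq_0_iff)
    finally show ?thesis .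
  qed
  define s where "s = 1 / sqrt (1 + k\<^sup>2)"
  have s: "s > 0" "s \<le> 1" "s\<^sup>2 * (1 + k\<^sup>2) = 1"
    using k by (simp_all add: s_def power_divide add_pos_nonneg add_nonneg_eq_0_iff)
  \<comment> \<open>The unit directions \<open>z 1\<close> and \<open>z (-1)\<close> are mirror images in the perpendicular to \<open>z0\<close>.\<close>
  define z where "z c = (s * c * k) *\<^sub>R z0 + (s * e) *\<^sub>R (\<i> * z0)" for c
  have z1: "cmod (z c) = 1" if "c\<^sup>2 = 1" for c
  proof -
    have "z c = z0 * Complex (s * c * k) (s * e)"
      by (simp add: z_def complex_eq_iff algebra_simps)
    then have "(cmod (z c))\<^sup>2 = (s * c * k)\<^sup>2 + (s * e)\<^sup>2"
      by (simp add: norm_mult z0 cmod_power2)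
    also have "\<dots> = s\<^sup>2 * (1 + k\<^sup>2)"
      using that me(2) by (simp add: power_mult_distrib algebra_simps)
    finally show ?thesis
      using s(3) by (simp add: abs_square_eq_1)
  qed
  have zm: "Im (z c + a\<^sup>2 * cnj (z c)) > - 2 * Im a" if c: "\<bar>c\<bar> = 1" for c
  proof -
    have "m (z c) = s * (c * (k * m z0)) + s * (e * m (\<i> * z0))"
      unfolding z_def m_lin by (simp add: mult_ac)
    moreover have "s * (e * m (\<i> * z0)) \<ge> 0"
      using s me by simp
    moreover have "\<bar>s * (c * (k * m z0))\<bar> \<le> Im a"
    proof -
      have "\<bar>s * (c * (k * m z0))\<bar> = s * (k * \<bar>m z0\<bar>)"
        using c s k by (simp add: abs_mult)
      also have "\<dots> \<le> 1 * Im a"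
        using s km k by (intro mult_mono) auto
      finally show ?thesis by simp
    qed
    ultimately have "m (z c) \<ge> - Im a"
      by linarith
    then show ?thesis
      using a by (simp add: m_def)
  qed
  have D: "cmod (z 1 - z (-1)) > 0"
  proof -
    have "z 1 - z (-1) = (2 * s * k) *\<^sub>R z0"
      by (simp add: z_def scaleR_conv_of_real algebra_simps)
    then show ?thesis
      using s k z0 by auto
  qed
  obtain r where r: "0 \<le> r" "r < 1" and far: "disc_dist (of_real r * z 1) (of_real r * z (-1)) > pi / 2"
    using disc_dist_unbounded [OF D z1 z1, of "pi / 2"] by auto
  have re: "qre (G (z c)) = s * e * qre (G (\<i> * z0))" for c
    unfolding z_def by (simp add: linear_add [OF linG] linear_cmul [OF linG] z0)
  \<comment> \<open>Their images have the same real part, because \<open>G z0\<close> is imaginary, and the same norm.\<close>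
  have same: "meridian (r *\<^sub>R G (z 1)) = meridian (r *\<^sub>R G (z (-1)))"
  proof -
    have "(norm (qvec (G (z c))))\<^sup>2 = 1 - (s * e * qre (G (\<i> * z0)))\<^sup>2" if "c\<^sup>2 = 1" for c
      using norm_sq_qvec [of "G (z c)"] nG [OF z1 [OF that]] re [of c] by simp
    from this [of 1] this [of "-1"]
    have "(norm (qvec (G (z 1))))\<^sup>2 = (norm (qvec (G (z (-1)))))\<^sup>2"
      by simp
    then have "norm (qvec (G (z 1))) = norm (qvec (G (z (-1))))"
      by (rule power2_eq_imp_eq) (rule norm_ge_zero)+
    then show ?thesis
      using re [of 1] re [of "-1"] by (simp add: meridian_def qvec_scaleR)
  qed
  define p where "p c = slice_embed I (disc_moebius a (of_real r * z c))" for c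
  have rz: "cmod (of_real r * z c) < 1" if "\<bar>c\<bar> = 1" for c
    using z1 [of c] r that by (simp add: norm_mult abs_square_eq_1)
  have pB: "p c \<in> \<bool>" if "\<bar>c\<bar> = 1" for c
    using disc_moebius_in_disc [OF a(1) rz [OF that]] by (simp add: p_def quat_ball_def slice_embed_sel [OF I])
  have hp: "h (p c) = r *\<^sub>R G (z c)" if "\<bar>c\<bar> = 1" for c
    unfolding p_def using z1 [of c] that by (intro ray zm r) (simp_all add: abs_square_eq_1)
  have mp: "meridian (p c) = disc_moebius a (of_real r * z c)" if "\<bar>c\<bar> = 1" for c
    using disc_moebius_Im_pos [OF a z1 zm [OF that] r] that
    by (simp add: p_def meridian_slice_embed [OF I] abs_square_eq_1)
  have "ennreal (disc_dist (of_real r * z 1) (of_real r * z (-1))) = ennreal (disc_dist (meridian (p 1)) (meridian (p (-1))))"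
    using rz [of 1] rz [of "-1"] by (simp add: mp disc_dist_moebius [OF a(1)])
  also have "\<dots> \<le> ball_dist (p 1) (p (-1))"
    by (rule meridian_le_riem_dist)
  also have "\<dots> = ball_dist (h (p 1)) (h (p (-1)))"
    by (intro riem_isometry_riem_dist [OF open_quat_ball h, symmetric] pB) auto
  also have "\<dots> \<le> ennreal (pi / 2)"
    using H(6) [OF pB [of 1]] same by (intro riem_dist_same_meridian) (simp_all add: hp)
  finally show False
    using far by (simp add: ennreal_le_iff)
qed

section \<open>The Moebius maps\<close>

lemma fps_geometric_inverse:
  fixes l :: "'a::division_ring"
  shows "inverse (1 - fps_X * fps_const l) = Abs_fps (\<lambda>n. l ^ n)"
proof (rule fps_inverse_unique, rule fps_ext)
  fix n
  show "fps_nth ((1 - fps_X * fps_const l) * Abs_fps (\<lambda>n. l ^ n)) n = fps_nth (1 :: 'a fps) n"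
    by (cases n) (simp_all add: left_diff_distrib mult.assoc)
qed

lemma quat_moebius_eq:
  assumes l: "-1 < l" "l < 1" and q: "q \<in> \<bool>"
  shows "quat_moebius l q = (q - of_real l) / (1 - of_real l * q)"
proof -
  define f :: "quat fps" where
    "f = inverse (1 - fps_X * fps_const (of_real l)) * (fps_X - fps_const (of_real l))"
  have f0: "fps_nth f 0 = - of_real l"
    by (simp add: f_def fps_geometric_inverse)
  have f: "fps_nth f (Suc n) = of_real (l ^ n * (1 - l\<^sup>2))" for n
    by (simp add: f_def fps_geometric_inverse right_diff_distrib power2_eq_square power_commutes mult.assoc)
      (simp add: mult_ac flip: of_real_mult of_real_power)
  have "norm (l *\<^sub>R q) < 1"
  proof -
    have "\<bar>l\<bar> * norm q \<le> \<bar>l\<bar> * 1"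
      using q by (intro mult_left_mono) (auto simp: quat_ball_def)
    then show ?thesis
      using l by simp
  qed
  then have s: "summable (\<lambda>n. (l *\<^sub>R q) ^ n)"
    by (intro summable_norm_cancel [of "\<lambda>n. (l *\<^sub>R q) ^ n"]) (simp only: norm_power summable_geometric_iff, simp)
  define h where "h = (\<Sum>n. (l *\<^sub>R q) ^ n)"
  have "h = 1 + (\<Sum>n. (l *\<^sub>R q) ^ Suc n)"
    unfolding h_def by (subst suminf_split_head [OF s]) simp
  also have "(\<Sum>n. (l *\<^sub>R q) ^ Suc n) = (l *\<^sub>R q) * h"
    unfolding h_def by (simp only: power_Suc suminf_mult [OF s])
  finally have hq: "l *\<^sub>R (q * h) = h - 1"
    by (simp add: algebra_simps)
  have "(\<lambda>n. (1 - l\<^sup>2) *\<^sub>R (q * (l *\<^sub>R q) ^ n)) sums ((1 - l\<^sup>2) *\<^sub>R (q * h))"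
    unfolding h_def by (intro sums_scaleR_right sums_mult summable_sums s)
  moreover have "(1 - l\<^sup>2) *\<^sub>R (q * (l *\<^sub>R q) ^ n) = q ^ Suc n * fps_nth f (Suc n)" for n
    unfolding f times_of_real_quat by (simp add: scaleR_power mult.commute)
  ultimately have "(\<lambda>n. q ^ Suc n * fps_nth f (Suc n)) sums ((1 - l\<^sup>2) *\<^sub>R (q * h))"
    by simp
  then have "(\<lambda>n. q ^ n * fps_nth f n) sums ((1 - l\<^sup>2) *\<^sub>R (q * h) + q ^ 0 * fps_nth f 0)"
    by (rule sums_Suc)
  then have "series_at f q = (1 - l\<^sup>2) *\<^sub>R (q * h) - of_real l"
    by (simp add: series_at_def sums_iff f0)
  also have "\<dots> = q * h - l *\<^sub>R (l *\<^sub>R (q * h)) - l *\<^sub>R 1"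
    by (simp add: scaleR_left_diff_distrib power2_eq_square of_real_def)
  also have "\<dots> = (q - of_real l) * h"
    unfolding hq by (simp add: left_diff_distrib scaleR_diff_right times_of_real_quat)
  also have "h = inverse (1 - of_real l * q)"
  proof -
    have "(1 - of_real l * q) * h = 1"
      using hq by (simp add: left_diff_distrib times_of_real_quat)
    then show ?thesis
      by (metis inverse_unique)
  qed
  finally show ?thesis
    by (simp add: quat_moebius_def f_def divide_quat_def)
qed

lemma slice_embed_inverse:
  assumes I: "I \<in> \<S>" and z: "z \<noteq> 0"
  shows "slice_embed I (inverse z) = inverse (slice_embed I z)"
proof -
  have "slice_embed I z * slice_embed I (inverse z) = 1"
    using z by (simp flip: slice_embed_mult [OF I] add: slice_embed_1)
  then show ?thesis
    by (metis inverse_unique)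
qed

text \<open>
  A vector orthogonal to the slice anticommutes with its imaginary unit.  Moving one factor across \<open>d\<close>
  therefore conjugates it.
\<close>

lemma slice_sandwich_perp:
  assumes I: "I \<in> \<S>" and d: "qre d = 0" "d \<bullet> I = 0"
  shows "slice_embed I z * d * slice_embed I z = (cmod z)\<^sup>2 *\<^sub>R d"
proof -
  have I0: "qre I = 0"
    using I by (simp add: imag_units_iff)
  have II: "I * I = - 1"
    using I by (simp add: imag_units_def power2_eq_square)
  have anti: "I * d = - (d * I)"
  proof -
    have "qim1 d * qim1 I + qim2 d * qim2 I + qim3 d * qim3 I = 0"
      using d I0 by (simp add: inner_quat_def)
    then have "qre (I * d) = 0" "qre (d * I) = 0"
      using d(1) I0 by (simp_all add: quat_sel_times) algebra+
    then show ?thesis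
      using d(1) I0 by (simp add: quat_eq_iff quat_sel_times)
  qed
  have "d * I * I = - d"
    using II by (simp add: mult.assoc)
  then show ?thesis
    unfolding cmod_power2
    by (simp add: slice_embed_def of_real_def distrib_left distrib_right left_diff_distrib
        scaleR_left_distrib scaleR_right_distrib scaleR_diff_right power2_eq_square
        mult.commute [of "Im z" "Re z"] anti)
qed

lemma quat_moebius_slice:
  assumes l: "-1 < l" "l < 1" and I: "I \<in> \<S>" and z: "cmod z < 1"
  shows "quat_moebius l (slice_embed I z) = slice_embed I (disc_moebius (- of_real l) z)"
proof -
  have "1 - of_real l * z \<noteq> 0"
    using disc_moebius_denom [of "- of_real l" z] l z by simp
  moreover have "slice_embed I z \<in> \<bool>"
    using z by (simp add: quat_ball_def slice_embed_sel [OF I])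
  ultimately show ?thesis
    using quat_moebius_eq [OF l, of "slice_embed I z"]
    by (simp add: disc_moebius_def divide_quat_def divide_inverse slice_embed_mult [OF I] slice_embed_inverse [OF I]
        slice_embed_diff slice_embed_1 slice_embed_of_real)
qed

lemma quat_moebius_in_ball:
  assumes l: "-1 < l" "l < 1" and q: "q \<in> \<bool>"
  shows "quat_moebius l q \<in> \<bool>" "quat_moebius l (quat_moebius (- l) q) = q"
proof -
  obtain I z where I: "I \<in> \<S>" and q': "q = slice_embed I z"
    by (rule slice_embed_ex)
  have z: "cmod z < 1"
    using q by (simp add: q' quat_ball_def slice_embed_sel [OF I])
  have L: "cmod (- of_real l) < 1" "cmod (of_real l) < 1"
    using l by simp_all
  show "quat_moebius l q \<in> \<bool>"
    unfolding q' quat_moebius_slice [OF l I z]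
    using disc_moebius_in_disc [OF L(1) z] by (simp add: quat_ball_def slice_embed_sel [OF I])
  define w where "w = disc_moebius (of_real l) z"
  have w: "cmod w < 1"
    unfolding w_def by (rule disc_moebius_in_disc [OF L(2) z])
  have n: "1 + of_real l * z \<noteq> 0"
    using disc_moebius_denom [OF L(2) z] by simp
  have "disc_moebius (- of_real l) w = z"
  proof -
    define D where "D = 1 + of_real l * z"
    have l1: "1 - (of_real l)\<^sup>2 \<noteq> (0::complex)"
    proof -
      have "1 - l\<^sup>2 \<noteq> 0"
        using l by (metis abs_square_less_1 diff_gt_0_iff_gt less_irrefl abs_less_iff minus_less_iff)
      then have "complex_of_real (1 - l\<^sup>2) \<noteq> 0"
        by (simp only: of_real_eq_0_iff not_False_eq_True)
      then show ?thesis by simp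
    qed
    have "w - of_real l = (1 - (of_real l)\<^sup>2) * z / D"
      using n by (simp add: w_def disc_moebius_def D_def field_simps power2_eq_square)
    moreover have "1 - of_real l * w = (1 - (of_real l)\<^sup>2) / D"
      using n by (simp add: w_def disc_moebius_def D_def field_simps power2_eq_square)
    ultimately show ?thesis
      using n l1 by (simp add: disc_moebius_def D_def)
  qed
  moreover have "quat_moebius (- l) q = slice_embed I w"
    unfolding q' using quat_moebius_slice [of "- l" I z] l I z by (simp add: w_def)
  ultimately show "quat_moebius l (quat_moebius (- l) q) = q"
    unfolding q' by (simp add: quat_moebius_slice [OF l I w])
qed

lemma bounded_linear_qcnj: "bounded_linear qcnj"
proof -
  have "qcnj = (\<lambda>q. (2 * qre q) *\<^sub>R 1 - q)"
    by (simp add: fun_eq_iff quat_eq_iff)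
  moreover have "bounded_linear (\<lambda>q. (2 * qre q) *\<^sub>R 1 - q)"
    by (intro bounded_linear_sub bounded_linear_ident
        bounded_linear_compose [OF bounded_linear_scaleR_left]
        bounded_linear_compose [OF bounded_linear_mult_right bounded_linear_qre])
  ultimately show ?thesis by simp
qed

lemma quat_moebius_denom:
  assumes l: "-1 < l" "l < 1" and q: "q \<in> \<bool>"
  shows "1 - l *\<^sub>R q \<noteq> 0"
proof
  assume "1 - l *\<^sub>R q = 0"
  then have "norm (l *\<^sub>R q) = 1"
    by simp
  moreover have "\<bar>l\<bar> * norm q \<le> \<bar>l\<bar> * 1"
    using q by (intro mult_left_mono) (auto simp: quat_ball_def)
  ultimately show False
    using l by simp
qed

lemma Ck_on_quat_moebius:
  assumes l: "-1 < l" "l < 1"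
  shows "Ck_on k \<bool> (quat_moebius l)"
proof -
  note o = open_quat_ball
  have aff: "Ck_on k \<bool> (\<lambda>q. c + L q)" if "bounded_linear L" for c and L :: "quat \<Rightarrow> quat"
    by (intro Ck_on_add o Ck_on_const Ck_on_linear that)
  have D: "Ck_on k \<bool> (\<lambda>q. 1 - l *\<^sub>R q)"
    using aff [OF bounded_linear_minus [OF bounded_linear_scaleR_right], of 1 l] by simp
  have cD: "Ck_on k \<bool> (\<lambda>q. qcnj (1 - l *\<^sub>R q))"
    by (rule Ck_on_compose [OF o open_UNIV _ Ck_on_linear [OF open_UNIV bounded_linear_qcnj] D]) simp
  have N: "Ck_on k \<bool> (\<lambda>q. q - of_real l)"
    using aff [of "\<lambda>q. q" "- of_real l"] by (simp add: bounded_linear_ident)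
  have "Ck_on k \<bool> (\<lambda>q. inverse ((1 - l *\<^sub>R q) \<bullet> (1 - l *\<^sub>R q)))"
    using quat_moebius_denom [OF l]
    by (intro Ck_on_inverse o Ck_on_bilinear [OF o bounded_bilinear_inner] D) auto
  then have "Ck_on k \<bool> (\<lambda>q. (q - of_real l) * (inverse ((1 - l *\<^sub>R q) \<bullet> (1 - l *\<^sub>R q)) *\<^sub>R qcnj (1 - l *\<^sub>R q)))"
    by (intro Ck_on_bilinear [OF o bounded_bilinear_mult] Ck_on_bilinear [OF o bounded_bilinear_scaleR] N cD)
  then show ?thesis
    by (rule Ck_on_cong [OF o, rotated])
      (use l in \<open>simp add: quat_moebius_eq divide_quat_def inverse_quat_def power2_norm_eq_inner times_of_real_quat\<close>)
qed

text \<open>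
  The two factors do not commute with \<open>d\<close>, but they can be gathered on both sides of it, since
  \<open>l (w - l) + (1 - l w) = 1 - l\<^sup>2\<close>.
\<close>

lemma quat_moebius_has_derivative:
  assumes l: "-1 < l" "l < 1" and w: "w \<in> \<bool>"
  defines "a \<equiv> inverse (1 - l *\<^sub>R w)"
  shows "(quat_moebius l has_derivative (\<lambda>d. (1 - l\<^sup>2) *\<^sub>R (a * d * a))) (at w)"
proof -
  note n = quat_moebius_denom [OF l w]
  have "((\<lambda>q. (q - of_real l) * inverse (1 - l *\<^sub>R q)) has_derivative
      (\<lambda>d. (w - of_real l) * - (a * (- (l *\<^sub>R d)) * a) + d * a)) (at w)"
    unfolding a_def using n
    by (auto intro!: derivative_eq_intros)
  moreover have "(w - of_real l) * - (a * (- (l *\<^sub>R d)) * a) + d * a = (1 - l\<^sup>2) *\<^sub>R (a * d * a)" for d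
  proof -
    have "(l *\<^sub>R (w - of_real l) + (1 - l *\<^sub>R w)) * a = (1 - l\<^sup>2) *\<^sub>R a"
      by (simp add: algebra_simps of_real_def power2_eq_square)
    then have "l *\<^sub>R ((w - of_real l) * a) + 1 = (1 - l\<^sup>2) *\<^sub>R a"
      using n by (simp add: distrib_right a_def)
    then have "(l *\<^sub>R ((w - of_real l) * a) + 1) * (d * a) = (1 - l\<^sup>2) *\<^sub>R (a * d * a)"
      by (simp add: mult.assoc)
    then show ?thesis
      by (simp add: distrib_right mult.assoc)
  qed
  ultimately have "((\<lambda>q. (q - of_real l) * inverse (1 - l *\<^sub>R q)) has_derivative
      (\<lambda>d. (1 - l\<^sup>2) *\<^sub>R (a * d * a))) (at w)"
    by simp
  then show ?thesis
    by (rule has_derivative_transform_within_open [OF _ open_quat_ball w])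
      (use l in \<open>simp add: quat_moebius_eq divide_quat_def times_of_real_quat\<close>)
qed

text \<open>
  The derivative scales the slice and its orthogonal complement by the same factor
  \<open>r = (1 - l\<^sup>2) / |1 - l w|\<^sup>2\<close> up to a rotation of the slice, and \<open>1 - |w|\<^sup>2\<close> and \<open>|1 - w\<^sup>2|\<close> are
  multiplied by \<open>r\<close> as well.
\<close>

lemma quat_moebius_preserves_metric:
  assumes l: "-1 < l" "l < 1" and w: "w \<in> \<bool>"
  defines "a \<equiv> inverse (1 - l *\<^sub>R w)"
  shows "hardy_metric (quat_moebius l w) ((1 - l\<^sup>2) *\<^sub>R (a * d * a)) = hardy_metric w d"
proof -
  obtain I z where I: "I \<in> \<S>" and w': "w = slice_embed I z"
    by (rule slice_embed_ex)
  have z: "cmod z < 1"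
    using w by (simp add: w' quat_ball_def slice_embed_sel [OF I])
  obtain \<zeta> d2 where d: "d = slice_embed I \<zeta> + d2" "d2 \<in> (slice I)\<^sup>\<bottom>" "qre d2 = 0" "d2 \<bullet> I = 0"
    by (rule slice_perp_decomposition [OF I])
  define D where "D = 1 - of_real l * z"
  have L: "cmod (- of_real l) < 1"
    using l by simp
  have D: "D \<noteq> 0"
    using disc_moebius_denom [OF L z] by (simp add: D_def)
  have l1: "1 - l\<^sup>2 > 0"
    using l by (simp add: abs_square_less_1)
  define r where "r = (1 - l\<^sup>2) / (cmod D)\<^sup>2"
  have r: "r > 0"
    using l1 D by (simp add: r_def)
  have "slice_embed I D = 1 - l *\<^sub>R w"
    by (simp add: w' D_def slice_embed_diff slice_embed_1 slice_embed_mult [OF I] slice_embed_of_real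
        times_of_real_quat)
  then have a: "a = slice_embed I (inverse D)"
    by (simp add: a_def slice_embed_inverse [OF I D])
  define \<zeta>' where "\<zeta>' = of_real (1 - l\<^sup>2) * (inverse D * \<zeta> * inverse D)"
  have e1: "(1 - l\<^sup>2) *\<^sub>R (a * slice_embed I \<zeta> * a) = slice_embed I \<zeta>'"
    unfolding \<zeta>'_def slice_embed_mult [OF I] slice_embed_of_real times_of_real_quat by (simp add: a)
  have e2: "(1 - l\<^sup>2) *\<^sub>R (a * d2 * a) = r *\<^sub>R d2"
    unfolding a slice_sandwich_perp [OF I d(3,4)] by (simp add: r_def norm_inverse power_inverse divide_inverse)
  have "(1 - l\<^sup>2) *\<^sub>R (a * d * a) = slice_embed I \<zeta>' + r *\<^sub>R d2"
    unfolding d(1) e1 [symmetric] e2 [symmetric] by (simp add: algebra_simps)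
  moreover have "r *\<^sub>R d2 \<in> (slice I)\<^sup>\<bottom>"
    using d(2) by (simp add: orthogonal_comp_def orthogonal_def)
  ultimately have "hardy_metric (quat_moebius l w) ((1 - l\<^sup>2) *\<^sub>R (a * d * a)) =
      (cmod \<zeta>' / (1 - (cmod (disc_moebius (- of_real l) z))\<^sup>2))\<^sup>2
      + (norm (r *\<^sub>R d2) / cmod (1 - (disc_moebius (- of_real l) z)\<^sup>2))\<^sup>2"
    unfolding w' quat_moebius_slice [OF l I z]
    by (simp add: hardy_metric_slice [OF I disc_moebius_in_disc [OF L z]])
  moreover have "cmod \<zeta>' = r * cmod \<zeta>"
    using l1 unfolding \<zeta>'_def norm_mult norm_of_real by (simp add: r_def norm_inverse power2_eq_square divide_inverse)
  moreover have "1 - (cmod (disc_moebius (- of_real l) z))\<^sup>2 = r * (1 - (cmod z)\<^sup>2)"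
    unfolding disc_moebius_one_minus [OF L z] by (simp add: r_def D_def)
  moreover have "cmod (1 - (disc_moebius (- of_real l) z)\<^sup>2) = r * cmod (1 - z\<^sup>2)"
  proof -
    have e: "disc_moebius (- of_real l) z = (z - of_real l) / D"
      by (simp add: disc_moebius_def D_def)
    have "1 - (disc_moebius (- of_real l) z)\<^sup>2 = (D\<^sup>2 - (z - of_real l)\<^sup>2) / D\<^sup>2"
      unfolding e power_divide using D by (simp add: diff_divide_distrib)
    also have "D\<^sup>2 - (z - of_real l)\<^sup>2 = of_real (1 - l\<^sup>2) * (1 - z\<^sup>2)"
      by (simp add: D_def power2_eq_square algebra_simps)
    finally show ?thesis
      using l1 by (simp only: norm_divide norm_mult norm_of_real norm_power) (simp add: r_def)
  qed
  ultimately have "hardy_metric (quat_moebius l w) ((1 - l\<^sup>2) *\<^sub>R (a * d * a)) =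
      (cmod \<zeta> / (1 - (cmod z)\<^sup>2))\<^sup>2 + (norm d2 / cmod (1 - z\<^sup>2))\<^sup>2"
    using r by simp
  then show ?thesis
    unfolding w' d(1) by (simp add: hardy_metric_slice [OF I z d(2)])
qed

lemma quat_moebius_isometry:
  assumes l: "-1 < l" "l < 1"
  shows "restrict (quat_moebius l) \<bool> \<in> ball_isometries"
proof (rule riem_isometryI [OF open_quat_ball _ Ck_on_quat_moebius [OF l]])
  have l': "-1 < - l" "- l < 1"
    using l by auto
  show "bij_betw (quat_moebius l) \<bool> \<bool>"
    using quat_moebius_in_ball [OF l] quat_moebius_in_ball [OF l']
    by (intro bij_betw_byWitness [where f' = "quat_moebius (- l)"]) auto
  show "Ck_on k \<bool> (quat_moebius (- l))" for k
    by (rule Ck_on_quat_moebius [OF l'])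
  show "quat_moebius (- l) w \<in> \<bool>" if "w \<in> \<bool>" for w
    by (rule quat_moebius_in_ball(1) [OF l' that])
  show "quat_moebius l (quat_moebius (- l) w) = w" if "w \<in> \<bool>" for w
    by (rule quat_moebius_in_ball(2) [OF l that])
qed (fact quat_moebius_has_derivative [OF l] quat_moebius_preserves_metric [OF l])+

section \<open>Linear isometries, and the group that the generators span\<close>

text \<open>
  The metric in the form \<open>polar_form_diag\<close> depends on inner products and on the squares of real parts only.
\<close>

lemma linear_isometryI:
  assumes U: "orthogonal_transformation U" and V: "linear V" "\<And>w. U (V w) = w" "\<And>w. V (U w) = w"
    and re: "\<And>w. (qre (U w))\<^sup>2 = (qre w)\<^sup>2" "\<And>w. qvec (U w) = U (qvec w)"
  shows "restrict U \<bool> \<in> ball_isometries"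
proof -
  have lin: "linear U" and iU: "U x \<bullet> U y = x \<bullet> y" for x y
    using U by (simp_all add: orthogonal_transformation_def)
  have nU: "norm (U x) = norm x" for x
    by (simp add: norm_eq_sqrt_inner iU)
  have nV: "norm (V x) = norm x" for x
    using nU [of "V x"] V(2) by simp
  have UB: "U w \<in> \<bool> \<longleftrightarrow> w \<in> \<bool>" "V w \<in> \<bool> \<longleftrightarrow> w \<in> \<bool>" for w
    by (simp_all add: quat_ball_def nU nV)
  show ?thesis
  proof (rule riem_isometryI [OF open_quat_ball])
    show "bij_betw U \<bool> \<bool>"
      by (intro bij_betw_byWitness [where f' = V]) (auto simp: UB V)
    show "Ck_on k \<bool> U" "Ck_on k \<bool> V" for k
      using lin V(1) by (auto intro!: Ck_on_linear simp: linear_conv_bounded_linear)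
    show "(U has_derivative U) (at w)" for w
      by (rule linear_imp_has_derivative [OF lin])
    show "hardy_metric (U w) (U d) = hardy_metric w d" if "w \<in> \<bool>" for w d
      using that by (simp add: hardy_metric_polar_form UB polar_form_diag nU iU re)
  qed (auto simp: UB V)
qed

lemma reflection_isometry: "restrict reflection \<bool> \<in> ball_isometries"
proof (rule linear_isometryI)
  show lin: "linear reflection"
    unfolding reflection_def [abs_def]
    by (intro bounded_linear.linear bounded_linear_minus bounded_linear_qcnj)
  then show "orthogonal_transformation reflection"
    by (simp add: orthogonal_transformation_def reflection_def inner_quat_def)
qed (simp_all add: reflection_def quat_eq_iff)

lemma sphere_isometry_inner:
  assumes "sphere_isometry A" "I \<in> \<S>" "J \<in> \<S>"
  shows "A I \<bullet> A J = I \<bullet> J"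
proof -
  have b: "\<bar>I \<bullet> J\<bar> \<le> 1" if "I \<in> \<S>" "J \<in> \<S>" for I J
    using Cauchy_Schwarz_ineq2 [of I J] that by (simp add: imag_units_iff)
  have "A I \<in> \<S>" "A J \<in> \<S>"
    using assms by (auto simp: sphere_isometry_def dest: bij_betwE)
  then have "\<bar>A I \<bullet> A J\<bar> \<le> 1" "\<bar>I \<bullet> J\<bar> \<le> 1"
    using b assms by auto
  moreover have "arccos (A I \<bullet> A J) = arccos (I \<bullet> J)"
    using assms by (simp add: sphere_isometry_def sphere_dist_def)
  ultimately show ?thesis
    by (metis cos_arccos_abs)
qed

text \<open>
  \<open>A\<close> preserves inner products, so it is determined by its values on the three standard
  imaginary units, and these extend it linearly.
\<close>

lemma sphere_isometry_linear:
  assumes A: "sphere_isometry A"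
  obtains U where "orthogonal_transformation U" "U 1 = 1" "\<And>I. I \<in> \<S> \<Longrightarrow> U I = A I" "\<And>q. sphere_map A q = U q"
proof -
  define i j k where "i = Quat 0 1 0 0" "j = Quat 0 0 1 0" "k = Quat 0 0 0 1"
  note ijk = this
  have S: "i \<in> \<S>" "j \<in> \<S>" "k \<in> \<S>"
    by (simp_all add: ijk imag_units_iff norm_quat_def inner_quat_def)
  have AS: "A I \<in> \<S>" if "I \<in> \<S>" for I
    using A that by (auto simp: sphere_isometry_def dest: bij_betwE)
  note inn = sphere_isometry_inner [OF A]
  have orth: "A i \<bullet> A i = 1" "A j \<bullet> A j = 1" "A k \<bullet> A k = 1" "A i \<bullet> A j = 0" "A j \<bullet> A i = 0"
    "A i \<bullet> A k = 0" "A k \<bullet> A i = 0" "A j \<bullet> A k = 0" "A k \<bullet> A j = 0"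
    by (simp_all add: inn S) (simp_all add: ijk inner_quat_def)
  have one: "(1::quat) \<bullet> x = qre x" "x \<bullet> (1::quat) = qre x" for x
    by (simp_all add: inner_quat_def)
  have reA: "qre (A i) = 0" "qre (A j) = 0" "qre (A k) = 0"
    using AS S by (simp_all add: imag_units_iff)
  define U where "U q = qre q *\<^sub>R 1 + (qim1 q *\<^sub>R A i + (qim2 q *\<^sub>R A j + qim3 q *\<^sub>R A k))" for q
  have "linear U"
    by (rule linearI) (simp_all add: U_def algebra_simps)
  moreover have "U p \<bullet> U q = p \<bullet> q" for p q
    by (simp add: U_def inner_add_left inner_add_right orth one reA) (simp add: inner_quat_def)
  ultimately have U: "orthogonal_transformation U"
    by (simp add: orthogonal_transformation_def)
  have U1: "U 1 = 1"
    by (simp add: U_def)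
  have UI: "U I = A I" if I: "I \<in> \<S>" for I
  proof -
    have I1: "qre I = 0" "(qim1 I)\<^sup>2 + (qim2 I)\<^sup>2 + (qim3 I)\<^sup>2 = 1"
      using I norm_quat_sq [of I] by (simp_all add: imag_units_iff)
    have c: "A I \<bullet> A i = qim1 I" "A I \<bullet> A j = qim2 I" "A I \<bullet> A k = qim3 I" "A I \<bullet> A I = 1"
      using I1(2) by (simp_all add: inn S I) (simp_all add: ijk inner_quat_def I1(1) power2_eq_square)
    have "U I \<bullet> U I = 1" "A I \<bullet> U I = 1"
      using U I1 c by (simp_all add: orthogonal_transformation_def)
        (simp_all add: inner_quat_def [of I I] U_def inner_add_right power2_eq_square)
    then have "(U I - A I) \<bullet> (U I - A I) = 0"
      by (simp add: inner_diff_left inner_diff_right c inner_commute [of "U I" "A I"])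
    then show ?thesis by simp
  qed
  have "sphere_map A q = U q" for q
  proof -
    obtain x y I where q: "0 \<le> y" "I \<in> \<S>" "q = of_real x + of_real y * I"
      by (rule quat_polar_ex)
    have "q = x *\<^sub>R 1 + y *\<^sub>R I"
      using q by (simp add: times_of_real_quat of_real_def)
    then have "U q = x *\<^sub>R 1 + y *\<^sub>R A I"
      using \<open>linear U\<close> U1 UI [OF q(2)] by (simp add: linear_add linear_cmul)
    then show ?thesis
      unfolding q(3) sphere_map_eq [OF q(1,2)] by (simp add: times_of_real_quat of_real_def)
  qed
  then show ?thesis
    using that U U1 UI by blast
qed

lemma sphere_map_isometry:
  assumes A: "sphere_isometry A"
  shows "restrict (sphere_map A) \<bool> \<in> ball_isometries"
proof -
  obtain U where U: "orthogonal_transformation U" "U 1 = 1" and eq: "\<And>q. sphere_map A q = U q"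
    by (rule sphere_isometry_linear [OF A]) (rule that)
  have lin: "linear U" and iU: "U x \<bullet> U y = x \<bullet> y" for x y
    using U by (simp_all add: orthogonal_transformation_def)
  have re: "qre (U w) = qre w" for w
  proof -
    have "qre (U w) = U w \<bullet> U 1"
      by (simp add: U(2)) (simp add: inner_quat_def)
    also have "\<dots> = qre w"
      unfolding iU by (simp add: inner_quat_def)
    finally show ?thesis .
  qed
  have "qvec (U w) = U (qvec w)" for w
    by (simp add: qvec_def re linear_diff [OF lin] of_real_def linear_cmul [OF lin] U(2))
  then have "restrict U \<bool> \<in> ball_isometries"
  proof (intro linear_isometryI [where V = "inv_into UNIV U"])
    show "linear (inv_into UNIV U)"
      using orthogonal_transformation_inv [OF U(1)] by (simp add: orthogonal_transformation_def)
    show "U (inv_into UNIV U w) = w" "inv_into UNIV U (U w) = w" for w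
      using orthogonal_transformation_surj [OF U(1)] orthogonal_transformation_inj [OF U(1)]
      by (simp_all add: surj_f_inv_f)
  qed (use U re in auto)
  moreover have "sphere_map A = U"
    using eq by auto
  ultimately show ?thesis by simp
qed

lemma generators_isometries: "generators \<subseteq> ball_isometries"
  using quat_moebius_isometry sphere_map_isometry reflection_isometry by (auto simp: generators_def)

text \<open>
  Compose \<open>f\<close> with the Moebius map that moves the real point \<open>f 0\<close> to \<open>0\<close>.
\<close>

lemma isometry_in_generate:
  assumes f: "f \<in> ball_isometries"
  shows "f \<in> generate (BijGroup \<bool>) generators"
proof -
  interpret group "BijGroup \<bool>"
    by (rule group_BijGroup)
  interpret sub: subgroup "ball_isometries" "BijGroup \<bool>"
    by (rule subgroup_riem_isometries [OF open_quat_ball])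
  have carr: "g \<in> Bij \<bool>" if "g \<in> ball_isometries" for g
    using that by (rule riem_isometriesD)
  have mult: "(g \<otimes>\<^bsub>BijGroup \<bool>\<^esub> h) w = g (h w)"
    if "g \<in> ball_isometries" "h \<in> ball_isometries" "w \<in> \<bool>" for g h w
    using that carr by (simp add: BijGroup_def compose_def)
  have B0: "0 \<in> \<bool>"
    by (simp add: quat_ball_def)
  have f0: "f 0 \<in> \<bool>"
    by (rule riem_isometriesD(6) [OF f B0])
  have "(inv\<^bsub>BijGroup \<bool>\<^esub> f) (f 0) = 0"
    using riem_isometriesD(2) [OF f] B0 f0 by (simp add: inv_BijGroup carr f bij_betw_def)
  with isometry_preimage_0_real [OF sub.m_inv_closed [OF f] f0] have "qvec (f 0) = 0"
    by simp
  then have f0': "f 0 = of_real (qre (f 0))"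
    by (simp add: qvec_def)
  define l where "l = qre (f 0)"
  have l: "-1 < l" "l < 1"
  proof -
    have "norm (f 0) < 1"
      using f0 by (simp add: quat_ball_def)
    then have "\<bar>l\<bar> < 1"
      by (subst (asm) f0') (simp add: l_def)
    then show "-1 < l" "l < 1" by auto
  qed
  define M where "M = restrict (quat_moebius l) \<bool>"
  have M: "M \<in> generators" "M \<in> ball_isometries"
    using l quat_moebius_isometry [OF l] by (auto simp: M_def generators_def)
  define k where "k = M \<otimes>\<^bsub>BijGroup \<bool>\<^esub> f"
  have k: "k \<in> ball_isometries"
    unfolding k_def by (rule sub.m_closed [OF M(2) f])
  have "k 0 = M (f 0)"
    unfolding k_def by (rule mult [OF M(2) f B0])
  also have "\<dots> = quat_moebius l (f 0)"
    using f0 by (simp add: M_def)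
  also have "\<dots> = 0"
    unfolding quat_moebius_eq [OF l f0] using f0' by (simp add: l_def)
  finally have k0: "k 0 = 0" .
  have ext: "k = restrict g \<bool>" if "\<And>w. w \<in> \<bool> \<Longrightarrow> k w = g w" for g
    using that carr [OF k] by (intro extensionalityI [of _ \<bool>]) (auto simp: Bij_def)
  obtain A where A: "sphere_isometry A"
    "(\<forall>w\<in>\<bool>. k w = sphere_map A w) \<or> (\<forall>w\<in>\<bool>. k w = reflection (sphere_map A w))"
    by (rule isometry_fixing_0 [OF k k0])
  define T where "T = restrict (sphere_map A) \<bool>"
  define R where "R = restrict reflection \<bool>"
  have T: "T \<in> generators" "T \<in> ball_isometries"
    using A sphere_map_isometry by (auto simp: T_def generators_def)
  have R: "R \<in> generators" "R \<in> ball_isometries"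
    using reflection_isometry by (auto simp: R_def generators_def)
  have kg: "k \<in> generate (BijGroup \<bool>) generators"
    using A(2)
  proof
    assume "\<forall>w\<in>\<bool>. k w = sphere_map A w"
    then have "k = T"
      unfolding T_def by (intro ext) auto
    then show ?thesis
      using T(1) by (simp add: generate.incl)
  next
    assume *: "\<forall>w\<in>\<bool>. k w = reflection (sphere_map A w)"
    have "k = R \<otimes>\<^bsub>BijGroup \<bool>\<^esub> T"
    proof (rule extensionalityI [of _ \<bool>])
      show "k \<in> extensional \<bool>" "R \<otimes>\<^bsub>BijGroup \<bool>\<^esub> T \<in> extensional \<bool>"
        using carr k sub.m_closed [OF R(2) T(2)] by (auto dest: Bij_imp_extensional)
      fix w assume w: "w \<in> \<bool>"
      show "k w = (R \<otimes>\<^bsub>BijGroup \<bool>\<^esub> T) w"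
        unfolding mult [OF R(2) T(2) w]
        using * w riem_isometriesD(6) [OF T(2) w] by (simp add: R_def T_def)
    qed
    then show ?thesis
      using R(1) T(1) by (simp add: generate.incl generate.eng)
  qed
  have "f = inv\<^bsub>BijGroup \<bool>\<^esub> M \<otimes>\<^bsub>BijGroup \<bool>\<^esub> k"
    unfolding k_def using M(2) f sub.mem_carrier by (simp add: m_assoc [symmetric])
  then show ?thesis
    using kg M(1) by (metis generate.eng generate.inv)
qed

theorem theorem1p1:
  shows "(\<forall>p\<in>\<bool>. \<forall>q\<in>\<bool>. length_metric \<bool> hardy_dist p q = riem_dist \<bool> hardy_metric p q)
    \<and> (\<forall>l\<in>{-1<..<1}. \<forall>q\<in>\<bool>. quat_moebius l q = (q - of_real l) / (1 - of_real l * q))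
    \<and> riem_isometries \<bool> hardy_metric = generate (BijGroup \<bool>) generators"
proof (intro conjI ballI)
  show "length_metric \<bool> hardy_dist p q = riem_dist \<bool> hardy_metric p q" for p q
    by (rule length_metric_eq_riem_dist)
  show "quat_moebius l q = (q - of_real l) / (1 - of_real l * q)" if "l \<in> {-1<..<1}" "q \<in> \<bool>" for l q
    using that by (intro quat_moebius_eq) auto
  show "riem_isometries \<bool> hardy_metric = generate (BijGroup \<bool>) generators"
  proof
    show "riem_isometries \<bool> hardy_metric \<subseteq> generate (BijGroup \<bool>) generators"
      using isometry_in_generate by blast
    show "generate (BijGroup \<bool>) generators \<subseteq> riem_isometries \<bool> hardy_metric"
      by (rule group.generate_subgroup_incl [OF group_BijGroup generators_isometries
            subgroup_riem_isometries [OF open_quat_ball]])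
  qed
qed

end
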